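(* Let $\mathbf{S}$ be a symmetric monoidal category and let $G$ be a group. (1) The category $\mathbf{Alg}\left(\mathbb{F}\otimes\mathbb{G},\mathbf{S}\right)$ is equivalent to the category of $G$-commutative monoids in $\mathbf{S}$; (2) the category $\mathbf{Alg}\left((\mathbb{F}\otimes\mathbb{G})^{op},\mathbf{S}\right)$ is equivalent to the category of $G$-cocommutative comonoids in $\mathbf{S}$.
   Context: For $n\geq 1$, $\underline{n}=\{1,\dots,n\}$, and $\underline{0}=\emptyset$. A PROP is a symmetric strict monoidal category whose objects are the sets $\underline{n}$, $n\ge 0$, with tensor product of objects given by addition. For a PROP $T$ and a symmetric monoidal category $\mathbf{S}$, $\mathbf{Alg}(T,\mathbf{S})$ is the category of symmetric strict monoidal functors $T\to\mathbf{S}$ and natural transformations. The PROP $\mathbb{F}\otimes\mathbb{G}$ has objects $\underline{n}$; a morphism $\underline{n}\to\underline{m}$ is a pair $(f,x)$ with $f:\underline{n}\to\underline{m}$ a map of sets and $x=(x_1,\dots,x_n)\in G^n$. Composition is $(f_2,y)\circ(f_1,x)=\big(f_2\circ f_1,\ (y_{f_1(1)}x_1,\dots,y_{f_1(n)}x_n)\big)$. The tensor product is disjoint union (juxtaposition) and the symmetries are the block permutations with trivial labels. The opposite category has the inherited symmetric monoidal structure. A $G$-commutative monoid in $\mathbf{S}$ is a functor from $G$ (viewed as a one-object category) to the category of commutative monoids in $\mathbf{S}$; a $G$-cocommutative comonoid is a functor from $G$ to the category of cocommutative comonoids in $\mathbf{S}$; morphisms are natural transformations.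
   Formalization: Natural transformations in Alg are taken to be monoidal, and for non-strict S the functors are symmetric monoidal up to coherent isomorphism; for strict S the version with literally strict symmetric monoidal functors is also proved. *)

theory Defs
  imports "HOL-Algebra.Group"
begin

section \<open>Categories, functors, natural transformations, equivalences\<close>

record ('o, 'm) cat =
  Ob :: "'o set"
  Arr :: "'m set"
  Dom :: "'m \<Rightarrow> 'o"
  Cod :: "'m \<Rightarrow> 'o"
  Id :: "'o \<Rightarrow> 'm"
  Cmp :: "'m \<Rightarrow> 'm \<Rightarrow> 'm"  (infixr \<open>\<cdot>\<index>\<close> 65)

definition Hom :: "('o, 'm, 'x) cat_scheme \<Rightarrow> 'o \<Rightarrow> 'o \<Rightarrow> 'm set"
  where "Hom C a b = {f \<in> Arr C. Dom C f = a \<and> Cod C f = b}"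

locale category =
  fixes C :: "('o, 'm, 'x) cat_scheme" (structure)
  assumes Dom_Ob: "f \<in> Arr C \<Longrightarrow> Dom C f \<in> Ob C"
    and Cod_Ob: "f \<in> Arr C \<Longrightarrow> Cod C f \<in> Ob C"
    and Id_Hom: "a \<in> Ob C \<Longrightarrow> Id C a \<in> Hom C a a"
    and Cmp_Hom: "\<lbrakk>f \<in> Hom C a b; g \<in> Hom C b c\<rbrakk> \<Longrightarrow> g \<cdot> f \<in> Hom C a c"
    and Id_left: "f \<in> Hom C a b \<Longrightarrow> Id C b \<cdot> f = f"
    and Id_right: "f \<in> Hom C a b \<Longrightarrow> f \<cdot> Id C a = f"
    and Cmp_assoc:
      "\<lbrakk>f \<in> Hom C a b; g \<in> Hom C b c; h \<in> Hom C c d\<rbrakk> \<Longrightarrow> (h \<cdot> g) \<cdot> f = h \<cdot> (g \<cdot> f)"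

definition inverse_arrows :: "('o, 'm, 'x) cat_scheme \<Rightarrow> 'm \<Rightarrow> 'm \<Rightarrow> bool"
  where "inverse_arrows C f g \<longleftrightarrow>
    f \<in> Arr C \<and> g \<in> Hom C (Cod C f) (Dom C f) \<and>
    Cmp C g f = Id C (Dom C f) \<and> Cmp C f g = Id C (Cod C f)"

definition iso_arr :: "('o, 'm, 'x) cat_scheme \<Rightarrow> 'm \<Rightarrow> bool"
  where "iso_arr C f \<longleftrightarrow> (\<exists>g. inverse_arrows C f g)"

definition inv_arr :: "('o, 'm, 'x) cat_scheme \<Rightarrow> 'm \<Rightarrow> 'm"
  where "inv_arr C f = (THE g. inverse_arrows C f g)"

record ('o1, 'm1, 'o2, 'm2) cfunctor =
  FO :: "'o1 \<Rightarrow> 'o2"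
  FA :: "'m1 \<Rightarrow> 'm2"

text \<open>The extensionality conditions only ensure that a functor is determined by its values on
  the objects and arrows of its source.\<close>

locale cat_functor =
  source: category C + target: category D
  for C :: "('o1, 'm1, 'x) cat_scheme" and D :: "('o2, 'm2, 'y) cat_scheme" +
  fixes F :: "('o1, 'm1, 'o2, 'm2, 'z) cfunctor_scheme"
  assumes FO_ext: "FO F \<in> extensional (Ob C)"
    and FA_ext: "FA F \<in> extensional (Arr C)"
    and FO_Ob: "a \<in> Ob C \<Longrightarrow> FO F a \<in> Ob D"
    and FA_Hom: "f \<in> Hom C a b \<Longrightarrow> FA F f \<in> Hom D (FO F a) (FO F b)"
    and FA_Id: "a \<in> Ob C \<Longrightarrow> FA F (Id C a) = Id D (FO F a)"
    and FA_Cmp: "\<lbrakk>f \<in> Hom C a b; g \<in> Hom C b c\<rbrakk> \<Longrightarrow>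
      FA F (g \<cdot>\<^bsub>C\<^esub> f) = FA F g \<cdot>\<^bsub>D\<^esub> FA F f"

definition id_functor :: "('o, 'm, 'x) cat_scheme \<Rightarrow> ('o, 'm, 'o, 'm) cfunctor"
  where "id_functor C = \<lparr>FO = restrict (\<lambda>a. a) (Ob C), FA = restrict (\<lambda>f. f) (Arr C)\<rparr>"

definition comp_functor :: "('o1, 'm1, 'x) cat_scheme \<Rightarrow>
    ('o2, 'm2, 'o3, 'm3, 'y) cfunctor_scheme \<Rightarrow> ('o1, 'm1, 'o2, 'm2, 'z) cfunctor_scheme \<Rightarrow>
    ('o1, 'm1, 'o3, 'm3) cfunctor"
  where "comp_functor C K F =
    \<lparr>FO = restrict (\<lambda>a. FO K (FO F a)) (Ob C), FA = restrict (\<lambda>f. FA K (FA F f)) (Arr C)\<rparr>"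

definition nat_transf :: "('o1, 'm1, 'x) cat_scheme \<Rightarrow> ('o2, 'm2, 'y) cat_scheme \<Rightarrow>
    ('o1, 'm1, 'o2, 'm2, 'z) cfunctor_scheme \<Rightarrow> ('o1 \<Rightarrow> 'm2) \<Rightarrow>
    ('o1, 'm1, 'o2, 'm2, 'z) cfunctor_scheme \<Rightarrow> bool"
  where "nat_transf C D F \<theta> F' \<longleftrightarrow>
    \<theta> \<in> extensional (Ob C) \<and>
    (\<forall>a \<in> Ob C. \<theta> a \<in> Hom D (FO F a) (FO F' a)) \<and>
    (\<forall>f \<in> Arr C. \<theta> (Cod C f) \<cdot>\<^bsub>D\<^esub> FA F f = FA F' f \<cdot>\<^bsub>D\<^esub> \<theta> (Dom C f))"

definition naturally_isomorphic :: "('o1, 'm1, 'x) cat_scheme \<Rightarrow> ('o2, 'm2, 'y) cat_scheme \<Rightarrow>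
    ('o1, 'm1, 'o2, 'm2, 'z) cfunctor_scheme \<Rightarrow>
    ('o1, 'm1, 'o2, 'm2, 'z) cfunctor_scheme \<Rightarrow> bool"
  where "naturally_isomorphic C D F F' \<longleftrightarrow>
    (\<exists>\<theta>. nat_transf C D F \<theta> F' \<and> (\<forall>a \<in> Ob C. iso_arr D (\<theta> a)))"

definition equivalent_categories ::
    "('o1, 'm1, 'x) cat_scheme \<Rightarrow> ('o2, 'm2, 'y) cat_scheme \<Rightarrow> bool"
  where "equivalent_categories C D \<longleftrightarrow>
    category C \<and> category D \<and>
    (\<exists>(F :: ('o1, 'm1, 'o2, 'm2) cfunctor) (K :: ('o2, 'm2, 'o1, 'm1) cfunctor).
      cat_functor C D F \<and> cat_functor D C K \<and>
      naturally_isomorphic C C (comp_functor C K F) (id_functor C) \<and>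
      naturally_isomorphic D D (comp_functor D F K) (id_functor D))"

text \<open>The category whose objects are the functors in \<open>Fs\<close> and whose arrows are the natural
  transformations satisfying \<open>P\<close>, tagged with their source and target functor; composition is
  componentwise.\<close>

definition transf_category :: "('o1, 'm1, 'x) cat_scheme \<Rightarrow> ('o2, 'm2, 'y) cat_scheme \<Rightarrow>
    ('o1, 'm1, 'o2, 'm2, 'z) cfunctor_scheme set \<Rightarrow>
    (('o1, 'm1, 'o2, 'm2, 'z) cfunctor_scheme \<Rightarrow> ('o1 \<Rightarrow> 'm2) \<Rightarrow>
      ('o1, 'm1, 'o2, 'm2, 'z) cfunctor_scheme \<Rightarrow> bool) \<Rightarrow>
    (('o1, 'm1, 'o2, 'm2, 'z) cfunctor_scheme,
     ('o1, 'm1, 'o2, 'm2, 'z) cfunctor_scheme \<times> ('o1 \<Rightarrow> 'm2) \<times>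
       ('o1, 'm1, 'o2, 'm2, 'z) cfunctor_scheme) cat"
  where "transf_category C D Fs P =
    \<lparr>Ob = Fs,
     Arr = {(F, \<theta>, F'). F \<in> Fs \<and> F' \<in> Fs \<and> nat_transf C D F \<theta> F' \<and> P F \<theta> F'},
     Dom = (\<lambda>(F, \<theta>, F'). F),
     Cod = (\<lambda>(F, \<theta>, F'). F'),
     Id = (\<lambda>F. (F, restrict (\<lambda>a. Id D (FO F a)) (Ob C), F)),
     Cmp = (\<lambda>(E', \<psi>, E'') (F, \<theta>, F'). (F, restrict (\<lambda>a. \<psi> a \<cdot>\<^bsub>D\<^esub> \<theta> a) (Ob C), E''))\<rparr>"

definition functor_category :: "('o1, 'm1, 'x) cat_scheme \<Rightarrow> ('o2, 'm2, 'y) cat_scheme \<Rightarrow>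
    (('o1, 'm1, 'o2, 'm2) cfunctor,
     ('o1, 'm1, 'o2, 'm2) cfunctor \<times> ('o1 \<Rightarrow> 'm2) \<times> ('o1, 'm1, 'o2, 'm2) cfunctor) cat"
  where "functor_category C D = transf_category C D {F. cat_functor C D F} (\<lambda>F \<theta> F'. True)"


section \<open>Symmetric monoidal categories and functors\<close>

record ('o, 'm) smc = "('o, 'm) cat" +
  tensO :: "'o \<Rightarrow> 'o \<Rightarrow> 'o"  (infixr \<open>\<boxtimes>\<index>\<close> 70)
  tensA :: "'m \<Rightarrow> 'm \<Rightarrow> 'm"  (infixr \<open>\<odot>\<index>\<close> 70)
  unitO :: "'o"
  asc :: "'o \<Rightarrow> 'o \<Rightarrow> 'o \<Rightarrow> 'm"
  lun :: "'o \<Rightarrow> 'm"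
  run :: "'o \<Rightarrow> 'm"
  sym :: "'o \<Rightarrow> 'o \<Rightarrow> 'm"

locale symmetric_monoidal_category = category S
  for S :: "('o, 'm, 'x) smc_scheme" (structure) +
  assumes unitO_Ob: "unitO S \<in> Ob S"
    and tensO_Ob: "\<lbrakk>a \<in> Ob S; b \<in> Ob S\<rbrakk> \<Longrightarrow> a \<boxtimes> b \<in> Ob S"
    and tensA_Hom: "\<lbrakk>f \<in> Hom S a b; g \<in> Hom S c d\<rbrakk> \<Longrightarrow> f \<odot> g \<in> Hom S (a \<boxtimes> c) (b \<boxtimes> d)"
    and tensA_Id: "\<lbrakk>a \<in> Ob S; b \<in> Ob S\<rbrakk> \<Longrightarrow> Id S a \<odot> Id S b = Id S (a \<boxtimes> b)"
    and tensA_Cmp: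
      "\<lbrakk>f \<in> Hom S a b; f' \<in> Hom S b c; g \<in> Hom S a' b'; g' \<in> Hom S b' c'\<rbrakk> \<Longrightarrow>
        (f' \<cdot> f) \<odot> (g' \<cdot> g) = (f' \<odot> g') \<cdot> (f \<odot> g)"
    and asc_Hom: "\<lbrakk>a \<in> Ob S; b \<in> Ob S; c \<in> Ob S\<rbrakk> \<Longrightarrow>
        asc S a b c \<in> Hom S ((a \<boxtimes> b) \<boxtimes> c) (a \<boxtimes> (b \<boxtimes> c))"
    and asc_iso: "\<lbrakk>a \<in> Ob S; b \<in> Ob S; c \<in> Ob S\<rbrakk> \<Longrightarrow> iso_arr S (asc S a b c)"
    and asc_nat: "\<lbrakk>f \<in> Hom S a a'; g \<in> Hom S b b'; h \<in> Hom S c c'\<rbrakk> \<Longrightarrow>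
        asc S a' b' c' \<cdot> ((f \<odot> g) \<odot> h) = (f \<odot> (g \<odot> h)) \<cdot> asc S a b c"
    and lun_Hom: "a \<in> Ob S \<Longrightarrow> lun S a \<in> Hom S (unitO S \<boxtimes> a) a"
    and lun_iso: "a \<in> Ob S \<Longrightarrow> iso_arr S (lun S a)"
    and lun_nat: "f \<in> Hom S a b \<Longrightarrow> lun S b \<cdot> (Id S (unitO S) \<odot> f) = f \<cdot> lun S a"
    and run_Hom: "a \<in> Ob S \<Longrightarrow> run S a \<in> Hom S (a \<boxtimes> unitO S) a"
    and run_iso: "a \<in> Ob S \<Longrightarrow> iso_arr S (run S a)"
    and run_nat: "f \<in> Hom S a b \<Longrightarrow> run S b \<cdot> (f \<odot> Id S (unitO S)) = f \<cdot> run S a"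
    and sym_Hom: "\<lbrakk>a \<in> Ob S; b \<in> Ob S\<rbrakk> \<Longrightarrow> sym S a b \<in> Hom S (a \<boxtimes> b) (b \<boxtimes> a)"
    and sym_nat: "\<lbrakk>f \<in> Hom S a a'; g \<in> Hom S b b'\<rbrakk> \<Longrightarrow>
        sym S a' b' \<cdot> (f \<odot> g) = (g \<odot> f) \<cdot> sym S a b"
    and sym_sym: "\<lbrakk>a \<in> Ob S; b \<in> Ob S\<rbrakk> \<Longrightarrow> sym S b a \<cdot> sym S a b = Id S (a \<boxtimes> b)"
    and pentagon: "\<lbrakk>a \<in> Ob S; b \<in> Ob S; c \<in> Ob S; d \<in> Ob S\<rbrakk> \<Longrightarrow>
        asc S a b (c \<boxtimes> d) \<cdot> asc S (a \<boxtimes> b) c d =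
        (Id S a \<odot> asc S b c d) \<cdot> asc S a (b \<boxtimes> c) d \<cdot> (asc S a b c \<odot> Id S d)"
    and triangle: "\<lbrakk>a \<in> Ob S; b \<in> Ob S\<rbrakk> \<Longrightarrow>
        (Id S a \<odot> lun S b) \<cdot> asc S a (unitO S) b = run S a \<odot> Id S b"
    and hexagon: "\<lbrakk>a \<in> Ob S; b \<in> Ob S; c \<in> Ob S\<rbrakk> \<Longrightarrow>
        asc S b c a \<cdot> sym S a (b \<boxtimes> c) \<cdot> asc S a b c =
        (Id S b \<odot> sym S a c) \<cdot> asc S b a c \<cdot> (sym S a b \<odot> Id S c)"

locale symmetric_strict_monoidal_category = symmetric_monoidal_category S
  for S :: "('o, 'm, 'x) smc_scheme" (structure) +
  assumes strict_asc: "\<lbrakk>a \<in> Ob S; b \<in> Ob S; c \<in> Ob S\<rbrakk> \<Longrightarrow>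
        (a \<boxtimes> b) \<boxtimes> c = a \<boxtimes> (b \<boxtimes> c) \<and> asc S a b c = Id S (a \<boxtimes> (b \<boxtimes> c))"
    and strict_lun: "a \<in> Ob S \<Longrightarrow> unitO S \<boxtimes> a = a \<and> lun S a = Id S a"
    and strict_run: "a \<in> Ob S \<Longrightarrow> a \<boxtimes> unitO S = a \<and> run S a = Id S a"

definition op_smc :: "('o, 'm, 'x) smc_scheme \<Rightarrow> ('o, 'm) smc"
  where "op_smc S =
    \<lparr>Ob = Ob S, Arr = Arr S, Dom = Cod S, Cod = Dom S, Id = Id S,
     Cmp = (\<lambda>g f. f \<cdot>\<^bsub>S\<^esub> g),
     tensO = tensO S, tensA = tensA S, unitO = unitO S,
     asc = (\<lambda>a b c. inv_arr S (asc S a b c)),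
     lun = (\<lambda>a. inv_arr S (lun S a)),
     run = (\<lambda>a. inv_arr S (run S a)),
     sym = (\<lambda>a b. inv_arr S (sym S a b))\<rparr>"

text \<open>Functors preserving the whole symmetric monoidal structure on the nose.\<close>

locale symmetric_strict_monoidal_functor =
  cat_functor T S F +
  source: symmetric_monoidal_category T + target: symmetric_monoidal_category S
  for T :: "('o1, 'm1, 'x) smc_scheme" and S :: "('o2, 'm2, 'y) smc_scheme"
    and F :: "('o1, 'm1, 'o2, 'm2) cfunctor" +
  assumes strict_tensO:
      "\<lbrakk>a \<in> Ob T; b \<in> Ob T\<rbrakk> \<Longrightarrow> FO F (a \<boxtimes>\<^bsub>T\<^esub> b) = FO F a \<boxtimes>\<^bsub>S\<^esub> FO F b"
    and strict_unitO: "FO F (unitO T) = unitO S"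
    and strict_tensA:
      "\<lbrakk>f \<in> Arr T; g \<in> Arr T\<rbrakk> \<Longrightarrow> FA F (f \<odot>\<^bsub>T\<^esub> g) = FA F f \<odot>\<^bsub>S\<^esub> FA F g"
    and strict_FA_asc: "\<lbrakk>a \<in> Ob T; b \<in> Ob T; c \<in> Ob T\<rbrakk> \<Longrightarrow>
        FA F (asc T a b c) = asc S (FO F a) (FO F b) (FO F c)"
    and strict_FA_lun: "a \<in> Ob T \<Longrightarrow> FA F (lun T a) = lun S (FO F a)"
    and strict_FA_run: "a \<in> Ob T \<Longrightarrow> FA F (run T a) = run S (FO F a)"
    and strict_FA_sym:
      "\<lbrakk>a \<in> Ob T; b \<in> Ob T\<rbrakk> \<Longrightarrow> FA F (sym T a b) = sym S (FO F a) (FO F b)"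

text \<open>Functors preserving the structure up to specified coherent isomorphisms
  \<open>phi (a, b) : F a \<boxtimes> F b \<rightarrow> F (a \<boxtimes> b)\<close> and \<open>phi0 : I \<rightarrow> F I\<close>.\<close>

record ('o1, 'm1, 'o2, 'm2) mfunctor = "('o1, 'm1, 'o2, 'm2) cfunctor" +
  phi :: "'o1 \<times> 'o1 \<Rightarrow> 'm2"
  phi0 :: "'m2"

locale symmetric_monoidal_functor =
  cat_functor T S F +
  source: symmetric_monoidal_category T + target: symmetric_monoidal_category S
  for T :: "('o1, 'm1, 'x) smc_scheme" and S :: "('o2, 'm2, 'y) smc_scheme"
    and F :: "('o1, 'm1, 'o2, 'm2) mfunctor" +
  assumes phi_ext: "phi F \<in> extensional (Ob T \<times> Ob T)"
    and phi_Hom: "\<lbrakk>a \<in> Ob T; b \<in> Ob T\<rbrakk> \<Longrightarrow>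
        phi F (a, b) \<in> Hom S (FO F a \<boxtimes>\<^bsub>S\<^esub> FO F b) (FO F (a \<boxtimes>\<^bsub>T\<^esub> b))"
    and phi_iso: "\<lbrakk>a \<in> Ob T; b \<in> Ob T\<rbrakk> \<Longrightarrow> iso_arr S (phi F (a, b))"
    and phi0_Hom: "phi0 F \<in> Hom S (unitO S) (FO F (unitO T))"
    and phi0_iso: "iso_arr S (phi0 F)"
    and phi_nat: "\<lbrakk>f \<in> Hom T a a'; g \<in> Hom T b b'\<rbrakk> \<Longrightarrow>
        phi F (a', b') \<cdot>\<^bsub>S\<^esub> (FA F f \<odot>\<^bsub>S\<^esub> FA F g) = FA F (f \<odot>\<^bsub>T\<^esub> g) \<cdot>\<^bsub>S\<^esub> phi F (a, b)"
    and phi_asc: "\<lbrakk>a \<in> Ob T; b \<in> Ob T; c \<in> Ob T\<rbrakk> \<Longrightarrow>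
        FA F (asc T a b c) \<cdot>\<^bsub>S\<^esub> phi F (a \<boxtimes>\<^bsub>T\<^esub> b, c) \<cdot>\<^bsub>S\<^esub> (phi F (a, b) \<odot>\<^bsub>S\<^esub> Id S (FO F c)) =
        phi F (a, b \<boxtimes>\<^bsub>T\<^esub> c) \<cdot>\<^bsub>S\<^esub> (Id S (FO F a) \<odot>\<^bsub>S\<^esub> phi F (b, c)) \<cdot>\<^bsub>S\<^esub>
          asc S (FO F a) (FO F b) (FO F c)"
    and phi_lun: "a \<in> Ob T \<Longrightarrow>
        FA F (lun T a) \<cdot>\<^bsub>S\<^esub> phi F (unitO T, a) \<cdot>\<^bsub>S\<^esub> (phi0 F \<odot>\<^bsub>S\<^esub> Id S (FO F a)) =
        lun S (FO F a)"
    and phi_run: "a \<in> Ob T \<Longrightarrow>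
        FA F (run T a) \<cdot>\<^bsub>S\<^esub> phi F (a, unitO T) \<cdot>\<^bsub>S\<^esub> (Id S (FO F a) \<odot>\<^bsub>S\<^esub> phi0 F) =
        run S (FO F a)"
    and phi_sym: "\<lbrakk>a \<in> Ob T; b \<in> Ob T\<rbrakk> \<Longrightarrow>
        FA F (sym T a b) \<cdot>\<^bsub>S\<^esub> phi F (a, b) = phi F (b, a) \<cdot>\<^bsub>S\<^esub> sym S (FO F a) (FO F b)"

text \<open>Algebras.  Transformations between monoidal functors are required to be compatible with
  the tensor product, as always for monoidal functors; without this condition a transformation
  is not determined by its component at the generating object of a PROP.

  \<open>Alg_strict\<close> uses functors that are strict in the literal sense, which is meaningful for
  strict \<open>S\<close>: a strict functor from a PROP to \<open>S\<close> forces
  \<open>(X \<boxtimes> X) \<boxtimes> X = X \<boxtimes> (X \<boxtimes> X)\<close> and \<open>I \<boxtimes> X = X\<close> for the image \<open>X\<close> of the generating object,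
  with identity constraints.  For general \<open>S\<close>, where these equations hold only up to the
  constraints of \<open>S\<close>, \<open>Alg\<close> uses functors preserving the structure up to coherent
  isomorphism.\<close>

definition Alg_strict :: "('o1, 'm1, 'x) smc_scheme \<Rightarrow> ('o2, 'm2, 'y) smc_scheme \<Rightarrow>
    (('o1, 'm1, 'o2, 'm2) cfunctor,
     ('o1, 'm1, 'o2, 'm2) cfunctor \<times> ('o1 \<Rightarrow> 'm2) \<times> ('o1, 'm1, 'o2, 'm2) cfunctor) cat"
  where "Alg_strict T S =
    transf_category T S {F. symmetric_strict_monoidal_functor T S F}
      (\<lambda>F \<theta> F'.
        (\<forall>a \<in> Ob T. \<forall>b \<in> Ob T. \<theta> (a \<boxtimes>\<^bsub>T\<^esub> b) = \<theta> a \<odot>\<^bsub>S\<^esub> \<theta> b) \<and>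
        \<theta> (unitO T) = Id S (unitO S))"

definition Alg :: "('o1, 'm1, 'x) smc_scheme \<Rightarrow> ('o2, 'm2, 'y) smc_scheme \<Rightarrow>
    (('o1, 'm1, 'o2, 'm2) mfunctor,
     ('o1, 'm1, 'o2, 'm2) mfunctor \<times> ('o1 \<Rightarrow> 'm2) \<times> ('o1, 'm1, 'o2, 'm2) mfunctor) cat"
  where "Alg T S =
    transf_category T S {F. symmetric_monoidal_functor T S F}
      (\<lambda>F \<theta> F'.
        (\<forall>a \<in> Ob T. \<forall>b \<in> Ob T.
          \<theta> (a \<boxtimes>\<^bsub>T\<^esub> b) \<cdot>\<^bsub>S\<^esub> phi F (a, b) = phi F' (a, b) \<cdot>\<^bsub>S\<^esub> (\<theta> a \<odot>\<^bsub>S\<^esub> \<theta> b)) \<and>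
        \<theta> (unitO T) \<cdot>\<^bsub>S\<^esub> phi0 F = phi0 F')"


section \<open>The PROP of finite sets with labels in a group\<close>

text \<open>The object \<open>n\<close> stands for the set \<open>{1..n}\<close>.\<close>

locale prop_cat = symmetric_strict_monoidal_category T
  for T :: "(nat, 'm, 'x) smc_scheme" +
  assumes prop_cat_Ob: "Ob T = UNIV"
    and prop_cat_tensO: "tensO T m n = m + n"
    and prop_cat_unitO: "unitO T = 0"

text \<open>The arrow \<open>(n, m, f, x)\<close> is the pair \<open>(f, x)\<close> regarded as an arrow from \<open>n\<close> to \<open>m\<close>.\<close>

type_synonym 'g FG_arr = "nat \<times> nat \<times> (nat \<Rightarrow> nat) \<times> (nat \<Rightarrow> 'g)"

definition FG :: "('g, 'b) monoid_scheme \<Rightarrow> (nat, 'g FG_arr) smc"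
  where "FG G =
    \<lparr>Ob = UNIV,
     Arr = {(n, m, f, x). f \<in> {1..n} \<rightarrow>\<^sub>E {1..m} \<and> x \<in> {1..n} \<rightarrow>\<^sub>E carrier G},
     Dom = (\<lambda>(n, m, f, x). n),
     Cod = (\<lambda>(n, m, f, x). m),
     Id = (\<lambda>n. (n, n, \<lambda>i\<in>{1..n}. i, \<lambda>i\<in>{1..n}. \<one>\<^bsub>G\<^esub>)),
     Cmp = (\<lambda>(m', k, f2, y) (n, m, f1, x).
       (n, k, \<lambda>i\<in>{1..n}. f2 (f1 i), \<lambda>i\<in>{1..n}. y (f1 i) \<otimes>\<^bsub>G\<^esub> x i)),
     tensO = (+),
     tensA = (\<lambda>(n, m, f, x) (n', m', f', x').
       (n + n', m + m',
        \<lambda>i\<in>{1..n + n'}. if i \<le> n then f i else m + f' (i - n),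
        \<lambda>i\<in>{1..n + n'}. if i \<le> n then x i else x' (i - n))),
     unitO = 0,
     asc = (\<lambda>a b c. (a + b + c, a + b + c, \<lambda>i\<in>{1..a + b + c}. i, \<lambda>i\<in>{1..a + b + c}. \<one>\<^bsub>G\<^esub>)),
     lun = (\<lambda>n. (n, n, \<lambda>i\<in>{1..n}. i, \<lambda>i\<in>{1..n}. \<one>\<^bsub>G\<^esub>)),
     run = (\<lambda>n. (n, n, \<lambda>i\<in>{1..n}. i, \<lambda>i\<in>{1..n}. \<one>\<^bsub>G\<^esub>)),
     sym = (\<lambda>n m. (n + m, m + n,
       \<lambda>i\<in>{1..n + m}. if i \<le> n then m + i else i - n,
       \<lambda>i\<in>{1..n + m}. \<one>\<^bsub>G\<^esub>))\<rparr>"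

lemma FG_Hom: "(p \<in> Hom (FG G) n m) \<longleftrightarrow> (\<exists>f x. p = (n, m, f, x) \<and> f \<in> {1..n} \<rightarrow>\<^sub>E {1..m} \<and> x \<in> {1..n} \<rightarrow>\<^sub>E carrier G)"
  by (cases p) (simp add: Hom_def FG_def, blast)

definition FG_id :: "('g, 'b) monoid_scheme \<Rightarrow> nat \<Rightarrow> 'g FG_arr"
  where "FG_id G n = (n::nat, n, \<lambda>i\<in>{1..n}. i, \<lambda>i\<in>{1..n}. \<one>\<^bsub>G\<^esub>)"

lemma FG_sel:
  "Ob (FG G) = UNIV" "tensO (FG G) n m = n + m" "unitO (FG G) = 0"
  "asc (FG G) a b c = FG_id G (a + b + c)" "lun (FG G) a = FG_id G a" "run (FG G) a = FG_id G a" "Id (FG G) n = FG_id G n"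
  by (auto simp: FG_def FG_id_def)

lemma FG_Cmp: "Cmp (FG G) (m', k, f2, y) (n, m, f1, x) =
       (n, k, \<lambda>i\<in>{1..n}. f2 (f1 i), \<lambda>i\<in>{1..n}. y (f1 i) \<otimes>\<^bsub>G\<^esub> x i)" by (simp add: FG_def)
lemma FG_tensA: "tensA (FG G) (n, m, f, x) (n', m', f', x') =
       (n + n', m + m',
        \<lambda>i\<in>{1..n + n'}. if i \<le> n then f i else m + f' (i - n),
        \<lambda>i\<in>{1..n + n'}. if i \<le> n then x i else x' (i - n))" by (simp add: FG_def)
lemma FG_sym: "sym (FG G) n m = (n + m, m + n,
       \<lambda>i\<in>{1..n + m}. if i \<le> n then m + i else i - n,
       \<lambda>i\<in>{1..n + m}. \<one>\<^bsub>G\<^esub>)" by (simp add: FG_def)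

lemma FG_eqI: assumes "n = n'" "m = m'" "f \<in> extensional {1..n}" "f' \<in> extensional {1..n}" "x \<in> extensional {1..n}" "x' \<in> extensional {1..n}"
  "\<And>i. 1 \<le> i \<Longrightarrow> i \<le> n \<Longrightarrow> f i = f' i" "\<And>i. 1 \<le> i \<Longrightarrow> i \<le> n \<Longrightarrow> x i = x' i"
  shows "(n, m, f, x) = (n', m', f', x')"
  using assms by (auto intro!: extensionalityI[of _ "{1..n}"])

lemma restrict_eqI: "f \<in> extensional A \<Longrightarrow> (\<And>i. i \<in> A \<Longrightarrow> h i = f i) \<Longrightarrow> restrict h A = f"
  by (auto intro!: extensionalityI[of _ A])

lemma PiE_interval_iff: "f \<in> {1..n} \<rightarrow>\<^sub>E B \<longleftrightarrow> f \<in> extensional {1..n} \<and> (\<forall>i. 1 \<le> i \<and> i \<le> n \<longrightarrow> f i \<in> B)" 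
  by (auto simp: PiE_def)

lemma prop_cat_FG:
  assumes "group G" shows "prop_cat (FG G)"
proof -
  interpret group G by fact
  have idH: "FG_id G n \<in> Hom (FG G) n n" for n by (auto simp: FG_Hom FG_id_def)
  have idl: "Cmp (FG G) (FG_id G m) p = p" if "p \<in> Hom (FG G) n m" for p n m
    using that unfolding FG_Hom by (auto simp: FG_Cmp FG_id_def PiE_interval_iff simp del: One_nat_def intro!: restrict_eqI)
  have idr: "Cmp (FG G) p (FG_id G n) = p" if "p \<in> Hom (FG G) n m" for p n m
    using that unfolding FG_Hom by (auto simp: FG_Cmp FG_id_def PiE_interval_iff simp del: One_nat_def intro!: restrict_eqI)
  have idi: "iso_arr (FG G) (FG_id G n)" for n
    unfolding iso_arr_def inverse_arrows_def using idH[of n] idl[OF idH[of n]] by (intro exI[of _ "FG_id G n"]) (auto simp: Hom_def FG_sel)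
  have tH: "tensA (FG G) p q \<in> Hom (FG G) (a + c) (b + d)" if pq: "p \<in> Hom (FG G) a b" "q \<in> Hom (FG G) c d" for p q a b c d
  proof -
    have k: "\<not> i \<le> a \<Longrightarrow> i \<le> a + c \<Longrightarrow> 1 \<le> i - a \<and> i - a \<le> c" for i by auto
    obtain f x g y where p: "p = (a, b, f, x)" "f \<in> {1..a} \<rightarrow>\<^sub>E {1..b}" "x \<in> {1..a} \<rightarrow>\<^sub>E carrier G" 
      and q: "q = (c, d, g, y)" "g \<in> {1..c} \<rightarrow>\<^sub>E {1..d}" "y \<in> {1..c} \<rightarrow>\<^sub>E carrier G"
      using pq unfolding FG_Hom by blast
    have "1 \<le> i \<Longrightarrow> i \<le> a + c \<Longrightarrow> (if i \<le> a then f i else b + g (i - a)) \<in> {1..b+d}" for i 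
      using p(2) q(2) k[of i] unfolding PiE_interval_iff by (cases "i \<le> a") (auto simp: trans_le_add1 trans_le_add2 simp del: One_nat_def)
    moreover have "1 \<le> i \<Longrightarrow> i \<le> a + c \<Longrightarrow> (if i \<le> a then x i else y (i - a)) \<in> carrier G" for i 
      using p(3) q(3) k[of i] unfolding PiE_interval_iff by (cases "i \<le> a") auto
    ultimately show ?thesis unfolding p q FG_tensA FG_Hom by (simp add: PiE_interval_iff del: One_nat_def)
  qed
  have tI: "tensA (FG G) (FG_id G a) (FG_id G b) = FG_id G (a + b)" for a b
    by (auto simp: FG_tensA FG_id_def simp del: One_nat_def intro!: restrict_eqI)
  have tA: "tensA (FG G) (tensA (FG G) p q) r = tensA (FG G) p (tensA (FG G) q r)" for p q r
    by (cases p; cases q; cases r) (auto simp: FG_tensA  simp del: One_nat_def intro!: restrict_eqI)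
  have tu: "tensA (FG G) (FG_id G 0) p = p" "tensA (FG G) p (FG_id G 0) = p"  if "p \<in> Hom (FG G) a b" for p a b
    using that unfolding FG_Hom by (auto simp: FG_tensA FG_id_def PiE_interval_iff simp del: One_nat_def intro!: restrict_eqI)
  show ?thesis
  proof (unfold_locales, unfold FG_sel, goal_cases)
    case (1 f) then show ?case by (simp)
  next case (2 f) then show ?case by (simp)
  next case (3 a) show ?case by (rule idH)
  next case (4 f a b g c) then show ?case unfolding FG_Hom by (auto simp: FG_Cmp PiE_interval_iff simp del: One_nat_def)
  next case (5 f a b) then show ?case by (rule idl)
  next case (6 f a b) then show ?case by (rule idr)
  next case (7 f a b g c h d) then show ?case unfolding FG_Hom
     by (auto simp: FG_Cmp PiE_interval_iff m_assoc simp del: One_nat_def intro!: restrict_eqI)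
  next case 8 then show ?case by simp
  next case 9 then show ?case by simp
  next case (10 f a b g c d) then show ?case by (rule tH)
  next case (11 a b) show ?case by (rule tI)
  next case (12 f a b f' c g a' b' g' c')
    have k: "\<not> i \<le> a \<Longrightarrow> i \<le> a + a' \<Longrightarrow> 1 \<le> i - a \<and> i - a \<le> a'" for i by auto
    obtain p x p' x' where p: "f = (a, b, p, x)" "f' = (b, c, p', x')" "p \<in> {1..a} \<rightarrow>\<^sub>E {1..b}"
      using 12 unfolding FG_Hom by blast
    obtain q y q' y' where q: "g = (a', b', q, y)" "g' = (b', c', q', y')" "q \<in> {1..a'} \<rightarrow>\<^sub>E {1..b'}"
      using 12 unfolding FG_Hom by blast
    have r: "1 \<le> i \<Longrightarrow> i \<le> a \<Longrightarrow> 1 \<le> p i \<and> p i \<le> b \<and> p i \<le> b + b'" for i using p(3) unfolding PiE_interval_iff by (auto simp: trans_le_add1 simp del: One_nat_def)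
    have r': "\<not> i \<le> a \<Longrightarrow> i \<le> a + a' \<Longrightarrow> 1 \<le> q (i-a) \<and> q (i-a) \<le> b' \<and> 1 \<le> b + q (i - a) \<and> q (i-a) \<noteq> 0" for i
      using q(3) k[of i] unfolding PiE_interval_iff by fastforce 
    show ?case unfolding p q
      by (auto simp: FG_Cmp FG_tensA r r' k simp del: One_nat_def intro!: restrict_eqI)
  next case (13 a b c) show ?case using idH[of "a+b+c"] by (simp add: add.assoc)
  next case (14 a b c) show ?case by (rule idi)
  next case (15 f a a' g b b' h c c')
    have "tensA (FG G) (tensA (FG G) f g) h \<in> Hom (FG G) (a+b+c) (a'+b'+c')" using 15 tH by blast
    from idl[OF this] idr[OF this] show ?case by (simp add: tA)
  next case (16 a) show ?case using idH by simp
  next case (17 a) show ?case by (rule idi)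
  next case (18 f a b) then show ?case using idl[OF 18] idr[OF 18] tu[OF 18] by simp
  next case (19 a) show ?case using idH by simp
  next case (20 a) show ?case by (rule idi)
  next case (21 f a b) then show ?case using idl[OF 21] idr[OF 21] tu[OF 21] by simp
  next case (22 a b) show ?case by (auto simp: FG_sym FG_Hom)
  next case (23 f a a' g b b')
    have k: "\<not> i \<le> a \<Longrightarrow> i \<le> a + b \<Longrightarrow> 1 \<le> i - a \<and> i - a \<le> b" for i by auto
    obtain p x where p: "f = (a, a', p, x)" "p \<in> {1..a} \<rightarrow>\<^sub>E {1..a'}" "x \<in> {1..a} \<rightarrow>\<^sub>E carrier G"
      using 23 unfolding FG_Hom by blast
    obtain q y where q: "g = (b, b', q, y)" "q \<in> {1..b} \<rightarrow>\<^sub>E {1..b'}" "y \<in> {1..b} \<rightarrow>\<^sub>E carrier G"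
      using 23 unfolding FG_Hom by blast
    have r: "1 \<le> i \<Longrightarrow> i \<le> a \<Longrightarrow> 1 \<le> p i \<and> p i \<le> a' \<and> p i \<le> a' + b' \<and> x i \<in> carrier G" for i using p(2,3) unfolding PiE_interval_iff by (auto simp: trans_le_add1 simp del: One_nat_def)
    have r': "\<not> i \<le> a \<Longrightarrow> i \<le> a + b \<Longrightarrow> 1 \<le> q (i-a) \<and> q (i-a) \<le> b' \<and> 1 \<le> a' + q (i - a) \<and> q (i - a) \<noteq> 0 \<and> y (i - a) \<in> carrier G" for i
      using q(2,3) k[of i] unfolding PiE_interval_iff by fastforce 
    show ?case unfolding p q
      by (auto simp: FG_Cmp FG_tensA FG_sym r r' k simp del: One_nat_def intro!: restrict_eqI)
  next case (24 a b) show ?case by (auto simp: FG_Cmp FG_sym FG_id_def simp del: One_nat_def intro!: restrict_eqI)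
  next case (25 a b c d)
    show ?case using idl[OF idH] by (simp add: tI add.assoc)
  next case (26 a b) show ?case using idl[OF idH] by (simp add: tI)
  next case (27 a b c)
    have sH: "sym (FG G) a b \<in> Hom (FG G) (a + b) (b + a)" for a b by (auto simp: FG_sym FG_Hom)
    have L: "FG_id G (b + c + a) \<cdot>\<^bsub>FG G\<^esub> sym (FG G) a (b + c) \<cdot>\<^bsub>FG G\<^esub> FG_id G (a + b + c) = sym (FG G) a (b + c)"
      using idl[OF sH[of a "b+c"]] idr[OF sH[of a "b+c"]] by (simp add: add.assoc)
    have h: "sym (FG G) a b \<odot>\<^bsub>FG G\<^esub> FG_id G c \<in> Hom (FG G) (a + b + c) (b + a + c)" by (rule tH[OF sH idH])
    have R: "FG_id G (b + a + c) \<cdot>\<^bsub>FG G\<^esub> sym (FG G) a b \<odot>\<^bsub>FG G\<^esub> FG_id G c = sym (FG G) a b \<odot>\<^bsub>FG G\<^esub> FG_id G c"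
      by (rule idl[OF h])
    have D: "i \<le> a \<or> (\<exists>j. i = a + j \<and> 1 \<le> j \<and> j \<le> b) \<or> (\<exists>j. i = a + (b + j) \<and> 1 \<le> j \<and> j \<le> c)" if "i \<le> a + b + c" for i
    proof -
      consider "i \<le> a" | "\<not> i \<le> a" "i \<le> a + b" | "\<not> i \<le> a + b" by linarith
      then show ?thesis
      proof cases
        case 2 then have "i = a + (i - a) \<and> 1 \<le> i - a \<and> i - a \<le> b" by auto
        then show ?thesis by blast
      next case 3 then have "i = a + (b + (i - (a + b))) \<and> 1 \<le> i - (a + b) \<and> i - (a + b) \<le> c" using that by auto
        then show ?thesis by blast
      qed simp
    qed
    show ?case unfolding L R FG_sym FG_id_def FG_tensA FG_Cmp
    proof (rule FG_eqI, goal_cases)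
      case (7 i) 
      consider "i \<le> a" | j where "i = a + j" "1 \<le> j" "j \<le> b" | j where "i = a + (b + j)" "1 \<le> j" "j \<le> c"
        using D[OF 7(2)] by blast
      then show ?case using 7(1,2) by cases (simp_all del: One_nat_def)
    next case (8 i) 
      consider "i \<le> a" | j where "i = a + j" "1 \<le> j" "j \<le> b" | j where "i = a + (b + j)" "1 \<le> j" "j \<le> c"
        using D[OF 8(2)] by blast
      then show ?case using 8(1,2) by cases (simp_all del: One_nat_def)
    qed (auto simp: add.assoc)
  next case (28 a b c) show ?case by (simp add: add.assoc)
  next case (29 a) show ?case by simp
  next case (30 a) show ?case by simp
  next case 31 show ?case by simp
  next case 32 show ?case by simp
  next case 33 show ?case by simp
  qed
qed


section \<open>Commutative monoids and cocommutative comonoids with an action of a group\<close>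

record ('o, 'm) mon =
  obj :: "'o"
  mu :: "'m"
  eta :: "'m"

definition is_comm_monoid :: "('o, 'm, 'x) smc_scheme \<Rightarrow> ('o, 'm) mon \<Rightarrow> bool"
  where "is_comm_monoid S A \<longleftrightarrow>
    obj A \<in> Ob S \<and>
    mu A \<in> Hom S (obj A \<boxtimes>\<^bsub>S\<^esub> obj A) (obj A) \<and>
    eta A \<in> Hom S (unitO S) (obj A) \<and>
    mu A \<cdot>\<^bsub>S\<^esub> (mu A \<odot>\<^bsub>S\<^esub> Id S (obj A)) =
      mu A \<cdot>\<^bsub>S\<^esub> (Id S (obj A) \<odot>\<^bsub>S\<^esub> mu A) \<cdot>\<^bsub>S\<^esub> asc S (obj A) (obj A) (obj A) \<and>
    mu A \<cdot>\<^bsub>S\<^esub> (eta A \<odot>\<^bsub>S\<^esub> Id S (obj A)) = lun S (obj A) \<and>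
    mu A \<cdot>\<^bsub>S\<^esub> (Id S (obj A) \<odot>\<^bsub>S\<^esub> eta A) = run S (obj A) \<and>
    mu A \<cdot>\<^bsub>S\<^esub> sym S (obj A) (obj A) = mu A"

definition is_monoid_hom :: "('o, 'm, 'x) smc_scheme \<Rightarrow> ('o, 'm) mon \<Rightarrow> 'm \<Rightarrow> ('o, 'm) mon \<Rightarrow> bool"
  where "is_monoid_hom S A f B \<longleftrightarrow>
    f \<in> Hom S (obj A) (obj B) \<and>
    f \<cdot>\<^bsub>S\<^esub> mu A = mu B \<cdot>\<^bsub>S\<^esub> (f \<odot>\<^bsub>S\<^esub> f) \<and>
    f \<cdot>\<^bsub>S\<^esub> eta A = eta B"

definition CommMon :: "('o, 'm, 'x) smc_scheme \<Rightarrow>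
    (('o, 'm) mon, ('o, 'm) mon \<times> 'm \<times> ('o, 'm) mon) cat"
  where "CommMon S =
    \<lparr>Ob = {A. is_comm_monoid S A},
     Arr = {(A, f, B). is_comm_monoid S A \<and> is_comm_monoid S B \<and> is_monoid_hom S A f B},
     Dom = (\<lambda>(A, f, B). A),
     Cod = (\<lambda>(A, f, B). B),
     Id = (\<lambda>A. (A, Id S (obj A), A)),
     Cmp = (\<lambda>(B', g, C) (A, f, B). (A, g \<cdot>\<^bsub>S\<^esub> f, C))\<rparr>"

record ('o, 'm) comon =
  coobj :: "'o"
  delta :: "'m"
  counit :: "'m"

definition is_cocomm_comonoid :: "('o, 'm, 'x) smc_scheme \<Rightarrow> ('o, 'm) comon \<Rightarrow> bool"
  where "is_cocomm_comonoid S A \<longleftrightarrow>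
    coobj A \<in> Ob S \<and>
    delta A \<in> Hom S (coobj A) (coobj A \<boxtimes>\<^bsub>S\<^esub> coobj A) \<and>
    counit A \<in> Hom S (coobj A) (unitO S) \<and>
    asc S (coobj A) (coobj A) (coobj A) \<cdot>\<^bsub>S\<^esub> (delta A \<odot>\<^bsub>S\<^esub> Id S (coobj A)) \<cdot>\<^bsub>S\<^esub> delta A =
      (Id S (coobj A) \<odot>\<^bsub>S\<^esub> delta A) \<cdot>\<^bsub>S\<^esub> delta A \<and>
    lun S (coobj A) \<cdot>\<^bsub>S\<^esub> (counit A \<odot>\<^bsub>S\<^esub> Id S (coobj A)) \<cdot>\<^bsub>S\<^esub> delta A = Id S (coobj A) \<and>
    run S (coobj A) \<cdot>\<^bsub>S\<^esub> (Id S (coobj A) \<odot>\<^bsub>S\<^esub> counit A) \<cdot>\<^bsub>S\<^esub> delta A = Id S (coobj A) \<and>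
    sym S (coobj A) (coobj A) \<cdot>\<^bsub>S\<^esub> delta A = delta A"

definition is_comonoid_hom ::
    "('o, 'm, 'x) smc_scheme \<Rightarrow> ('o, 'm) comon \<Rightarrow> 'm \<Rightarrow> ('o, 'm) comon \<Rightarrow> bool"
  where "is_comonoid_hom S A f B \<longleftrightarrow>
    f \<in> Hom S (coobj A) (coobj B) \<and>
    delta B \<cdot>\<^bsub>S\<^esub> f = (f \<odot>\<^bsub>S\<^esub> f) \<cdot>\<^bsub>S\<^esub> delta A \<and>
    counit B \<cdot>\<^bsub>S\<^esub> f = counit A"

definition CocommComon :: "('o, 'm, 'x) smc_scheme \<Rightarrow>
    (('o, 'm) comon, ('o, 'm) comon \<times> 'm \<times> ('o, 'm) comon) cat"
  where "CocommComon S =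
    \<lparr>Ob = {A. is_cocomm_comonoid S A},
     Arr = {(A, f, B). is_cocomm_comonoid S A \<and> is_cocomm_comonoid S B \<and> is_comonoid_hom S A f B},
     Dom = (\<lambda>(A, f, B). A),
     Cod = (\<lambda>(A, f, B). B),
     Id = (\<lambda>A. (A, Id S (coobj A), A)),
     Cmp = (\<lambda>(B', g, C) (A, f, B). (A, g \<cdot>\<^bsub>S\<^esub> f, C))\<rparr>"

definition one_object_cat :: "('g, 'b) monoid_scheme \<Rightarrow> (unit, 'g) cat"
  where "one_object_cat G =
    \<lparr>Ob = UNIV, Arr = carrier G, Dom = (\<lambda>g. ()), Cod = (\<lambda>g. ()),
     Id = (\<lambda>u. \<one>\<^bsub>G\<^esub>), Cmp = (\<lambda>h g. h \<otimes>\<^bsub>G\<^esub> g)\<rparr>"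

abbreviation "G_comm_monoids G S \<equiv> functor_category (one_object_cat G) (CommMon S)"

abbreviation "G_cocomm_comonoids G S \<equiv> functor_category (one_object_cat G) (CocommComon S)"

end

(*
  Evaluation at the generating object sends an algebra to a commutative monoid with an action of
  G. It is fully faithful because F (x) G is generated by the multiplication, the unit, the
  symmetries and the elements of G.

  For essential surjectivity, work first in a strict PROP T with a commutative G-monoid on the
  object 1. The object n carries the tensor power of that monoid, and this is its n-fold coproduct
  among commutative monoids. Hence an arrow (f, x) of F (x) G can be sent to the unique
  homomorphism n -> m whose restriction along the i-th inclusion is the f(i)-th inclusion composed
  with x_i; functoriality and compatibility with tensor and symmetry follow from uniqueness.
  For an object X of a general S this is applied to the PROP of arrows between the powers of X,
  which is strict and maps monoidally to S; this map is strict if S is.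

  The statement on comonoids is the statement on monoids in the opposite of S.
*)

theory Submission
  imports Defs
begin

section \<open>Isomorphisms and equivalences\<close>

text \<open>The obstacle is coherence: in a general \<open>S\<close> every computation with tensor
  powers would have to carry associators and unitors. The universal property of the powers is
  therefore proved where all of these are identities, and the return to \<open>S\<close> is confined
  to one family of isomorphisms \<open>J n m\<close> from \<open>pw n \<boxtimes> pw m\<close> to
  \<open>pw (n + m)\<close>. Of coherence only their compatibility with associators, units and
  symmetries has to be known, and this follows from the axioms and from Kelly's identities for the
  unitors. Because the recursion for powers starts at the unit object, the first power is
  \<open>X \<boxtimes> I\<close> and not \<open>X\<close>. The given monoid is thus transported
  along the right unitor first, and the algebra built from it returns the given monoid up to
  isomorphism. A contravariant assignment turns a left action of G into a right one, which is
  repaired by inverting the group elements. Choice enters when a fully faithful and essentially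
  surjective functor is turned into an equivalence.\<close>

lemma Hom_iff [simp]: "f \<in> Hom C a b \<longleftrightarrow> f \<in> Arr C \<and> Dom C f = a \<and> Cod C f = b"
  by (auto simp: Hom_def)

context category
begin

lemmas [simp] = Dom_Ob Cod_Ob

lemma Cmp_Arr [simp]:
  assumes "f \<in> Arr C" "g \<in> Arr C" "Dom C g = Cod C f"
  shows "g \<cdot> f \<in> Arr C" "Dom C (g \<cdot> f) = Dom C f" "Cod C (g \<cdot> f) = Cod C g"
  using Cmp_Hom[of f "Dom C f" "Cod C f" g "Cod C g"] assms by auto

lemma Id_Arr [simp]:
  assumes "a \<in> Ob C"
  shows "Id C a \<in> Arr C" "Dom C (Id C a) = a" "Cod C (Id C a) = a"
  using Id_Hom[of a] assms by auto

lemma Id_Cmp [simp]: "\<lbrakk>f \<in> Arr C; Cod C f = b\<rbrakk> \<Longrightarrow> Id C b \<cdot> f = f"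
  using Id_left[of f "Dom C f" b] by auto

lemma Cmp_Id [simp]: "\<lbrakk>f \<in> Arr C; Dom C f = a\<rbrakk> \<Longrightarrow> f \<cdot> Id C a = f"
  using Id_right[of f a "Cod C f"] by auto

lemma Cmp_Cmp [simp]:
  "\<lbrakk>f \<in> Arr C; g \<in> Arr C; h \<in> Arr C; Dom C g = Cod C f; Dom C h = Cod C g\<rbrakk>
    \<Longrightarrow> (h \<cdot> g) \<cdot> f = h \<cdot> g \<cdot> f"
  using Cmp_assoc[of f "Dom C f" "Cod C f" g "Cod C g" h "Cod C h"] by auto

lemma inverse_arrows_unique:
  assumes "inverse_arrows C f g" "inverse_arrows C f h" shows "g = h"
proof -
  have "g = (h \<cdot> f) \<cdot> g" using assms by (auto simp: inverse_arrows_def)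
  also have "\<dots> = h \<cdot> f \<cdot> g" using assms by (intro Cmp_Cmp) (auto simp: inverse_arrows_def)
  also have "\<dots> = h" using assms by (auto simp: inverse_arrows_def)
  finally show ?thesis .
qed

lemma inv_arr_eqI: "inverse_arrows C f g \<Longrightarrow> inv_arr C f = g"
  unfolding inv_arr_def using inverse_arrows_unique by blast

lemma inverse_arrows_inv: "iso_arr C f \<Longrightarrow> inverse_arrows C f (inv_arr C f)"
  unfolding iso_arr_def using inv_arr_eqI by auto

lemma iso_Arr: "iso_arr C f \<Longrightarrow> f \<in> Arr C"
  by (auto simp: iso_arr_def inverse_arrows_def)

lemma inv_arr [simp]:
  assumes "iso_arr C f"
  shows "inv_arr C f \<in> Arr C" "Dom C (inv_arr C f) = Cod C f" "Cod C (inv_arr C f) = Dom C f"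
    "inv_arr C f \<cdot> f = Id C (Dom C f)" "f \<cdot> inv_arr C f = Id C (Cod C f)"
  using inverse_arrows_inv[OF assms] by (auto simp: inverse_arrows_def)

text \<open>\<open>Cmp_Cmp\<close> nests compositions to the right, so an isomorphism often meets
  its inverse in front of a further arrow \<open>x\<close>. The plain inverse laws do not match
  there; these variants with a tail do the cancelling.\<close>

lemma inv_cancel [simp]:
  assumes "iso_arr C f" "x \<in> Arr C"
  shows "Cod C x = Dom C f \<Longrightarrow> inv_arr C f \<cdot> f \<cdot> x = x"
    and "Cod C x = Cod C f \<Longrightarrow> f \<cdot> inv_arr C f \<cdot> x = x"
proof -
  assume "Cod C x = Dom C f"
  then have "inv_arr C f \<cdot> f \<cdot> x = (inv_arr C f \<cdot> f) \<cdot> x"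
    using assms iso_Arr[of f] by (simp del: inv_arr(4,5))
  then show "inv_arr C f \<cdot> f \<cdot> x = x" using assms \<open>Cod C x = Dom C f\<close> by simp
next
  assume "Cod C x = Cod C f"
  then have "f \<cdot> inv_arr C f \<cdot> x = (f \<cdot> inv_arr C f) \<cdot> x"
    using assms iso_Arr[of f] by (simp del: inv_arr(4,5))
  then show "f \<cdot> inv_arr C f \<cdot> x = x" using assms \<open>Cod C x = Cod C f\<close> by simp
qed

lemma inverse_arrowsI:
  assumes "f \<in> Arr C" "g \<in> Arr C" "Dom C g = Cod C f" "Cod C g = Dom C f"
    "g \<cdot> f = Id C (Dom C f)" "f \<cdot> g = Id C (Cod C f)"
  shows "iso_arr C f" "inv_arr C f = g"
proof -
  have "inverse_arrows C f g" using assms by (auto simp: inverse_arrows_def)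
  then show "iso_arr C f" "inv_arr C f = g" using inv_arr_eqI by (auto simp: iso_arr_def)
qed

lemma iso_inv [simp]:
  assumes "iso_arr C f" shows "iso_arr C (inv_arr C f)" "inv_arr C (inv_arr C f) = f"
  using inverse_arrowsI[of "inv_arr C f" f] assms iso_Arr[OF assms] by auto

lemma iso_Id [simp]:
  assumes "a \<in> Ob C" shows "iso_arr C (Id C a)" "inv_arr C (Id C a) = Id C a"
  using inverse_arrowsI[of "Id C a" "Id C a"] assms by auto

lemma iso_Cmp [simp]:
  assumes "iso_arr C f" "iso_arr C g" "Dom C g = Cod C f"
  shows "iso_arr C (g \<cdot> f)" "inv_arr C (g \<cdot> f) = inv_arr C f \<cdot> inv_arr C g"
  using inverse_arrowsI[of "g \<cdot> f" "inv_arr C f \<cdot> inv_arr C g"] assms iso_Arr[of f] iso_Arr[of g]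
  by auto

lemma inv_Cmp_eq_iff:
  assumes "iso_arr C f" "x \<in> Arr C" "y \<in> Arr C" "Cod C x = Dom C f" "Cod C y = Cod C f"
  shows "f \<cdot> x = y \<longleftrightarrow> x = inv_arr C f \<cdot> y"
  using assms iso_Arr[of f] by auto

lemma Cmp_inv_eq_iff:
  assumes "iso_arr C f" "x \<in> Arr C" "y \<in> Arr C" "Dom C x = Cod C f" "Dom C y = Dom C f"
  shows "x \<cdot> f = y \<longleftrightarrow> x = y \<cdot> inv_arr C f"
proof
  assume "x \<cdot> f = y"
  then have "y \<cdot> inv_arr C f = (x \<cdot> f) \<cdot> inv_arr C f" by simp
  also have "\<dots> = x" using assms iso_Arr[of f] by simp
  finally show "x = y \<cdot> inv_arr C f" by simp
qed (use assms iso_Arr[of f] in auto)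

lemma iso_cancel_left:
  assumes "f \<cdot> x = f \<cdot> y" "iso_arr C f" "x \<in> Arr C" "y \<in> Arr C" "Cod C x = Dom C f" "Cod C y = Dom C f"
  shows "x = y"
  using inv_Cmp_eq_iff[of f x "f \<cdot> y"] assms iso_Arr[of f] by simp

lemma iso_cancel_right:
  assumes "x \<cdot> f = y \<cdot> f" "iso_arr C f" "x \<in> Arr C" "y \<in> Arr C" "Dom C x = Cod C f" "Dom C y = Cod C f"
  shows "x = y"
  using Cmp_inv_eq_iff[of f x "y \<cdot> f"] assms iso_Arr[of f] by simp

end

context cat_functor
begin

lemma FO_Ob' [simp]: "a \<in> Ob C \<Longrightarrow> FO F a \<in> Ob D"
  by (rule FO_Ob)

lemma FA_Arr [simp]:
  assumes "f \<in> Arr C"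
  shows "FA F f \<in> Arr D" "Dom D (FA F f) = FO F (Dom C f)" "Cod D (FA F f) = FO F (Cod C f)"
  using FA_Hom[of f "Dom C f" "Cod C f"] assms by auto

lemma FA_Id' [simp]: "a \<in> Ob C \<Longrightarrow> FA F (Id C a) = Id D (FO F a)"
  by (rule FA_Id)

lemma FA_Cmp' [simp]:
  "\<lbrakk>f \<in> Arr C; g \<in> Arr C; Dom C g = Cod C f\<rbrakk> \<Longrightarrow> FA F (g \<cdot>\<^bsub>C\<^esub> f) = FA F g \<cdot>\<^bsub>D\<^esub> FA F f"
  using FA_Cmp[of f "Dom C f" "Cod C f" g "Cod C g"] by auto

lemma FA_iso:
  assumes "iso_arr C f"
  shows "iso_arr D (FA F f)" "FA F (inv_arr C f) = inv_arr D (FA F f)"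
proof -
  have f: "f \<in> Arr C" using assms by (rule source.iso_Arr)
  have "FA F (inv_arr C f) \<cdot>\<^bsub>D\<^esub> FA F f = Id D (FO F (Dom C f))"
    "FA F f \<cdot>\<^bsub>D\<^esub> FA F (inv_arr C f) = Id D (FO F (Cod C f))"
    using f assms by (simp_all flip: FA_Cmp')
  then show "iso_arr D (FA F f)" "FA F (inv_arr C f) = inv_arr D (FA F f)"
    using target.inverse_arrowsI[of "FA F f" "FA F (inv_arr C f)"] f assms by auto
qed

end

section \<open>Fully faithful and essentially surjective functors\<close>

definition fully_faithful ::
    "('o1, 'm1, 'x) cat_scheme \<Rightarrow> ('o2, 'm2, 'y) cat_scheme \<Rightarrow> ('o1, 'm1, 'o2, 'm2) cfunctor \<Rightarrow> bool"
  where "fully_faithful C D F \<longleftrightarrow>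
    cat_functor C D F \<and>
    (\<forall>a \<in> Ob C. \<forall>b \<in> Ob C. \<forall>g \<in> Hom D (FO F a) (FO F b). \<exists>!f. f \<in> Hom C a b \<and> FA F f = g)"

text \<open>This property passes to composites and opposites by short arguments, whereas explicit
  quasi-inverses would have to be carried along. An actual equivalence is produced once, at the end
  of each chain.\<close>

definition weak_equivalence ::
    "('o1, 'm1, 'x) cat_scheme \<Rightarrow> ('o2, 'm2, 'y) cat_scheme \<Rightarrow> ('o1, 'm1, 'o2, 'm2) cfunctor \<Rightarrow> bool"
  where "weak_equivalence C D F \<longleftrightarrow>
    fully_faithful C D F \<and>
    (\<forall>d \<in> Ob D. \<exists>c \<in> Ob C. \<exists>g \<in> Hom D (FO F c) d. iso_arr D g)"

text \<open>For each object d of the target, choose \<open>K d\<close> and an isomorphism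
  \<open>e d\<close> from its image to d. Full faithfulness lifts conjugates by these isomorphisms,
  and the uniqueness of lifts gives all equations.\<close>

lemma weak_equivalence_imp_equivalent:
  assumes "weak_equivalence C D F"
  shows "equivalent_categories C D"
proof -
  interpret F: cat_functor C D F using assms by (simp add: weak_equivalence_def fully_faithful_def)
  have ff: "\<exists>!f. f \<in> Hom C a b \<and> FA F f = g"
    if "a \<in> Ob C" "b \<in> Ob C" "g \<in> Hom D (FO F a) (FO F b)" for a b g
    using assms that unfolding weak_equivalence_def fully_faithful_def by blast
  have faith: "f = f'" if "f \<in> Arr C" "f' \<in> Arr C" "Dom C f = Dom C f'" "Cod C f = Cod C f'"
    "FA F f = FA F f'" for f f'
    using ff[of "Dom C f" "Cod C f" "FA F f"] that by auto
  obtain K e where Ke: "\<And>d. d \<in> Ob D \<Longrightarrow>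
      K d \<in> Ob C \<and> e d \<in> Arr D \<and> Dom D (e d) = FO F (K d) \<and> Cod D (e d) = d \<and> iso_arr D (e d)"
  proof -
    have "\<forall>d \<in> Ob D. \<exists>p. fst p \<in> Ob C \<and> snd p \<in> Hom D (FO F (fst p)) d \<and> iso_arr D (snd p)"
      using assms unfolding weak_equivalence_def by fastforce
    then obtain p where "\<forall>d \<in> Ob D. fst (p d) \<in> Ob C \<and> snd (p d) \<in> Hom D (FO F (fst (p d))) d \<and>
        iso_arr D (snd (p d))"
      unfolding bchoice_iff by blast
    then show thesis by (intro that[of "fst \<circ> p" "snd \<circ> p"]) auto
  qed
  \<comment> \<open>Forced by naturality of \<open>e\<close>: the image of \<open>L g\<close> has to
    be \<open>g\<close> conjugated by the chosen isomorphisms.\<close>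
  define L where "L g = (THE f. f \<in> Hom C (K (Dom D g)) (K (Cod D g)) \<and>
      FA F f = inv_arr D (e (Cod D g)) \<cdot>\<^bsub>D\<^esub> g \<cdot>\<^bsub>D\<^esub> e (Dom D g))" for g
  have L: "L g \<in> Arr C \<and> Dom C (L g) = K (Dom D g) \<and> Cod C (L g) = K (Cod D g) \<and>
      FA F (L g) = inv_arr D (e (Cod D g)) \<cdot>\<^bsub>D\<^esub> g \<cdot>\<^bsub>D\<^esub> e (Dom D g)" if "g \<in> Arr D" for g
  proof -
    have "\<exists>!f. f \<in> Hom C (K (Dom D g)) (K (Cod D g)) \<and>
      FA F f = inv_arr D (e (Cod D g)) \<cdot>\<^bsub>D\<^esub> g \<cdot>\<^bsub>D\<^esub> e (Dom D g)"
      using that Ke[of "Dom D g"] Ke[of "Cod D g"] by (intro ff) auto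
    from theI'[OF this] show ?thesis unfolding L_def by auto
  qed
  define KK where "KK = \<lparr>FO = restrict K (Ob D), FA = restrict L (Arr D)\<rparr>"
  have sel: "FO KK = restrict K (Ob D)" "FA KK = restrict L (Arr D)" by (auto simp: KK_def)
  have KK: "cat_functor D C KK"
  proof (unfold_locales, unfold sel, goal_cases)
    case (5 a)
    then have "L (Id D a) = Id C (K a)"
      using L[of "Id D a"] Ke[of a] by (intro faith) auto
    then show ?case using 5 by simp
  next
    case (6 f a b g c)
    then have "L (g \<cdot>\<^bsub>D\<^esub> f) = L g \<cdot>\<^bsub>C\<^esub> L f"
      using L[of f] L[of g] L[of "g \<cdot>\<^bsub>D\<^esub> f"] Ke[of "Dom D f"] Ke[of "Cod D f"] Ke[of "Cod D g"]
      by (intro faith) auto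
    then show ?case using 6 by simp
  qed (use Ke L in auto)
  have 1: "naturally_isomorphic D D (comp_functor D F KK) (id_functor D)"
    unfolding naturally_isomorphic_def nat_transf_def
  proof (intro exI[of _ "restrict e (Ob D)"] conjI ballI, goal_cases)
    case (3 f)
    then show ?case using L[of f] Ke[of "Dom D f"] Ke[of "Cod D f"]
      by (auto simp: comp_functor_def id_functor_def sel)
  qed (use Ke in \<open>auto simp: comp_functor_def id_functor_def sel\<close>)
  \<comment> \<open>The isomorphism from \<open>F K\<close> to the identity is \<open>e\<close>
    itself. The one from \<open>K F\<close> is the lift of \<open>e\<close> at the objects
    \<open>F c\<close>, and it is invertible because the inverse of \<open>e\<close> lifts
    too.\<close>
  define k where "k c = (THE f. f \<in> Hom C (K (FO F c)) c \<and> FA F f = e (FO F c))" for c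
  have k: "k c \<in> Arr C \<and> Dom C (k c) = K (FO F c) \<and> Cod C (k c) = c \<and> FA F (k c) = e (FO F c)"
    if "c \<in> Ob C" for c
  proof -
    have "\<exists>!f. f \<in> Hom C (K (FO F c)) c \<and> FA F f = e (FO F c)"
      using that Ke[of "FO F c"] by (intro ff) auto
    from theI'[OF this] show ?thesis unfolding k_def by auto
  qed
  have k_iso: "iso_arr C (k c)" if c: "c \<in> Ob C" for c
  proof -
    have "\<exists>!f. f \<in> Hom C c (K (FO F c)) \<and> FA F f = inv_arr D (e (FO F c))"
      using c Ke[of "FO F c"] by (intro ff) auto
    then obtain f where f: "f \<in> Arr C" "Dom C f = c" "Cod C f = K (FO F c)"
      "FA F f = inv_arr D (e (FO F c))" by auto
    have "f \<cdot>\<^bsub>C\<^esub> k c = Id C (K (FO F c))" "k c \<cdot>\<^bsub>C\<^esub> f = Id C c"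
      using f k[OF c] Ke[of "FO F c"] c by (auto intro!: faith)
    then show ?thesis using k[OF c] f by (intro F.source.inverse_arrowsI[of _ f]) auto
  qed
  have 2: "naturally_isomorphic C C (comp_functor C KK F) (id_functor C)"
    unfolding naturally_isomorphic_def nat_transf_def
  proof (intro exI[of _ "restrict k (Ob C)"] conjI ballI, goal_cases)
    case (3 f)
    then have "k (Cod C f) \<cdot>\<^bsub>C\<^esub> L (FA F f) = f \<cdot>\<^bsub>C\<^esub> k (Dom C f)"
      using k[of "Dom C f"] k[of "Cod C f"] L[of "FA F f"] Ke[of "FO F (Dom C f)"] Ke[of "FO F (Cod C f)"]
      by (intro faith) auto
    then show ?case using 3 by (auto simp: comp_functor_def id_functor_def sel)
  qed (use k k_iso in \<open>auto simp: comp_functor_def id_functor_def sel\<close>)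
  show ?thesis unfolding equivalent_categories_def
    using F.source.category_axioms F.target.category_axioms F.cat_functor_axioms KK 1 2 by blast
qed

lemma cat_functor_comp:
  assumes "cat_functor C D F" "cat_functor D B K"
  shows "cat_functor C B (comp_functor C K F)"
proof -
  interpret F: cat_functor C D F by fact
  interpret K: cat_functor D B K by fact
  show ?thesis by unfold_locales (auto simp: comp_functor_def)
qed

lemma fully_faithful_comp:
  assumes "fully_faithful C D F" "fully_faithful D B K"
  shows "fully_faithful C B (comp_functor C K F)"
proof -
  interpret F: cat_functor C D F using assms by (simp add: fully_faithful_def)
  interpret K: cat_functor D B K using assms by (simp add: fully_faithful_def)
  show ?thesis unfolding fully_faithful_def
  proof (intro conjI ballI cat_functor_comp[of _ D])
    fix a b g assume *: "a \<in> Ob C" "b \<in> Ob C"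
      "g \<in> Hom B (FO (comp_functor C K F) a) (FO (comp_functor C K F) b)"
    then have g: "g \<in> Hom B (FO K (FO F a)) (FO K (FO F b))" by (simp add: comp_functor_def)
    have K1: "\<exists>!f. f \<in> Hom D (FO F a) (FO F b) \<and> FA K f = g"
      using assms(2) g * F.FO_Ob unfolding fully_faithful_def by blast
    then obtain h where h: "h \<in> Hom D (FO F a) (FO F b)" "FA K h = g" by blast
    have F1: "\<exists>!f. f \<in> Hom C a b \<and> FA F f = h"
      using assms(1) h * unfolding fully_faithful_def by blast
    have "f \<in> Hom C a b \<and> FA (comp_functor C K F) f = g \<longleftrightarrow> f \<in> Hom C a b \<and> FA F f = h" for f
      using K1 h F.FA_Hom[of f a b] by (auto simp: comp_functor_def)
    then show "\<exists>!f. f \<in> Hom C a b \<and> FA (comp_functor C K F) f = g" using F1 by simp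
  qed (use assms in \<open>auto simp: fully_faithful_def\<close>)
qed

lemma weak_equivalence_comp:
  assumes "weak_equivalence C D F" "weak_equivalence D B K"
  shows "weak_equivalence C B (comp_functor C K F)"
proof -
  interpret F: cat_functor C D F using assms by (simp add: weak_equivalence_def fully_faithful_def)
  interpret K: cat_functor D B K using assms by (simp add: weak_equivalence_def fully_faithful_def)
  show ?thesis unfolding weak_equivalence_def
  proof (intro conjI ballI fully_faithful_comp[of _ D])
    fix d assume "d \<in> Ob B"
    then obtain c g where c: "c \<in> Ob D" "g \<in> Hom B (FO K c) d" "iso_arr B g"
      using assms(2) unfolding weak_equivalence_def by blast
    then obtain a h where a: "a \<in> Ob C" "h \<in> Hom D (FO F a) c" "iso_arr D h"
      using assms(1) unfolding weak_equivalence_def by blast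
    show "\<exists>c\<in>Ob C. \<exists>g\<in>Hom B (FO (comp_functor C K F) c) d. iso_arr B g"
      using a c K.FA_iso[of h]
      by (intro bexI[of _ a] bexI[of _ "g \<cdot>\<^bsub>B\<^esub> FA K h"]) (auto simp: comp_functor_def)
  qed (use assms in \<open>auto simp: weak_equivalence_def\<close>)
qed

text \<open>Dualising an algebra or a monoid reverses the natural transformations, so each duality
  relates a category to the opposite of another. \<open>op_smc\<close> cannot serve for these
  categories, since they carry no tensor product.\<close>

definition op_cat :: "('o, 'm, 'x) cat_scheme \<Rightarrow> ('o, 'm) cat"
  where "op_cat C = \<lparr>Ob = Ob C, Arr = Arr C, Dom = Cod C, Cod = Dom C, Id = Id C,
    Cmp = (\<lambda>g f. f \<cdot>\<^bsub>C\<^esub> g)\<rparr>"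

lemma op_cat_sel [simp]:
  "Ob (op_cat C) = Ob C" "Arr (op_cat C) = Arr C" "Dom (op_cat C) = Cod C" "Cod (op_cat C) = Dom C"
  "Id (op_cat C) = Id C" "Cmp (op_cat C) g f = f \<cdot>\<^bsub>C\<^esub> g"
  by (auto simp: op_cat_def)

lemma category_op_cat: "category C \<Longrightarrow> category (op_cat C)"
proof -
  assume "category C"
  then interpret category C .
  show ?thesis by unfold_locales auto
qed

lemma iso_arr_op_cat [simp]: "iso_arr (op_cat C) f \<longleftrightarrow> iso_arr C f"
  unfolding iso_arr_def inverse_arrows_def by auto

lemma weak_equivalence_op:
  assumes "weak_equivalence C D F"
  shows "weak_equivalence (op_cat C) (op_cat D) F"
proof -
  interpret F: cat_functor C D F using assms by (simp add: weak_equivalence_def fully_faithful_def)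
  have 1: "cat_functor (op_cat C) (op_cat D) F"
    using category_op_cat[OF F.source.category_axioms] category_op_cat[OF F.target.category_axioms]
      F.FO_ext F.FA_ext
    by (auto simp: cat_functor_def cat_functor_axioms_def)
  show ?thesis unfolding weak_equivalence_def fully_faithful_def
  proof (intro conjI ballI 1)
    fix a b g assume "a \<in> Ob (op_cat C)" "b \<in> Ob (op_cat C)" "g \<in> Hom (op_cat D) (FO F a) (FO F b)"
    then have "\<exists>!f. f \<in> Hom C b a \<and> FA F f = g"
      using assms unfolding weak_equivalence_def fully_faithful_def by auto
    then show "\<exists>!f. f \<in> Hom (op_cat C) a b \<and> FA F f = g" by (simp add: conj_ac)
  next
    fix d assume "d \<in> Ob (op_cat D)"
    then obtain c g where "c \<in> Ob C" "g \<in> Hom D (FO F c) d" "iso_arr D g"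
      using assms unfolding weak_equivalence_def by auto
    \<comment> \<open>Read in the opposite category, the given isomorphism points the wrong way; its
      inverse is the witness.\<close>
    then show "\<exists>c\<in>Ob (op_cat C). \<exists>g\<in>Hom (op_cat D) (FO F c) d. iso_arr (op_cat D) g"
      by (intro bexI[of _ c] bexI[of _ "inv_arr D g"]) auto
  qed
qed

section \<open>Categories of natural transformations\<close>

lemma transf_category_sel [simp]:
  "Ob (transf_category C D Fs P) = Fs"
  "(F, \<theta>, F') \<in> Arr (transf_category C D Fs P) \<longleftrightarrow>
     F \<in> Fs \<and> F' \<in> Fs \<and> nat_transf C D F \<theta> F' \<and> P F \<theta> F'"
  "Dom (transf_category C D Fs P) (F, \<theta>, F') = F"
  "Cod (transf_category C D Fs P) (F, \<theta>, F') = F'"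
  "Id (transf_category C D Fs P) F = (F, restrict (\<lambda>a. Id D (FO F a)) (Ob C), F)"
  "Cmp (transf_category C D Fs P) (E', \<psi>, E'') (F, \<theta>, F') =
     (F, restrict (\<lambda>a. \<psi> a \<cdot>\<^bsub>D\<^esub> \<theta> a) (Ob C), E'')"
  by (auto simp: transf_category_def)

text \<open>Vertical composition is checked here once for all categories of functors. What varies
  between them is the side condition \<open>P\<close>, whose closure under identities and
  composition is left to each instance.\<close>

lemma category_transf_category:
  assumes Fs: "\<And>F. F \<in> Fs \<Longrightarrow> cat_functor C D F"
    and C: "category C" and D: "category D"
    and id: "\<And>F. F \<in> Fs \<Longrightarrow> P F (restrict (\<lambda>a. Id D (FO F a)) (Ob C)) F"
    and comp: "\<And>F F' F'' \<theta> \<psi>. \<lbrakk>F \<in> Fs; F' \<in> Fs; F'' \<in> Fs; nat_transf C D F \<theta> F'; nat_transf C D F' \<psi> F'';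
       P F \<theta> F'; P F' \<psi> F''\<rbrakk> \<Longrightarrow> P F (restrict (\<lambda>a. \<psi> a \<cdot>\<^bsub>D\<^esub> \<theta> a) (Ob C)) F''"
  shows "category (transf_category C D Fs P)"
proof -
  interpret C: category C by fact
  interpret D: category D by fact
  let ?T = "transf_category C D Fs P"
  note F = cat_functor.FA_Arr[OF Fs] cat_functor.FO_Ob'[OF Fs]
  have nid: "nat_transf C D F (restrict (\<lambda>a. Id D (FO F a)) (Ob C)) F" if "F \<in> Fs" for F
  proof -
    interpret cat_functor C D F using Fs[OF that] .
    show ?thesis by (auto simp: nat_transf_def)
  qed
  have ncomp: "nat_transf C D F (restrict (\<lambda>a. \<psi> a \<cdot>\<^bsub>D\<^esub> \<theta> a) (Ob C)) F''"
    if *: "F \<in> Fs" "F' \<in> Fs" "F'' \<in> Fs" "nat_transf C D F \<theta> F'" "nat_transf C D F' \<psi> F''" for F \<theta> F' \<psi> F''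
    unfolding nat_transf_def
  proof (intro conjI ballI, goal_cases)
    case (3 f)
    have e: "\<theta> (Cod C f) \<cdot>\<^bsub>D\<^esub> FA F f = FA F' f \<cdot>\<^bsub>D\<^esub> \<theta> (Dom C f)"
      "\<psi> (Cod C f) \<cdot>\<^bsub>D\<^esub> FA F' f = FA F'' f \<cdot>\<^bsub>D\<^esub> \<psi> (Dom C f)"
      using * 3 by (auto simp: nat_transf_def)
    have h: "\<And>a. a \<in> Ob C \<Longrightarrow> \<theta> a \<in> Arr D \<and> Dom D (\<theta> a) = FO F a \<and> Cod D (\<theta> a) = FO F' a"
      "\<And>a. a \<in> Ob C \<Longrightarrow> \<psi> a \<in> Arr D \<and> Dom D (\<psi> a) = FO F' a \<and> Cod D (\<psi> a) = FO F'' a"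
      using * by (auto simp: nat_transf_def)
    have "(\<psi> (Cod C f) \<cdot>\<^bsub>D\<^esub> \<theta> (Cod C f)) \<cdot>\<^bsub>D\<^esub> FA F f = \<psi> (Cod C f) \<cdot>\<^bsub>D\<^esub> FA F' f \<cdot>\<^bsub>D\<^esub> \<theta> (Dom C f)"
      using 3 h F[OF *(1)] by (simp add: e)
    also have "\<dots> = (\<psi> (Cod C f) \<cdot>\<^bsub>D\<^esub> FA F' f) \<cdot>\<^bsub>D\<^esub> \<theta> (Dom C f)"
      using 3 h F[OF *(2)] by simp
    also have "\<dots> = FA F'' f \<cdot>\<^bsub>D\<^esub> \<psi> (Dom C f) \<cdot>\<^bsub>D\<^esub> \<theta> (Dom C f)"
      unfolding e using 3 h F[OF *(3)] by simp
    finally show ?case using 3 by simp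
  qed (use * in \<open>auto simp: nat_transf_def\<close>)
  show ?thesis
  proof
    show "Dom ?T f \<in> Ob ?T" if "f \<in> Arr ?T" for f using that by (cases f) simp
    show "Cod ?T f \<in> Ob ?T" if "f \<in> Arr ?T" for f using that by (cases f) simp
    show "Id ?T a \<in> Hom ?T a a" if "a \<in> Ob ?T" for a using that nid id by simp
    show "g \<cdot>\<^bsub>?T\<^esub> f \<in> Hom ?T a c" if "f \<in> Hom ?T a b" "g \<in> Hom ?T b c" for f g a b c
      using that comp ncomp by (cases f; cases g) auto
    show "Id ?T b \<cdot>\<^bsub>?T\<^esub> f = f" if "f \<in> Hom ?T a b" for f a b
      using that by (cases f) (auto simp: nat_transf_def intro!: restrict_eqI)
    show "f \<cdot>\<^bsub>?T\<^esub> Id ?T a = f" if "f \<in> Hom ?T a b" for f a b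
      using that by (cases f) (auto simp: nat_transf_def intro!: restrict_eqI)
    show "(h \<cdot>\<^bsub>?T\<^esub> g) \<cdot>\<^bsub>?T\<^esub> f = h \<cdot>\<^bsub>?T\<^esub> (g \<cdot>\<^bsub>?T\<^esub> f)"
      if "f \<in> Hom ?T a b" "g \<in> Hom ?T b c" "h \<in> Hom ?T c d" for f g h a b c d
      using that by (cases f; cases g; cases h) (auto simp: nat_transf_def intro!: restrict_ext)
  qed
qed

section \<open>Symmetric monoidal categories and duality\<close>

context category
begin

text \<open>Inverts two opposite sides of a commuting square. Naturality of a structure isomorphism
  thereby becomes naturality of its inverse, which is what the opposite category asks for.\<close>

lemma iso_square:
  assumes "x \<cdot> p = q \<cdot> y" "iso_arr C x" "iso_arr C y" "p \<in> Arr C" "q \<in> Arr C"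
    "Dom C x = Cod C p" "Dom C q = Cod C y" "Dom C p = Dom C y" "Cod C q = Cod C x"
  shows "p \<cdot> inv_arr C y = inv_arr C x \<cdot> q"
proof -
  have "inv_arr C x \<cdot> (x \<cdot> p) \<cdot> inv_arr C y = inv_arr C x \<cdot> (q \<cdot> y) \<cdot> inv_arr C y"
    by (simp only: assms(1))
  then show ?thesis using assms(2-) iso_Arr[of x] iso_Arr[of y] by simp
qed

end

context symmetric_monoidal_category
begin

lemmas [simp] = unitO_Ob tensO_Ob tensA_Id

lemma tensA_Arr [simp]:
  assumes "f \<in> Arr S" "g \<in> Arr S"
  shows "f \<odot> g \<in> Arr S" "Dom S (f \<odot> g) = Dom S f \<boxtimes> Dom S g" "Cod S (f \<odot> g) = Cod S f \<boxtimes> Cod S g"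
  using tensA_Hom[of f "Dom S f" "Cod S f" g "Dom S g" "Cod S g"] assms by auto

lemma interchange:
  assumes "f \<in> Arr S" "f' \<in> Arr S" "g \<in> Arr S" "g' \<in> Arr S" "Dom S f' = Cod S f" "Dom S g' = Cod S g"
  shows "(f' \<odot> g') \<cdot> (f \<odot> g) = (f' \<cdot> f) \<odot> (g' \<cdot> g)"
  using tensA_Cmp[of f "Dom S f" "Cod S f" f' "Cod S f'" g "Dom S g" "Cod S g" g' "Cod S g'"] assms
  by auto

text \<open>The interchange law in front of a tail \<open>h\<close>, the form in which it occurs in
  right-nested composites.\<close>

lemma interchange_Cmp:
  assumes "f \<in> Arr S" "f' \<in> Arr S" "g \<in> Arr S" "g' \<in> Arr S" "Dom S f' = Cod S f" "Dom S g' = Cod S g"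
    "h \<in> Arr S" "Cod S h = Dom S f \<boxtimes> Dom S g"
  shows "(f' \<odot> g') \<cdot> (f \<odot> g) \<cdot> h = ((f' \<cdot> f) \<odot> (g' \<cdot> g)) \<cdot> h"
proof -
  have "((f' \<odot> g') \<cdot> (f \<odot> g)) \<cdot> h = ((f' \<cdot> f) \<odot> (g' \<cdot> g)) \<cdot> h"
    using assms by (simp only: interchange)
  then show ?thesis using assms by simp
qed

lemma asc_Arr [simp]:
  assumes "a \<in> Ob S" "b \<in> Ob S" "c \<in> Ob S"
  shows "asc S a b c \<in> Arr S" "Dom S (asc S a b c) = (a \<boxtimes> b) \<boxtimes> c" "Cod S (asc S a b c) = a \<boxtimes> b \<boxtimes> c"
    "iso_arr S (asc S a b c)"
  using asc_Hom[OF assms] asc_iso[OF assms] by auto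

lemma lun_Arr [simp]:
  assumes "a \<in> Ob S"
  shows "lun S a \<in> Arr S" "Dom S (lun S a) = unitO S \<boxtimes> a" "Cod S (lun S a) = a" "iso_arr S (lun S a)"
  using lun_Hom[OF assms] lun_iso[OF assms] by auto

lemma run_Arr [simp]:
  assumes "a \<in> Ob S"
  shows "run S a \<in> Arr S" "Dom S (run S a) = a \<boxtimes> unitO S" "Cod S (run S a) = a" "iso_arr S (run S a)"
  using run_Hom[OF assms] run_iso[OF assms] by auto

lemma sym_Arr [simp]:
  assumes "a \<in> Ob S" "b \<in> Ob S"
  shows "sym S a b \<in> Arr S" "Dom S (sym S a b) = a \<boxtimes> b" "Cod S (sym S a b) = b \<boxtimes> a"
    "iso_arr S (sym S a b)" "inv_arr S (sym S a b) = sym S b a"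
proof -
  show *: "sym S a b \<in> Arr S" "Dom S (sym S a b) = a \<boxtimes> b" "Cod S (sym S a b) = b \<boxtimes> a"
    using sym_Hom[OF assms] by auto
  have "sym S b a \<in> Arr S" "Dom S (sym S b a) = b \<boxtimes> a" "Cod S (sym S b a) = a \<boxtimes> b"
    using sym_Hom[OF assms(2,1)] by auto
  then show "iso_arr S (sym S a b)" "inv_arr S (sym S a b) = sym S b a"
    using * assms by (auto intro!: inverse_arrowsI simp: sym_sym)
qed

lemma tensA_iso [simp]:
  assumes "iso_arr S f" "iso_arr S g"
  shows "iso_arr S (f \<odot> g)" "inv_arr S (f \<odot> g) = inv_arr S f \<odot> inv_arr S g"
  using inverse_arrowsI[of "f \<odot> g" "inv_arr S f \<odot> inv_arr S g"] assms iso_Arr[of f] iso_Arr[of g]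
  by (auto simp: interchange)

lemma asc_natural:
  assumes "f \<in> Arr S" "g \<in> Arr S" "h \<in> Arr S" "Cod S f = a'" "Cod S g = b'" "Cod S h = c'"
  shows "asc S a' b' c' \<cdot> ((f \<odot> g) \<odot> h) = (f \<odot> (g \<odot> h)) \<cdot> asc S (Dom S f) (Dom S g) (Dom S h)"
  using asc_nat[of f _ a' g _ b' h _ c'] assms by auto

lemma sym_natural:
  assumes "f \<in> Arr S" "g \<in> Arr S" "Cod S f = a'" "Cod S g = b'"
  shows "sym S a' b' \<cdot> (f \<odot> g) = (g \<odot> f) \<cdot> sym S (Dom S f) (Dom S g)"
  using sym_nat[of f _ a' g _ b'] assms by auto

lemma lun_natural:
  "\<lbrakk>f \<in> Arr S; Cod S f = b\<rbrakk> \<Longrightarrow> lun S b \<cdot> (Id S (unitO S) \<odot> f) = f \<cdot> lun S (Dom S f)"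
  using lun_nat[of f _ b] by auto

lemma run_natural:
  "\<lbrakk>f \<in> Arr S; Cod S f = b\<rbrakk> \<Longrightarrow> run S b \<cdot> (f \<odot> Id S (unitO S)) = f \<cdot> run S (Dom S f)"
  using run_nat[of f _ b] by auto

end

lemma op_smc_sel [simp]:
  "Ob (op_smc S) = Ob S" "Arr (op_smc S) = Arr S" "Dom (op_smc S) = Cod S" "Cod (op_smc S) = Dom S"
  "Id (op_smc S) = Id S" "Cmp (op_smc S) g f = f \<cdot>\<^bsub>S\<^esub> g"
  "tensO (op_smc S) = tensO S" "tensA (op_smc S) = tensA S" "unitO (op_smc S) = unitO S"
  "asc (op_smc S) a b c = inv_arr S (asc S a b c)" "lun (op_smc S) a = inv_arr S (lun S a)"
  "run (op_smc S) a = inv_arr S (run S a)" "sym (op_smc S) a b = inv_arr S (sym S a b)"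
  by (auto simp: op_smc_def)

lemma inverse_arrows_op_smc: "inverse_arrows (op_smc S) = inverse_arrows S"
  by (intro ext) (auto simp: inverse_arrows_def)

lemma iso_arr_op_smc [simp]: "iso_arr (op_smc S) f \<longleftrightarrow> iso_arr S f"
  and inv_arr_op_smc [simp]: "inv_arr (op_smc S) f = inv_arr S f"
  unfolding iso_arr_def inv_arr_def by (auto simp: inverse_arrows_op_smc)

text \<open>Inverting a composite reverses the order of its factors, and the opposite category
  reverses it once more. Hence applying \<open>inv_arr\<close> to both sides of the pentagon, the
  triangle and the hexagon gives these axioms for the inverse constraints.\<close>

lemma symmetric_monoidal_category_op:
  assumes "symmetric_monoidal_category S"
  shows "symmetric_monoidal_category (op_smc S)"
proof -
  interpret symmetric_monoidal_category S by fact
  show ?thesis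
  proof (unfold_locales, goal_cases)
    case (12 f a b f' c g a' b' g' c')
    then show ?case by (auto simp: interchange)
  next
    case (15 f a a' g b b' h c c')
    then show ?case using asc_natural[of f g h a b c] by (auto intro!: iso_square)
  next
    case (18 f a b)
    then show ?case using lun_natural[of f a] by (auto intro!: iso_square)
  next
    case (21 f a b)
    then show ?case using run_natural[of f a] by (auto intro!: iso_square)
  next
    case (23 f a a' g b b')
    then show ?case using sym_natural[of g f b a] by (auto simp: sym_natural)
  next
    case (25 a b c d)
    then show ?case using arg_cong[OF pentagon[of a b c d], of "inv_arr S"] by simp
  next
    case (26 a b)
    then show ?case using arg_cong[OF triangle[of a b], of "inv_arr S"] by simp
  next
    case (27 a b c)
    then show ?case using arg_cong[OF hexagon[of a b c], of "inv_arr S"] by simp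
  qed (auto simp: sym_sym)
qed

lemma symmetric_strict_monoidal_category_op:
  assumes "symmetric_strict_monoidal_category S"
  shows "symmetric_strict_monoidal_category (op_smc S)"
proof -
  interpret symmetric_strict_monoidal_category S by fact
  interpret op: symmetric_monoidal_category "op_smc S"
    by (rule symmetric_monoidal_category_op) unfold_locales
  show ?thesis by unfold_locales (auto simp: strict_asc strict_lun strict_run)
qed

section \<open>Duality for monoidal functors and algebras\<close>

context symmetric_monoidal_functor
begin

lemma phi_Arr [simp]:
  assumes "a \<in> Ob T" "b \<in> Ob T"
  shows "phi F (a, b) \<in> Arr S" "Dom S (phi F (a, b)) = FO F a \<boxtimes>\<^bsub>S\<^esub> FO F b"
    "Cod S (phi F (a, b)) = FO F (a \<boxtimes>\<^bsub>T\<^esub> b)" "iso_arr S (phi F (a, b))"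
  using phi_Hom[OF assms] phi_iso[OF assms] by auto

lemma phi0_Arr [simp]:
  "phi0 F \<in> Arr S" "Dom S (phi0 F) = unitO S" "Cod S (phi0 F) = FO F (unitO T)" "iso_arr S (phi0 F)"
  using phi0_Hom phi0_iso by auto

lemma phi_natural:
  assumes "f \<in> Arr T" "g \<in> Arr T" "Cod T f = a'" "Cod T g = b'"
  shows "phi F (a', b') \<cdot>\<^bsub>S\<^esub> (FA F f \<odot>\<^bsub>S\<^esub> FA F g) = FA F (f \<odot>\<^bsub>T\<^esub> g) \<cdot>\<^bsub>S\<^esub> phi F (Dom T f, Dom T g)"
  using phi_nat[of f _ a' g _ b'] assms by auto

end

text \<open>Also in the opposite of \<open>S\<close> the comparison arrow has to run from
  \<open>F a \<boxtimes> F b\<close> to \<open>F (a \<boxtimes> b)\<close>, that is, backwards in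
  \<open>S\<close>; the inverse does so.\<close>

definition dual_mfunctor :: "('o1, 'm1) smc \<Rightarrow> ('o2, 'm2) smc \<Rightarrow>
    ('o1, 'm1, 'o2, 'm2) mfunctor \<Rightarrow> ('o1, 'm1, 'o2, 'm2) mfunctor"
  where "dual_mfunctor T S F = \<lparr>FO = FO F, FA = FA F,
    phi = restrict (\<lambda>p. inv_arr S (phi F p)) (Ob T \<times> Ob T), phi0 = inv_arr S (phi0 F)\<rparr>"

lemma dual_mfunctor_sel [simp]:
  "FO (dual_mfunctor T S F) = FO F" "FA (dual_mfunctor T S F) = FA F"
  "phi (dual_mfunctor T S F) = restrict (\<lambda>p. inv_arr S (phi F p)) (Ob T \<times> Ob T)"
  "phi0 (dual_mfunctor T S F) = inv_arr S (phi0 F)"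
  by (auto simp: dual_mfunctor_def)

lemma dual_mfunctor:
  fixes T :: "('o1, 'm1) smc" and S :: "('o2, 'm2) smc"
  assumes T: "symmetric_monoidal_category T" and F: "symmetric_monoidal_functor (op_smc T) S F"
  shows "symmetric_monoidal_functor T (op_smc S) (dual_mfunctor T S F)"
proof -
  interpret T: symmetric_monoidal_category T by fact
  interpret F: symmetric_monoidal_functor "op_smc T" S F by fact
  interpret S: symmetric_monoidal_category "op_smc S"
    by (rule symmetric_monoidal_category_op) unfold_locales
  have FAi: "FA F (inv_arr T f) = inv_arr S (FA F f)" "iso_arr S (FA F f)" if "iso_arr T f" for f
    using F.FA_iso[of f] that by auto
  have FAarr: "FA F f \<in> Arr S" "Dom S (FA F f) = FO F (Cod T f)" "Cod S (FA F f) = FO F (Dom T f)"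
    if "f \<in> Arr T" for f
    using F.FA_Arr[of f] that by auto
  have phiarr: "phi F (a, b) \<in> Arr S" "Dom S (phi F (a, b)) = FO F a \<boxtimes>\<^bsub>S\<^esub> FO F b"
    "Cod S (phi F (a, b)) = FO F (a \<boxtimes>\<^bsub>T\<^esub> b)" "iso_arr S (phi F (a, b))"
    if "a \<in> Ob T" "b \<in> Ob T" for a b using F.phi_Arr[of a b] that by auto
  have FO: "FO F a \<in> Ob S" if "a \<in> Ob T" for a using F.FO_Ob[of a] that by simp
  have phi0: "phi0 F \<in> Arr S" "Dom S (phi0 F) = unitO S" "Cod S (phi0 F) = FO F (unitO T)" "iso_arr S (phi0 F)"
    using F.phi0_Arr by simp_all
  note * = FAarr FAi phiarr FO phi0
  show ?thesis
  proof (unfold_locales, goal_cases)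
    case 1 then show ?case using F.FO_ext by simp
  next case 2 then show ?case using F.FA_ext by simp
  next case (3 a) then show ?case by (simp add: *)
  next case (4 f a b) then show ?case by (auto simp: *)
  next case (5 a) then show ?case using F.FA_Id[of a] by simp
  next case (6 f a b g c) then show ?case using F.FA_Cmp[of g c b f a] by auto
  next case 7 show ?case by simp
  next case (8 a b) then show ?case by (simp add: *)
  next case (9 a b) then show ?case by (simp add: *)
  next case 10 then show ?case by (simp add: *)
  next case 11 then show ?case by (simp add: *)
  next
    case (12 f a a' g b b')
    then show ?case using F.phi_natural[of f g a b] by (auto simp: * intro!: F.target.iso_square)
  next
    case (13 a b c)
    then show ?case using arg_cong[OF F.phi_asc[of a b c], of "inv_arr S"] by (simp add: *)
  next
    case (14 a)
    then show ?case using arg_cong[OF F.phi_lun[of a], of "inv_arr S"] by (simp add: *)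
  next
    case (15 a)
    then show ?case using arg_cong[OF F.phi_run[of a], of "inv_arr S"] by (simp add: *)
  next
    case (16 a b)
    then show ?case using arg_cong[OF F.phi_sym[of a b], of "inv_arr S"] FAi(1)[of "sym T b a"]
      by (simp add: *)
  qed
qed


text \<open>\<open>op_smc (op_smc T)\<close> need not equal \<open>T\<close> as a record: inverting
  a constraint twice gives it back only where it is an isomorphism, and outside the objects nothing
  is known. So functors are moved across by checking the axioms.\<close>

lemma symmetric_monoidal_functor_op_op:
  fixes T :: "('o1, 'm1) smc" and S :: "('o2, 'm2) smc"
  assumes T: "symmetric_monoidal_category T" and S: "symmetric_monoidal_category S"
    and F: "symmetric_monoidal_functor T S F"
  shows "symmetric_monoidal_functor (op_smc (op_smc T)) S F"
proof -
  interpret F: symmetric_monoidal_functor T S F by fact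
  interpret T: symmetric_monoidal_category "op_smc (op_smc T)"
    by (intro symmetric_monoidal_category_op T)
  show ?thesis
    by unfold_locales
      (auto simp: F.FO_ext F.FA_ext F.phi_ext F.phi_natural F.phi_asc F.phi_lun F.phi_run F.phi_sym)
qed

lemma symmetric_monoidal_functor_op_op':
  fixes T :: "('o1, 'm1) smc" and S :: "('o2, 'm2) smc"
  assumes T: "symmetric_monoidal_category T" and S: "symmetric_monoidal_category S"
    and F: "symmetric_monoidal_functor T (op_smc (op_smc S)) F"
  shows "symmetric_monoidal_functor T S F"
proof -
  interpret F: symmetric_monoidal_functor T "op_smc (op_smc S)" F by fact
  interpret S: symmetric_monoidal_category S by fact
  show ?thesis
  proof (unfold_locales, goal_cases)
    case 1 then show ?case using F.FO_ext by simp
  next case 2 then show ?case using F.FA_ext by simp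
  next case (3 a) then show ?case using F.FO_Ob[of a] by simp
  next case (4 f a b) then show ?case using F.FA_Hom[of f a b] by simp
  next case (5 a) then show ?case using F.FA_Id[of a] by simp
  next case (6 f a b g c) then show ?case using F.FA_Cmp[of f a b g c] by simp
  next case 7 show ?case using F.phi_ext by simp
  next case (8 a b) then show ?case using F.phi_Hom[of a b] by simp
  next case (9 a b) then show ?case using F.phi_iso[of a b] by simp
  next case 10 then show ?case using F.phi0_Hom by simp
  next case 11 then show ?case using F.phi0_iso by simp
  next case (12 f a a' g b b') then show ?case using F.phi_nat[of f a a' g b b'] by simp
  next case (13 a b c)
    then show ?case using F.phi_asc[of a b c] F.FO_Ob[of a] F.FO_Ob[of b] F.FO_Ob[of c] by simp
  next case (14 a) then show ?case using F.phi_lun[of a] F.FO_Ob[of a] by simp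
  next case (15 a) then show ?case using F.phi_run[of a] F.FO_Ob[of a] by simp
  next case (16 a b) then show ?case using F.phi_sym[of a b] F.FO_Ob[of a] F.FO_Ob[of b] by simp
  qed
qed

text \<open>The form in which the dualities are supplied: unrestricted maps on objects and arrows,
  bijective on hom-sets and surjective on objects, so that identities witness essential
  surjectivity.\<close>

lemma weak_equivalence_isomorphism:
  assumes C: "category C" and D: "category D"
    and FO: "\<And>a. a \<in> Ob C \<Longrightarrow> fo a \<in> Ob D" and FO_surj: "\<And>d. d \<in> Ob D \<Longrightarrow> \<exists>a \<in> Ob C. fo a = d"
    and FA: "\<And>f. f \<in> Arr C \<Longrightarrow> fa f \<in> Hom D (fo (Dom C f)) (fo (Cod C f))"
    and FA_Id: "\<And>a. a \<in> Ob C \<Longrightarrow> fa (Id C a) = Id D (fo a)"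
    and FA_Cmp: "\<And>f g. \<lbrakk>f \<in> Arr C; g \<in> Arr C; Dom C g = Cod C f\<rbrakk> \<Longrightarrow> fa (g \<cdot>\<^bsub>C\<^esub> f) = fa g \<cdot>\<^bsub>D\<^esub> fa f"
    and full: "\<And>a b g. \<lbrakk>a \<in> Ob C; b \<in> Ob C; g \<in> Hom D (fo a) (fo b)\<rbrakk> \<Longrightarrow> \<exists>!f. f \<in> Hom C a b \<and> fa f = g"
  shows "weak_equivalence C D \<lparr>FO = restrict fo (Ob C), FA = restrict fa (Arr C)\<rparr>"
proof -
  interpret C: category C by fact
  interpret D: category D by fact
  have "\<exists>c\<in>Ob C. \<exists>g\<in>Hom D (fo c) d. iso_arr D g" if "d \<in> Ob D" for d
    using FO_surj[OF that] that by (metis D.Id_Hom D.iso_Id(1))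
  moreover have "f \<in> Hom C a b \<and> restrict fa (Arr C) f = g \<longleftrightarrow> f \<in> Hom C a b \<and> fa f = g" for f a b g
    by auto
  ultimately show ?thesis unfolding weak_equivalence_def fully_faithful_def cat_functor_def cat_functor_axioms_def
    using assms by simp
qed

lemma category_Alg:
  fixes T :: "('o1, 'm1) smc" and S :: "('o2, 'm2) smc" (structure)
  assumes T: "symmetric_monoidal_category T" and S: "symmetric_monoidal_category S"
  shows "category (Alg T S)"
proof -
  interpret T: symmetric_monoidal_category T by fact
  interpret S: symmetric_monoidal_category S by fact
  show ?thesis unfolding Alg_def
  proof (rule category_transf_category, goal_cases)
    case (1 F)
    then show ?case by (simp add: symmetric_monoidal_functor_def)
  next
    case (4 F)
    then interpret symmetric_monoidal_functor T S F by simp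
    show ?case by simp
  next
    case (5 F F' F'' \<theta> \<psi>)
    interpret F: symmetric_monoidal_functor T S F using 5 by simp
    interpret F': symmetric_monoidal_functor T S F' using 5 by simp
    interpret F'': symmetric_monoidal_functor T S F'' using 5 by simp
    have \<theta>: "\<theta> a \<in> Arr S" "Dom S (\<theta> a) = FO F a" "Cod S (\<theta> a) = FO F' a"
      "\<psi> a \<in> Arr S" "Dom S (\<psi> a) = FO F' a" "Cod S (\<psi> a) = FO F'' a" if "a \<in> Ob T" for a
      using 5(4,5) that by (auto simp: nat_transf_def)
    have p: "\<theta> (a \<boxtimes>\<^bsub>T\<^esub> b) \<cdot> phi F (a, b) = phi F' (a, b) \<cdot> (\<theta> a \<odot> \<theta> b)"
      "\<psi> (a \<boxtimes>\<^bsub>T\<^esub> b) \<cdot> phi F' (a, b) = phi F'' (a, b) \<cdot> (\<psi> a \<odot> \<psi> b)" if "a \<in> Ob T" "b \<in> Ob T" for a b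
      using 5(6,7) that by auto
    have "(\<psi> (a \<boxtimes>\<^bsub>T\<^esub> b) \<cdot> \<theta> (a \<boxtimes>\<^bsub>T\<^esub> b)) \<cdot> phi F (a, b) =
        phi F'' (a, b) \<cdot> ((\<psi> a \<cdot> \<theta> a) \<odot> (\<psi> b \<cdot> \<theta> b))" if ab: "a \<in> Ob T" "b \<in> Ob T" for a b
    proof -
      have "(\<psi> (a \<boxtimes>\<^bsub>T\<^esub> b) \<cdot> \<theta> (a \<boxtimes>\<^bsub>T\<^esub> b)) \<cdot> phi F (a, b) = (\<psi> (a \<boxtimes>\<^bsub>T\<^esub> b) \<cdot> phi F' (a, b)) \<cdot> (\<theta> a \<odot> \<theta> b)"
        using ab by (simp add: \<theta> p(1))
      then show ?thesis using ab by (simp add: \<theta> p(2) S.interchange)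
    qed
    moreover have "(\<psi> (unitO T) \<cdot> \<theta> (unitO T)) \<cdot> phi0 F = phi0 F''"
      using 5(6,7) by (simp add: \<theta>)
    ultimately show ?case by simp
  qed unfold_locales
qed

lemma category_Alg_strict:
  fixes T :: "('o1, 'm1) smc" and S :: "('o2, 'm2) smc"
  assumes T: "symmetric_monoidal_category T" and S: "symmetric_monoidal_category S"
  shows "category (Alg_strict T S)"
proof -
  interpret T: symmetric_monoidal_category T by fact
  interpret S: symmetric_monoidal_category S by fact
  show ?thesis unfolding Alg_strict_def
  proof (rule category_transf_category, goal_cases)
    case (1 F)
    then show ?case by (simp add: symmetric_strict_monoidal_functor_def)
  next
    case (4 F)
    then interpret symmetric_strict_monoidal_functor T S F by simp
    show ?case by (simp add: strict_tensO strict_unitO)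
  next
    case (5 F F' F'' \<theta> \<psi>)
    have \<theta>: "\<theta> a \<in> Arr S" "Dom S (\<theta> a) = FO F a" "Cod S (\<theta> a) = FO F' a"
      "\<psi> a \<in> Arr S" "Dom S (\<psi> a) = FO F' a" "Cod S (\<psi> a) = FO F'' a" if "a \<in> Ob T" for a
      using 5(4,5) that by (auto simp: nat_transf_def)
    show ?case using 5(6,7) by (simp add: \<theta> S.interchange)
  qed unfold_locales
qed

text \<open>An equality of records: \<open>phi\<close> is extensional, so restricting the doubly
  inverted comparison arrows restores the original function.\<close>

lemma dual_mfunctor_involution:
  fixes T :: "('o1, 'm1) smc" and S :: "('o2, 'm2) smc"
  assumes "symmetric_monoidal_functor T S F"
  shows "dual_mfunctor T S (dual_mfunctor T S F) = F"
proof -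
  interpret symmetric_monoidal_functor T S F by fact
  have "phi (dual_mfunctor T S (dual_mfunctor T S F)) = phi F"
    using phi_ext by (auto intro!: restrict_eqI)
  then show ?thesis by (simp add: mfunctor.equality)
qed

lemma dual_mfunctor_op [simp]: "dual_mfunctor (op_smc T) S F = dual_mfunctor T S F"
    "dual_mfunctor T (op_smc S) F = dual_mfunctor T S F"
  by (simp_all add: dual_mfunctor_def)

lemma dual_mfunctor':
  fixes T :: "('o1, 'm1) smc" and S :: "('o2, 'm2) smc"
  assumes T: "symmetric_monoidal_category T" and S: "symmetric_monoidal_category S"
    and F: "symmetric_monoidal_functor T (op_smc S) F"
  shows "symmetric_monoidal_functor (op_smc T) S (dual_mfunctor T S F)"
proof -
  note op = symmetric_monoidal_category_op
  have "symmetric_monoidal_functor (op_smc (op_smc T)) (op_smc S) F"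
    by (intro symmetric_monoidal_functor_op_op T S F op)
  then have "symmetric_monoidal_functor (op_smc T) (op_smc (op_smc S)) (dual_mfunctor T S F)"
    using dual_mfunctor[of "op_smc T" "op_smc S" F] T op by auto
  then show ?thesis by (rule symmetric_monoidal_functor_op_op'[rotated 2]) (intro T S op)+
qed

lemma nat_transf_op_iff:
  fixes T :: "('o1, 'm1) smc" and S :: "('o2, 'm2) smc"
  shows "nat_transf T (op_smc S) F' \<theta> F \<longleftrightarrow> nat_transf (op_smc T) S F \<theta> F'"
  unfolding nat_transf_def by auto

lemma nat_transf_dual_mfunctor [simp]:
  "nat_transf T S (dual_mfunctor T' S' F) \<theta> (dual_mfunctor T' S' F') \<longleftrightarrow> nat_transf T S F \<theta> F'"
  unfolding nat_transf_def by auto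

text \<open>Transformations keep their components and merely exchange source and target.\<close>

lemma weak_equivalence_dual_Alg:
  fixes T :: "('o1, 'm1) smc" and S :: "('o2, 'm2) smc" (structure)
  assumes T: "symmetric_monoidal_category T" and S: "symmetric_monoidal_category S"
  shows "\<exists>F. weak_equivalence (Alg (op_smc T) S) (op_cat (Alg T (op_smc S))) F"
proof -
  let ?d = "dual_mfunctor T S"
  interpret S: symmetric_monoidal_category S by fact
  note op = symmetric_monoidal_category_op
  have Arr: "(?d F', \<theta>, ?d F) \<in> Arr (Alg T (op_smc S)) \<longleftrightarrow> (F, \<theta>, F') \<in> Arr (Alg (op_smc T) S)"
    if FF': "symmetric_monoidal_functor (op_smc T) S F" "symmetric_monoidal_functor (op_smc T) S F'" for F \<theta> F'
  proof -
    interpret F: symmetric_monoidal_functor "op_smc T" S F by fact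
    interpret F': symmetric_monoidal_functor "op_smc T" S F' by fact
    note [simp] = F.phi_Arr[simplified] F'.phi_Arr[simplified] F.phi0_Arr[simplified] F'.phi0_Arr[simplified]
       F.FO_Ob[simplified] F'.FO_Ob[simplified]
    \<comment> \<open>The two compatibility conditions differ by moving the invertible comparison
      arrows to the other side of the equation.\<close>
    have eq1: "\<theta> (a \<boxtimes>\<^bsub>T\<^esub> b) \<cdot> phi F (a, b) = phi F' (a, b) \<cdot> (\<theta> a \<odot> \<theta> b) \<longleftrightarrow>
        inv_arr S (phi F' (a, b)) \<cdot> \<theta> (a \<boxtimes>\<^bsub>T\<^esub> b) = (\<theta> a \<odot> \<theta> b) \<cdot> inv_arr S (phi F (a, b))"
      and eq2: "\<theta> (unitO T) \<cdot> phi0 F = phi0 F' \<longleftrightarrow> inv_arr S (phi0 F') \<cdot> \<theta> (unitO T) = inv_arr S (phi0 F)"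
      if n: "nat_transf (op_smc T) S F \<theta> F'" and ab: "a \<in> Ob T" "b \<in> Ob T" for a b
    proof -
      interpret T: symmetric_monoidal_category T by fact
      have \<theta>: "\<theta> a \<in> Arr S" "Dom S (\<theta> a) = FO F a" "Cod S (\<theta> a) = FO F' a" if "a \<in> Ob T" for a
        using n that by (auto simp: nat_transf_def)
      show "\<theta> (a \<boxtimes>\<^bsub>T\<^esub> b) \<cdot> phi F (a, b) = phi F' (a, b) \<cdot> (\<theta> a \<odot> \<theta> b) \<longleftrightarrow>
        inv_arr S (phi F' (a, b)) \<cdot> \<theta> (a \<boxtimes>\<^bsub>T\<^esub> b) = (\<theta> a \<odot> \<theta> b) \<cdot> inv_arr S (phi F (a, b))"
        using ab S.inv_Cmp_eq_iff[of "inv_arr S (phi F' (a, b))" "\<theta> (a \<boxtimes>\<^bsub>T\<^esub> b)" "(\<theta> a \<odot> \<theta> b) \<cdot> inv_arr S (phi F (a, b))"]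
          S.Cmp_inv_eq_iff[of "phi F (a, b)" "\<theta> (a \<boxtimes>\<^bsub>T\<^esub> b)" "phi F' (a, b) \<cdot> (\<theta> a \<odot> \<theta> b)"]
        by (simp add: \<theta>)
      show "\<theta> (unitO T) \<cdot> phi0 F = phi0 F' \<longleftrightarrow> inv_arr S (phi0 F') \<cdot> \<theta> (unitO T) = inv_arr S (phi0 F)"
        using S.inv_Cmp_eq_iff[of "inv_arr S (phi0 F')" "\<theta> (unitO T)" "inv_arr S (phi0 F)"]
          S.Cmp_inv_eq_iff[of "phi0 F" "\<theta> (unitO T)" "phi0 F'"] by (simp add: \<theta>)
    qed
    note u = symmetric_monoidal_category.unitO_Ob[OF T]
    show ?thesis using FF' eq1 eq2[OF _ u u] T unfolding Alg_def
      by (auto simp: dual_mfunctor nat_transf_op_iff u)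
  qed
  have ObD: "F \<in> Ob (Alg T (op_smc S)) \<longleftrightarrow> (\<exists>F'. symmetric_monoidal_functor (op_smc T) S F' \<and> F = ?d F')" for F
    using dual_mfunctor[OF T] dual_mfunctor'[OF T S, of F] dual_mfunctor_involution[of T "op_smc S" F]
    unfolding Alg_def by auto
  have inj: "?d F = ?d F' \<longleftrightarrow> F = F'"
    if "symmetric_monoidal_functor (op_smc T) S F" "symmetric_monoidal_functor (op_smc T) S F'" for F F'
    using dual_mfunctor_involution[OF that(1)] dual_mfunctor_involution[OF that(2)] by (metis dual_mfunctor_op(1))
  have "weak_equivalence (Alg (op_smc T) S) (op_cat (Alg T (op_smc S)))
    \<lparr>FO = restrict ?d (Ob (Alg (op_smc T) S)),
     FA = restrict (\<lambda>(F, \<theta>, F'). (?d F', \<theta>, ?d F)) (Arr (Alg (op_smc T) S))\<rparr>"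
  proof (rule weak_equivalence_isomorphism, goal_cases)
    case 1 show ?case by (intro category_Alg op T S)
  next case 2 show ?case by (intro category_op_cat category_Alg op T S)
  next case (3 F) then show ?case using ObD by (auto simp: Alg_def)
  next case (4 F) then show ?case using ObD by (auto simp: Alg_def)
  next case (5 f) then show ?case using Arr by (cases f) (auto simp: Alg_def)
  next case (6 F) then show ?case by (simp add: Alg_def)
  next case (7 f g) then show ?case by (cases f; cases g) (simp add: Alg_def)
  next case (8 F F' g)
    then obtain \<theta> where g: "g = (?d F', \<theta>, ?d F)" by (cases g) (auto simp: Alg_def)
    have *: "symmetric_monoidal_functor (op_smc T) S F" "symmetric_monoidal_functor (op_smc T) S F'"
      using 8 by (auto simp: Alg_def)
    have "f \<in> Hom (Alg (op_smc T) S) F F' \<and> (case f of (F, \<theta>, F') \<Rightarrow> (?d F', \<theta>, ?d F)) = g \<longleftrightarrow>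
        f = (F, \<theta>, F')" for f
      using * 8(3) Arr[OF *] inj unfolding g by (cases f) (auto simp: Alg_def)
    then show ?case by simp
  qed
  then show ?thesis by blast
qed

text \<open>A strict functor has no comparison arrows to invert, so the same record serves on both
  sides. Its constraint equations carry over because functors preserve inverses.\<close>

lemma symmetric_strict_monoidal_functor_op:
  fixes T :: "('o1, 'm1) smc" and S :: "('o2, 'm2) smc"
  assumes T: "symmetric_monoidal_category T" and S: "symmetric_monoidal_category S"
  shows "symmetric_strict_monoidal_functor T (op_smc S) F \<longleftrightarrow> symmetric_strict_monoidal_functor (op_smc T) S F"
    (is "?L \<longleftrightarrow> ?R")
proof
  interpret T: symmetric_monoidal_category T by fact
  interpret S: symmetric_monoidal_category S by fact
  interpret oT: symmetric_monoidal_category "op_smc T" by (rule symmetric_monoidal_category_op[OF T])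
  interpret oS: symmetric_monoidal_category "op_smc S" by (rule symmetric_monoidal_category_op[OF S])
  {
    assume ?L
    then interpret F: symmetric_strict_monoidal_functor T "op_smc S" F .
    note [simp] = F.FO_Ob[simplified] F.FA_Arr[simplified] F.FA_iso(2)[simplified]
      F.strict_FA_asc[simplified] F.strict_FA_lun[simplified] F.strict_FA_run[simplified] F.strict_FA_sym[simplified]
    show ?R
      by unfold_locales
        (use F.FO_ext F.FA_ext F.FA_Id F.FA_Cmp' F.strict_tensO F.strict_unitO F.strict_tensA in auto)
  next
    assume ?R
    then interpret F: symmetric_strict_monoidal_functor "op_smc T" S F .
    have i: "FA F (inv_arr T f) = inv_arr S (FA F f)" "iso_arr S (FA F f)" if "iso_arr T f" for f
      using F.FA_iso[of f] that by auto
    have inv: "FA F f = inv_arr S x" if "inv_arr S (FA F f) = x" "iso_arr T f" for f x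
      using S.iso_inv(2)[OF i(2)[OF that(2)]] that(1) by simp
    note [simp] = F.FO_Ob[simplified] F.FA_Arr[simplified] i
    show ?L
    proof (unfold_locales, goal_cases)
      case (10 a b c)
      then show ?case using inv[OF F.strict_FA_asc[of a b c, simplified]] by simp
    next
      case (11 a)
      then show ?case using inv[OF F.strict_FA_lun[of a, simplified]] by simp
    next
      case (12 a)
      then show ?case using inv[OF F.strict_FA_run[of a, simplified]] by simp
    next
      case (13 a b)
      then show ?case using F.strict_FA_sym[of b a, simplified] by simp
    qed (use F.FO_ext F.FA_ext F.FA_Id F.FA_Cmp' F.strict_tensO F.strict_unitO F.strict_tensA in auto)
  }
qed

lemma weak_equivalence_dual_Alg_strict:
  fixes T :: "('o1, 'm1) smc" and S :: "('o2, 'm2) smc"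
  assumes T: "symmetric_monoidal_category T" and S: "symmetric_monoidal_category S"
  shows "\<exists>F. weak_equivalence (Alg_strict (op_smc T) S) (op_cat (Alg_strict T (op_smc S))) F"
proof -
  note op = symmetric_monoidal_category_op
  have "weak_equivalence (Alg_strict (op_smc T) S) (op_cat (Alg_strict T (op_smc S)))
    \<lparr>FO = restrict (\<lambda>F. F) (Ob (Alg_strict (op_smc T) S)),
     FA = restrict (\<lambda>(F, \<theta>, F'). (F', \<theta>, F)) (Arr (Alg_strict (op_smc T) S))\<rparr>"
  proof (rule weak_equivalence_isomorphism, goal_cases)
    case 1 show ?case by (intro category_Alg_strict op T S)
  next case 2 show ?case by (intro category_op_cat category_Alg_strict op T S)
  next case (3 F) then show ?case by (auto simp: Alg_strict_def symmetric_strict_monoidal_functor_op[OF T S])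
  next case (4 F) then show ?case by (auto simp: Alg_strict_def symmetric_strict_monoidal_functor_op[OF T S])
  next case (5 f) then show ?case
      by (cases f) (auto simp: Alg_strict_def nat_transf_op_iff symmetric_strict_monoidal_functor_op[OF T S])
  next case (6 F) then show ?case by (simp add: Alg_strict_def)
  next case (7 f g) then show ?case by (cases f; cases g) (simp add: Alg_strict_def)
  next case (8 F F' g)
    then obtain \<theta> where g: "g = (F', \<theta>, F)" by (cases g) (auto simp: Alg_strict_def)
    have "f \<in> Hom (Alg_strict (op_smc T) S) F F' \<and> (case f of (F, \<theta>, F') \<Rightarrow> (F', \<theta>, F)) = g \<longleftrightarrow>
        f = (F, \<theta>, F')" for f
      using 8(3) unfolding g
      by (cases f) (auto simp: Alg_strict_def nat_transf_op_iff symmetric_strict_monoidal_functor_op[OF T S])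
    then show ?case by simp
  qed
  then show ?thesis by blast
qed

section \<open>Commutative monoids and cocommutative comonoids\<close>

lemma CommMon_sel [simp]:
  "Ob (CommMon S) = {A. is_comm_monoid S A}"
  "(A, f, B) \<in> Arr (CommMon S) \<longleftrightarrow> is_comm_monoid S A \<and> is_comm_monoid S B \<and> is_monoid_hom S A f B"
  "Dom (CommMon S) (A, f, B) = A" "Cod (CommMon S) (A, f, B) = B"
  "Id (CommMon S) A = (A, Id S (obj A), A)"
  "Cmp (CommMon S) (B', g, C) (A, f, B) = (A, g \<cdot>\<^bsub>S\<^esub> f, C)"
  by (auto simp: CommMon_def)

lemma CocommComon_sel [simp]:
  "Ob (CocommComon S) = {A. is_cocomm_comonoid S A}"
  "(A, f, B) \<in> Arr (CocommComon S) \<longleftrightarrow>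
     is_cocomm_comonoid S A \<and> is_cocomm_comonoid S B \<and> is_comonoid_hom S A f B"
  "Dom (CocommComon S) (A, f, B) = A" "Cod (CocommComon S) (A, f, B) = B"
  "Id (CocommComon S) A = (A, Id S (coobj A), A)"
  "Cmp (CocommComon S) (B', g, C) (A, f, B) = (A, g \<cdot>\<^bsub>S\<^esub> f, C)"
  by (auto simp: CocommComon_def)

lemma one_object_cat_sel [simp]:
  "Ob (one_object_cat G) = UNIV" "Arr (one_object_cat G) = carrier G" "Dom (one_object_cat G) g = ()"
  "Cod (one_object_cat G) g = ()" "Id (one_object_cat G) u = \<one>\<^bsub>G\<^esub>"
  "Cmp (one_object_cat G) h g = h \<otimes>\<^bsub>G\<^esub> g"
  by (auto simp: one_object_cat_def)

context symmetric_monoidal_category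
begin

lemma is_comm_monoidD:
  assumes "is_comm_monoid S A"
  shows "obj A \<in> Ob S" "mu A \<in> Arr S" "Dom S (mu A) = obj A \<boxtimes> obj A" "Cod S (mu A) = obj A"
    "eta A \<in> Arr S" "Dom S (eta A) = unitO S" "Cod S (eta A) = obj A"
  using assms by (auto simp: is_comm_monoid_def)

lemma is_monoid_homD:
  assumes "is_monoid_hom S A f B"
  shows "f \<in> Arr S" "Dom S f = obj A" "Cod S f = obj B"
    "f \<cdot> mu A = mu B \<cdot> (f \<odot> f)" "f \<cdot> eta A = eta B"
  using assms by (auto simp: is_monoid_hom_def)

lemma is_monoid_hom_Id: "is_comm_monoid S A \<Longrightarrow> is_monoid_hom S A (Id S (obj A)) A"
  using is_comm_monoidD[of A] by (simp add: is_monoid_hom_def)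

lemma is_monoid_hom_Cmp:
  assumes "is_comm_monoid S A" "is_comm_monoid S B" "is_comm_monoid S C"
    "is_monoid_hom S A f B" "is_monoid_hom S B g C"
  shows "is_monoid_hom S A (g \<cdot> f) C"
proof -
  note [simp] = assms(1-3)[THEN is_comm_monoidD(1)] assms(1-3)[THEN is_comm_monoidD(2)]
    assms(1-3)[THEN is_comm_monoidD(3)] assms(1-3)[THEN is_comm_monoidD(4)]
    assms(1-3)[THEN is_comm_monoidD(5)] assms(1-3)[THEN is_comm_monoidD(6)]
    assms(1-3)[THEN is_comm_monoidD(7)] is_monoid_homD(1-3)[OF assms(4)] is_monoid_homD(1-3)[OF assms(5)]
  have "g \<cdot> f \<cdot> mu A = (g \<cdot> mu B) \<cdot> (f \<odot> f)" by (simp add: is_monoid_homD(4)[OF assms(4)])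
  also have "\<dots> = mu C \<cdot> ((g \<cdot> f) \<odot> (g \<cdot> f))"
    unfolding is_monoid_homD(4)[OF assms(5)] by (simp add: interchange)
  finally show ?thesis
    using is_monoid_homD(5)[OF assms(4)] is_monoid_homD(5)[OF assms(5)] by (simp add: is_monoid_hom_def)
qed

lemma category_CommMon: "category (CommMon S)"
proof (unfold_locales, goal_cases)
  case (1 f) then show ?case by (cases f) auto
next case (2 f) then show ?case by (cases f) auto
next case (3 A) then show ?case by (simp add: is_monoid_hom_Id)
next case (4 f A B g C) then show ?case by (cases f; cases g) (auto intro: is_monoid_hom_Cmp)
next case (5 f A B) then show ?case by (cases f) (auto simp: is_monoid_hom_def)
next case (6 f A B) then show ?case by (cases f) (auto simp: is_monoid_hom_def)
next case (7 f A B g C h D)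
  then show ?case by (cases f; cases g; cases h) (auto simp: is_monoid_hom_def)
qed

end

lemma category_one_object_cat: "group G \<Longrightarrow> category (one_object_cat G)"
proof -
  assume "group G"
  then interpret group G .
  show ?thesis by unfold_locales (auto simp: m_assoc)
qed

lemma category_functor_category:
  assumes "category C" "category D" shows "category (functor_category C D)"
  unfolding functor_category_def by (rule category_transf_category) (use assms in auto)

lemma cfunctor_eqI:
  fixes F F' :: "(unit, 'm1, 'o2, 'm2) cfunctor"
  assumes "FO F () = FO F' ()" "FA F = FA F'"
  shows "F = F'"
  using assms by (intro cfunctor.equality ext) auto

section \<open>Comonoids as monoids in the opposite category\<close>

definition comon_of_mon :: "('o, 'm) mon \<Rightarrow> ('o, 'm) comon"
  where "comon_of_mon A = \<lparr>coobj = obj A, delta = mu A, counit = eta A\<rparr>"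

lemma comon_of_mon_sel [simp]: "coobj (comon_of_mon A) = obj A" "delta (comon_of_mon A) = mu A"
  "counit (comon_of_mon A) = eta A"
  by (auto simp: comon_of_mon_def)

definition mon_of_comon :: "('o, 'm) comon \<Rightarrow> ('o, 'm) mon"
  where "mon_of_comon A = \<lparr>obj = coobj A, mu = delta A, eta = counit A\<rparr>"

lemma mon_of_comon_sel [simp]: "obj (mon_of_comon A) = coobj A" "mu (mon_of_comon A) = delta A"
  "eta (mon_of_comon A) = counit A" "comon_of_mon (mon_of_comon A) = A" "mon_of_comon (comon_of_mon B) = B"
  by (auto simp: comon_of_mon_def mon_of_comon_def)

context
  fixes S :: "('o, 'm) smc" (structure)
  assumes S: "symmetric_monoidal_category S"
begin

interpretation symmetric_monoidal_category S by (rule S)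

text \<open>The axioms agree once the associator and the unitors are moved to the other side. With
  wrong domains or codomains both sides are false, which is the second case.\<close>

lemma is_cocomm_comonoid_comon_of_mon:
  "is_cocomm_comonoid S (comon_of_mon A) \<longleftrightarrow> is_comm_monoid (op_smc S) A"
proof (cases "obj A \<in> Ob S \<and> mu A \<in> Hom S (obj A) (obj A \<boxtimes> obj A) \<and> eta A \<in> Hom S (obj A) (unitO S)")
  case True
  have 1: "asc S (obj A) (obj A) (obj A) \<cdot> (mu A \<odot> Id S (obj A)) \<cdot> mu A =
      (Id S (obj A) \<odot> mu A) \<cdot> mu A \<longleftrightarrow>
    (mu A \<odot> Id S (obj A)) \<cdot> mu A =
      inv_arr S (asc S (obj A) (obj A) (obj A)) \<cdot> (Id S (obj A) \<odot> mu A) \<cdot> mu A"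
    using True by (intro inv_Cmp_eq_iff) auto
  have 2: "lun S (obj A) \<cdot> (eta A \<odot> Id S (obj A)) \<cdot> mu A = Id S (obj A) \<longleftrightarrow>
      (eta A \<odot> Id S (obj A)) \<cdot> mu A = inv_arr S (lun S (obj A)) \<cdot> Id S (obj A)"
    using True by (intro inv_Cmp_eq_iff) auto
  have 3: "run S (obj A) \<cdot> (Id S (obj A) \<odot> eta A) \<cdot> mu A = Id S (obj A) \<longleftrightarrow>
      (Id S (obj A) \<odot> eta A) \<cdot> mu A = inv_arr S (run S (obj A)) \<cdot> Id S (obj A)"
    using True by (intro inv_Cmp_eq_iff) auto
  show ?thesis using True 1 2 3 by (auto simp: is_cocomm_comonoid_def is_comm_monoid_def)
qed (auto simp: is_cocomm_comonoid_def is_comm_monoid_def)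

lemma is_comonoid_hom_comon_of_mon:
  "is_comonoid_hom S (comon_of_mon A) f (comon_of_mon B) \<longleftrightarrow> is_monoid_hom (op_smc S) B f A"
  by (auto simp: is_comonoid_hom_def is_monoid_hom_def)

end


lemma category_CocommComon:
  fixes S :: "('o, 'm) smc"
  assumes S: "symmetric_monoidal_category S"
  shows "category (CocommComon S)"
proof -
  interpret symmetric_monoidal_category S by fact
  show ?thesis
  proof (unfold_locales, goal_cases)
    case (1 f) then show ?case by (cases f) auto
  next case (2 f) then show ?case by (cases f) auto
  next case (3 A) then show ?case
      by (auto simp: is_comonoid_hom_def is_cocomm_comonoid_def)
  next case (4 f A B g C)
    \<comment> \<open>The closure under composition is borrowed from monoid homomorphisms in the
      opposite category.\<close>
    interpret C: category "CommMon (op_smc S)"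
      by (intro symmetric_monoidal_category.category_CommMon symmetric_monoidal_category_op S)
    let ?i = mon_of_comon
    obtain u v where uv: "f = (A, u, B)" "g = (B, v, C)" using 4 by (cases f; cases g) auto
    have "(?i B, u, ?i A) \<in> Hom (CommMon (op_smc S)) (?i B) (?i A)"
      "(?i C, v, ?i B) \<in> Hom (CommMon (op_smc S)) (?i C) (?i B)"
      using 4 uv is_comonoid_hom_comon_of_mon[OF S, of "?i A" u "?i B"]
        is_comonoid_hom_comon_of_mon[OF S, of "?i B" v "?i C"] is_cocomm_comonoid_comon_of_mon[OF S, of "?i A"]
        is_cocomm_comonoid_comon_of_mon[OF S, of "?i B"] is_cocomm_comonoid_comon_of_mon[OF S, of "?i C"]
      by auto
    from C.Cmp_Hom[OF this(2,1)]
    have "is_comonoid_hom S A (v \<cdot>\<^bsub>S\<^esub> u) C"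
      using is_comonoid_hom_comon_of_mon[OF S, of "?i A" "v \<cdot>\<^bsub>S\<^esub> u" "?i C"] by auto
    then show ?case using 4 uv by auto
  next case (5 f A B) then show ?case by (cases f) (auto simp: is_comonoid_hom_def)
  next case (6 f A B) then show ?case by (cases f) (auto simp: is_comonoid_hom_def)
  next case (7 f A B g C h D)
    then show ?case by (cases f; cases g; cases h) (auto simp: is_comonoid_hom_def)
  qed
qed

text \<open>The inverse turns the right action obtained from a contravariant assignment into a left one.\<close>

definition contra_action :: "('g, 'b) monoid_scheme \<Rightarrow> ('o1 \<Rightarrow> 'o2) \<Rightarrow> ('m1 \<Rightarrow> 'm2) \<Rightarrow>
    (unit, 'g, 'o1, 'm1) cfunctor \<Rightarrow> (unit, 'g, 'o2, 'm2) cfunctor"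
  where "contra_action G c \<phi> H =
    \<lparr>FO = (\<lambda>u. c (FO H u)), FA = restrict (\<lambda>g. \<phi> (FA H (inv\<^bsub>G\<^esub> g))) (carrier G)\<rparr>"

lemma contra_action_sel [simp]:
  "FO (contra_action G c \<phi> H) u = c (FO H u)"
  "FA (contra_action G c \<phi> H) = restrict (\<lambda>g. \<phi> (FA H (inv\<^bsub>G\<^esub> g))) (carrier G)"
  by (auto simp: contra_action_def)

text \<open>Contravariant functors given by raw maps. The instance of interest exchanges commutative
  monoids in \<open>op_smc S\<close> with cocommutative comonoids in \<open>S\<close>, whose
  homomorphisms point in opposite directions.\<close>

locale contravariant =
  source: category C + target: category D
  for C :: "('o1, 'm1, 'x) cat_scheme" and D :: "('o2, 'm2, 'y) cat_scheme" +
  fixes c :: "'o1 \<Rightarrow> 'o2" and \<phi> :: "'m1 \<Rightarrow> 'm2"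
  assumes c_Ob: "a \<in> Ob C \<Longrightarrow> c a \<in> Ob D"
    and \<phi>_Hom: "f \<in> Arr C \<Longrightarrow> \<phi> f \<in> Hom D (c (Cod C f)) (c (Dom C f))"
    and \<phi>_Id: "a \<in> Ob C \<Longrightarrow> \<phi> (Id C a) = Id D (c a)"
    and \<phi>_Cmp: "\<lbrakk>f \<in> Arr C; g \<in> Arr C; Dom C g = Cod C f\<rbrakk> \<Longrightarrow> \<phi> (g \<cdot>\<^bsub>C\<^esub> f) = \<phi> f \<cdot>\<^bsub>D\<^esub> \<phi> g"
begin

lemma cat_functor_contra_action:
  assumes "group G" and "cat_functor (one_object_cat G) C H"
  shows "cat_functor (one_object_cat G) D (contra_action G c \<phi> H)"
proof -
  interpret G: group G by fact
  interpret H: cat_functor "one_object_cat G" C H by fact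
  have H: "FA H g \<in> Arr C" "Dom C (FA H g) = FO H ()" "Cod C (FA H g) = FO H ()" if "g \<in> carrier G" for g
    using H.FA_Arr[of g] that by auto
  show ?thesis
  proof (unfold_locales, goal_cases)
    case (6 f a b g d)
    then show ?case
      using H.FA_Cmp'[of "inv\<^bsub>G\<^esub> g" "inv\<^bsub>G\<^esub> f"] by (simp add: G.inv_mult_group \<phi>_Cmp H)
  qed (use \<phi>_Hom c_Ob \<phi>_Id H.FA_Id' H.FO_Ob in \<open>auto simp: H\<close>)
qed

text \<open>Naturality of the image at \<open>g\<close> comes from the original naturality at the
  inverse of \<open>g\<close>, which again ranges over the whole group.\<close>

lemma nat_transf_contra_action:
  assumes "group G" and H: "cat_functor (one_object_cat G) C H" "cat_functor (one_object_cat G) C H'"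
    and \<theta>: "nat_transf (one_object_cat G) C H \<theta> H'"
  shows "nat_transf (one_object_cat G) D (contra_action G c \<phi> H') (\<lambda>u. \<phi> (\<theta> u)) (contra_action G c \<phi> H)"
proof -
  interpret G: group G by fact
  note Ha = cat_functor.FA_Arr[OF H(1)] cat_functor.FA_Arr[OF H(2)]
  have \<theta>a: "\<theta> u \<in> Arr C" "Dom C (\<theta> u) = FO H ()" "Cod C (\<theta> u) = FO H' ()" for u
    using \<theta> by (auto simp: nat_transf_def)
  have "\<phi> (\<theta> ()) \<cdot>\<^bsub>D\<^esub> \<phi> (FA H' g) = \<phi> (FA H g) \<cdot>\<^bsub>D\<^esub> \<phi> (\<theta> ())" if "g \<in> carrier G" for g
  proof -
    have "\<theta> () \<cdot>\<^bsub>C\<^esub> FA H g = FA H' g \<cdot>\<^bsub>C\<^esub> \<theta> ()" using \<theta> that by (auto simp: nat_transf_def)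
    then show ?thesis using that Ha \<phi>_Cmp[of "FA H g" "\<theta> ()"] \<phi>_Cmp[of "\<theta> ()" "FA H' g"] by (simp add: \<theta>a)
  qed
  then show ?thesis using \<phi>_Hom \<theta>a by (auto simp: nat_transf_def)
qed

end

lemma contra_action_inverse:
  assumes "group G" "cat_functor (one_object_cat G) C H"
    and "\<And>a. a \<in> Ob C \<Longrightarrow> c' (c a) = a" "\<And>f. f \<in> Arr C \<Longrightarrow> \<phi>' (\<phi> f) = f"
  shows "contra_action G c' \<phi>' (contra_action G c \<phi> H) = H"
proof -
  interpret G: group G by fact
  interpret H: cat_functor "one_object_cat G" C H by fact
  show ?thesis
    using assms(3,4) H.FA_ext H.FO_Ob[of "()"] H.FA_Arr by (auto intro!: cfunctor_eqI restrict_eqI)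
qed

text \<open>The two contravariant functors are mutually inverse. The action itself stays covariant
  thanks to the inverse in G, but transformations are reversed; hence the opposite on one
  side.\<close>

lemma weak_equivalence_contra_action:
  assumes G: "group G" and CD: "contravariant C D c \<phi>" and DC: "contravariant D C c' \<phi>'"
    and cc': "\<And>a. a \<in> Ob C \<Longrightarrow> c' (c a) = a" "\<And>f. f \<in> Arr C \<Longrightarrow> \<phi>' (\<phi> f) = f"
    and c'c: "\<And>a. a \<in> Ob D \<Longrightarrow> c (c' a) = a" "\<And>f. f \<in> Arr D \<Longrightarrow> \<phi> (\<phi>' f) = f"
  shows "\<exists>F. weak_equivalence (op_cat (functor_category (one_object_cat G) C))
               (functor_category (one_object_cat G) D) F"
proof -
  interpret CD: contravariant C D c \<phi> by fact
  interpret DC: contravariant D C c' \<phi>' by fact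
  let ?k = "contra_action G c \<phi>" and ?k' = "contra_action G c' \<phi>'"
  let ?C = "op_cat (functor_category (one_object_cat G) C)" and ?D = "functor_category (one_object_cat G) D"
  have one: "category (one_object_cat G)" using G by (rule category_one_object_cat)
  have kk': "?k' (?k H) = H" if "cat_functor (one_object_cat G) C H" for H
    using contra_action_inverse[OF G that] cc' by blast
  have k'k: "?k (?k' H) = H" if "cat_functor (one_object_cat G) D H" for H
    using contra_action_inverse[OF G that] c'c by blast
  have "weak_equivalence ?C ?D
    \<lparr>FO = restrict ?k (Ob ?C), FA = restrict (\<lambda>(H, \<theta>, H'). (?k H', (\<lambda>u. \<phi> (\<theta> u)), ?k H)) (Arr ?C)\<rparr>"
  proof (rule weak_equivalence_isomorphism, goal_cases)
    case 1 show ?case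
      by (intro category_op_cat category_functor_category one CD.source.category_axioms)
  next case 2 show ?case
      by (intro category_functor_category one CD.target.category_axioms)
  next case (3 H) then show ?case by (auto simp: functor_category_def CD.cat_functor_contra_action G)
  next case (4 H) then show ?case using DC.cat_functor_contra_action[OF G, of H] k'k[of H]
      by (auto simp: functor_category_def)
  next case (5 f) then show ?case
      by (cases f) (auto simp: functor_category_def CD.cat_functor_contra_action CD.nat_transf_contra_action G)
  next case (6 H)
    then have "cat_functor (one_object_cat G) C H" by (simp add: functor_category_def)
    from cat_functor.FO_Ob[OF this] show ?case by (auto simp: functor_category_def CD.\<phi>_Id)
  next case (7 f g)
    then show ?case
      by (cases f; cases g)
        (auto simp: functor_category_def nat_transf_def CD.\<phi>_Cmp intro!: ext)
  next case (8 H H' g)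
    then obtain \<theta> where g: "g = (?k H, \<theta>, ?k H')" by (cases g) (auto simp: functor_category_def)
    have H: "cat_functor (one_object_cat G) C H" "cat_functor (one_object_cat G) C H'"
      using 8 by (auto simp: functor_category_def)
    have \<theta>: "nat_transf (one_object_cat G) D (?k H) \<theta> (?k H')"
      using 8(3) g by (auto simp: functor_category_def)
    have n: "nat_transf (one_object_cat G) C H' (\<lambda>u. \<phi>' (\<theta> u)) H"
      using DC.nat_transf_contra_action[OF G _ _ \<theta>] CD.cat_functor_contra_action[OF G] H kk' by simp
    have a: "\<theta> u \<in> Arr D" for u using \<theta> by (auto simp: nat_transf_def)
    have inv: "\<phi> x = y \<longleftrightarrow> x = \<phi>' y" if "x \<in> Arr C" "y \<in> Arr D" for x y
      using that cc' c'c by auto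
    have "f \<in> Hom ?C H H' \<and> (case f of (H, \<theta>, H') \<Rightarrow> (?k H', (\<lambda>u. \<phi> (\<theta> u)), ?k H)) = g \<longleftrightarrow>
        f = (H', (\<lambda>u. \<phi>' (\<theta> u)), H)" for f
      using H n a unfolding g
      by (cases f) (auto simp: functor_category_def nat_transf_def fun_eq_iff inv)
    then show ?case by simp
  qed
  then show ?thesis by blast
qed

lemma weak_equivalence_dual_comonoids:
  fixes S :: "('o, 'm) smc" and G :: "('g, 'b) monoid_scheme"
  assumes S: "symmetric_monoidal_category S" and G: "group G"
  shows "\<exists>F. weak_equivalence (op_cat (G_comm_monoids G (op_smc S))) (G_cocomm_comonoids G S) F"
proof -
  let ?c = "comon_of_mon :: ('o, 'm) mon \<Rightarrow> ('o, 'm) comon"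
  interpret S: symmetric_monoidal_category S by fact
  interpret oS: symmetric_monoidal_category "op_smc S" by (rule symmetric_monoidal_category_op[OF S])
  note eqs = is_cocomm_comonoid_comon_of_mon[OF S] is_comonoid_hom_comon_of_mon[OF S]
  have eqs': "is_comm_monoid (op_smc S) (mon_of_comon A) \<longleftrightarrow> is_cocomm_comonoid S A"
    "is_monoid_hom (op_smc S) (mon_of_comon A) f (mon_of_comon B) \<longleftrightarrow> is_comonoid_hom S B f A" for A B f
    by (simp_all flip: eqs)
  show ?thesis
  proof (rule weak_equivalence_contra_action[OF G, of _ _ ?c "\<lambda>(A, f, B). (?c B, f, ?c A)"
        mon_of_comon "\<lambda>(A, f, B). (mon_of_comon B, f, mon_of_comon A)"], goal_cases)
    case 1
    show ?case
    proof (intro contravariant.intro contravariant_axioms.intro oS.category_CommMon category_CocommComon S, goal_cases)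
      case (2 f) then show ?case by (cases f) (auto simp: eqs)
    next case (4 f g) then show ?case by (cases f; cases g) auto
    qed (auto simp: eqs)
  next
    case 2
    show ?case
    proof (intro contravariant.intro contravariant_axioms.intro oS.category_CommMon category_CocommComon S, goal_cases)
      case (2 f) then show ?case by (cases f) (auto simp: eqs')
    next case (4 f g) then show ?case by (cases f; cases g) auto
    qed (auto simp: eqs')
  qed (auto split: prod.splits)
qed

section \<open>Monoids in a PROP\<close>

context prop_cat
begin

abbreviation I where "I \<equiv> Id T"
abbreviation cmp (infixr \<open>\<bullet>\<close> 65) where "g \<bullet> f \<equiv> g \<cdot>\<^bsub>T\<^esub> f"
abbreviation tns (infixr \<open>\<star>\<close> 70) where "f \<star> g \<equiv> f \<odot>\<^bsub>T\<^esub> g"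

lemmas [simp] = prop_cat_Ob prop_cat_tensO prop_cat_unitO

lemma asc_Id [simp]: "asc T a b c = I (a + (b + c))"
  using strict_asc[of a b c] by simp

lemma lun_Id [simp]: "lun T a = I a" and run_Id [simp]: "run T a = I a"
  using strict_lun[of a] strict_run[of a] by simp_all

text \<open>Strictness is an assumption on objects and constraints. For arrows it follows from
  naturality of an associator that is an identity.\<close>

lemma tensA_assoc [simp]:
  "\<lbrakk>f \<in> Arr T; g \<in> Arr T; h \<in> Arr T\<rbrakk> \<Longrightarrow> (f \<star> g) \<star> h = f \<star> g \<star> h"
  using asc_natural[of f g h "Cod T f" "Cod T g" "Cod T h"] by (simp add: add.assoc)

lemma tensA_unit [simp]: "f \<in> Arr T \<Longrightarrow> I 0 \<star> f = f" "f \<in> Arr T \<Longrightarrow> f \<star> I 0 = f"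
  using lun_natural[of f "Cod T f"] run_natural[of f "Cod T f"] by simp_all

text \<open>Keeps neighbouring identities merged after \<open>tensA_assoc\<close> has nested tensor
  products to the right.\<close>

lemma Id_Id_tensA [simp]: "f \<in> Arr T \<Longrightarrow> I a \<star> I b \<star> f = I (a + b) \<star> f"
  using tensA_assoc[of "I a" "I b" f] by (simp del: tensA_assoc)

lemma slide:
  assumes "f \<in> Arr T" "g \<in> Arr T"
  shows "\<lbrakk>Dom T f = a; Cod T g = b\<rbrakk> \<Longrightarrow> (f \<star> I b) \<bullet> (I a \<star> g) = f \<star> g"
    and "\<lbrakk>Cod T f = a; Dom T g = b\<rbrakk> \<Longrightarrow> (I a \<star> g) \<bullet> (f \<star> I b) = f \<star> g"
  using assms by (auto simp: interchange)

lemma whisker_Cmp: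
  assumes "f \<in> Arr T" "g \<in> Arr T" "Dom T g = Cod T f"
  shows "I a \<star> (g \<bullet> f) = (I a \<star> g) \<bullet> (I a \<star> f)" "(g \<bullet> f) \<star> I a = (g \<star> I a) \<bullet> (f \<star> I a)"
  using assms by (simp_all add: interchange)

text \<open>The hexagon with identity associators. Its inverse is the corresponding law for sums in
  the first argument.\<close>

lemma sym_add_right: "sym T a (b + c) = (I b \<star> sym T a c) \<bullet> (sym T a b \<star> I c)"
  using hexagon[of a b c] by (simp add: add.assoc)

lemma sym_add_left: "sym T (a + b) c = (sym T a c \<star> I b) \<bullet> (I a \<star> sym T b c)"
  using arg_cong[OF sym_add_right[of c a b], of "inv_arr T"] by simp

text \<open>The hexagon with two of its objects equal to 0 makes \<open>sym T a 0\<close>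
  idempotent, and an invertible idempotent is an identity.\<close>

lemma sym_0 [simp]: "sym T a 0 = I a" "sym T 0 a = I a"
proof -
  have "sym T a 0 \<bullet> sym T a 0 = sym T a 0 \<bullet> I a"
    using sym_add_right[of a 0 0] by simp
  then show *: "sym T a 0 = I a" by (rule iso_cancel_left) auto
  show "sym T 0 a = I a" using arg_cong[OF *, of "inv_arr T"] by simp
qed

lemma interchange3:
  assumes "f \<in> Arr T" "f' \<in> Arr T" "g \<in> Arr T" "g' \<in> Arr T" "h \<in> Arr T" "h' \<in> Arr T"
    "Dom T f' = Cod T f" "Dom T g' = Cod T g" "Dom T h' = Cod T h"
  shows "(f' \<star> g' \<star> h') \<bullet> (f \<star> g \<star> h) = (f' \<bullet> f) \<star> (g' \<bullet> g) \<star> (h' \<bullet> h)"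
  using assms by (simp add: interchange)

text \<open>Tensor products, and the uniqueness of homomorphisms out of them, rest on the unit laws;
  their existence rests on \<open>medial\<close>.\<close>

definition is_magma :: "(nat, 'm) mon \<Rightarrow> bool"
  where "is_magma A \<longleftrightarrow> mu A \<in> Hom T (obj A + obj A) (obj A) \<and> eta A \<in> Hom T 0 (obj A) \<and>
    mu A \<bullet> (eta A \<star> I (obj A)) = I (obj A) \<and> mu A \<bullet> (I (obj A) \<star> eta A) = I (obj A)"

definition unit_mon :: "(nat, 'm) mon"
  where "unit_mon = \<lparr>obj = 0, mu = I 0, eta = I 0\<rparr>"

definition tens_mon :: "(nat, 'm) mon \<Rightarrow> (nat, 'm) mon \<Rightarrow> (nat, 'm) mon"
  where "tens_mon A B = \<lparr>obj = obj A + obj B,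
    mu = (mu A \<star> mu B) \<bullet> (I (obj A) \<star> sym T (obj B) (obj A) \<star> I (obj B)),
    eta = eta A \<star> eta B\<rparr>"

text \<open>By the Eckmann-Hilton argument, the commutative monoids are the unital magmas whose
  multiplication is a homomorphism. This form of the axioms passes to tensor products at once.\<close>

definition medial :: "(nat, 'm) mon \<Rightarrow> bool"
  where "medial A \<longleftrightarrow> is_monoid_hom T (tens_mon A A) (mu A) A"

lemma unit_mon_sel [simp]: "obj unit_mon = 0" "mu unit_mon = I 0" "eta unit_mon = I 0"
  by (auto simp: unit_mon_def)

lemma tens_mon_sel [simp]: "obj (tens_mon A B) = obj A + obj B"
  "mu (tens_mon A B) = (mu A \<star> mu B) \<bullet> (I (obj A) \<star> sym T (obj B) (obj A) \<star> I (obj B))"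
  "eta (tens_mon A B) = eta A \<star> eta B"
  by (auto simp: tens_mon_def)

lemma is_magmaD [simp]:
  assumes "is_magma A"
  shows "mu A \<in> Arr T" "Dom T (mu A) = obj A + obj A" "Cod T (mu A) = obj A"
    "eta A \<in> Arr T" "Dom T (eta A) = 0" "Cod T (eta A) = obj A"
    "mu A \<bullet> (eta A \<star> I (obj A)) = I (obj A)" "mu A \<bullet> (I (obj A) \<star> eta A) = I (obj A)"
  using assms by (auto simp: is_magma_def)

lemma is_magma_unit [simp]: "is_magma unit_mon"
  by (simp add: is_magma_def)

lemma is_magma_tens [simp]:
  assumes A: "is_magma A" and B: "is_magma B"
  shows "is_magma (tens_mon A B)"
proof -
  let ?a = "obj A" and ?b = "obj B"
  let ?t = "I ?a \<star> sym T ?b ?a \<star> I ?b"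
  note [simp] = A B
  \<comment> \<open>A symmetry moves a unit across without leaving a trace: by naturality it turns
    into a symmetry with the object 0.\<close>
  have s: "sym T ?b ?a \<bullet> (eta B \<star> I ?a) = I ?a \<star> eta B" "sym T ?b ?a \<bullet> (I ?b \<star> eta A) = eta A \<star> I ?b"
    using sym_natural[of "eta B" "I ?a" ?b ?a] sym_natural[of "I ?b" "eta A" ?b ?a] by simp_all
  have "?t \<bullet> (eta A \<star> (eta B \<star> I ?a) \<star> I ?b) =
      (I ?a \<bullet> eta A) \<star> (sym T ?b ?a \<bullet> (eta B \<star> I ?a)) \<star> (I ?b \<bullet> I ?b)"
    by (rule interchange3) simp_all
  then have 1: "?t \<bullet> (eta A \<star> (eta B \<star> I ?a) \<star> I ?b) = (eta A \<star> I ?a) \<star> (eta B \<star> I ?b)"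
    unfolding s by simp
  have "?t \<bullet> (I ?a \<star> (I ?b \<star> eta A) \<star> eta B) =
      (I ?a \<bullet> I ?a) \<star> (sym T ?b ?a \<bullet> (I ?b \<star> eta A)) \<star> (I ?b \<bullet> eta B)"
    by (rule interchange3) simp_all
  then have 2: "?t \<bullet> (I ?a \<star> (I ?b \<star> eta A) \<star> eta B) = (I ?a \<star> eta A) \<star> (I ?b \<star> eta B)"
    unfolding s by simp
  have "((mu A \<star> mu B) \<bullet> ?t) \<bullet> ((eta A \<star> eta B) \<star> I (?a + ?b)) =
      (mu A \<star> mu B) \<bullet> ?t \<bullet> (eta A \<star> (eta B \<star> I ?a) \<star> I ?b)"
    by (simp add: add.assoc)
  also have "\<dots> = I (?a + ?b)" unfolding 1 by (subst interchange) simp_all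
  finally have l: "((mu A \<star> mu B) \<bullet> ?t) \<bullet> ((eta A \<star> eta B) \<star> I (?a + ?b)) = I (?a + ?b)" .
  have "((mu A \<star> mu B) \<bullet> ?t) \<bullet> (I (?a + ?b) \<star> (eta A \<star> eta B)) =
      (mu A \<star> mu B) \<bullet> ?t \<bullet> (I ?a \<star> (I ?b \<star> eta A) \<star> eta B)"
    by (simp add: add.assoc)
  also have "\<dots> = I (?a + ?b)" unfolding 2 by (subst interchange) simp_all
  finally have r: "((mu A \<star> mu B) \<bullet> ?t) \<bullet> (I (?a + ?b) \<star> (eta A \<star> eta B)) = I (?a + ?b)" .
  show ?thesis unfolding is_magma_def tens_mon_sel using l r by (simp add: add.assoc del: Cmp_Cmp)
qed

lemma is_monoid_hom_I [simp]: "is_magma A \<Longrightarrow> is_monoid_hom T A (I (obj A)) A"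
  by (simp add: is_monoid_hom_def)

lemma is_monoid_hom_comp:
  assumes AB: "is_magma A" "is_magma B" "is_magma C" and h: "is_monoid_hom T A f B" "is_monoid_hom T B g C"
  shows "is_monoid_hom T A (g \<bullet> f) C"
proof -
  note [simp] = AB is_monoid_homD(1-3)[OF h(1)] is_monoid_homD(1-3)[OF h(2)]
  have "g \<bullet> f \<bullet> mu A = (g \<bullet> mu B) \<bullet> (f \<star> f)" by (simp add: is_monoid_homD(4)[OF h(1)])
  also have "\<dots> = mu C \<bullet> ((g \<bullet> f) \<star> (g \<bullet> f))"
    unfolding is_monoid_homD(4)[OF h(2)] by (simp add: interchange)
  finally show ?thesis
    using is_monoid_homD(5)[OF h(1)] is_monoid_homD(5)[OF h(2)] by (simp add: is_monoid_hom_def)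
qed

text \<open>The multiplications are preserved factor by factor, and naturality carries
  \<open>h\<close> and \<open>h'\<close> past the symmetry in the middle.\<close>

lemma is_monoid_hom_tens:
  assumes mag: "is_magma A" "is_magma B" "is_magma A'" "is_magma B'"
    and h: "is_monoid_hom T A h B" and h': "is_monoid_hom T A' h' B'"
  shows "is_monoid_hom T (tens_mon A A') (h \<star> h') (tens_mon B B')"
proof -
  note [simp] = mag is_monoid_homD(1-3)[OF h] is_monoid_homD(1-3)[OF h']
  let ?s = "sym T (obj A') (obj A)" and ?s' = "sym T (obj B') (obj B)"
  let ?t = "I (obj A) \<star> ?s \<star> I (obj A')" and ?t' = "I (obj B) \<star> ?s' \<star> I (obj B')"
  have "(h \<star> (h \<star> h') \<star> h') \<bullet> ?t = (h \<bullet> I (obj A)) \<star> ((h \<star> h') \<bullet> ?s) \<star> (h' \<bullet> I (obj A'))"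
    by (rule interchange3) simp_all
  also have "(h \<star> h') \<bullet> ?s = ?s' \<bullet> (h' \<star> h)"
    using sym_natural[of h' h "obj B'" "obj B"] by simp
  also have "(h \<bullet> I (obj A)) \<star> (?s' \<bullet> (h' \<star> h)) \<star> (h' \<bullet> I (obj A')) =
      (I (obj B) \<bullet> h) \<star> (?s' \<bullet> (h' \<star> h)) \<star> (I (obj B') \<bullet> h')" by simp
  also have "\<dots> = ?t' \<bullet> (h \<star> (h' \<star> h) \<star> h')"
    by (rule interchange3[symmetric]) simp_all
  finally have t: "(h \<star> (h \<star> h') \<star> h') \<bullet> ?t = ?t' \<bullet> (h \<star> (h' \<star> h) \<star> h')" .
  have "(h \<star> h') \<bullet> (mu A \<star> mu A') = (mu B \<bullet> (h \<star> h)) \<star> (mu B' \<bullet> (h' \<star> h'))"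
    by (simp add: interchange is_monoid_homD(4)[OF h] is_monoid_homD(4)[OF h'])
  also have "\<dots> = (mu B \<star> mu B') \<bullet> ((h \<star> h) \<star> (h' \<star> h'))"
    by (subst interchange) simp_all
  finally have m: "(h \<star> h') \<bullet> (mu A \<star> mu A') = (mu B \<star> mu B') \<bullet> (h \<star> (h \<star> h') \<star> h')" by simp
  have "(h \<star> h') \<bullet> (mu A \<star> mu A') \<bullet> ?t = ((h \<star> h') \<bullet> (mu A \<star> mu A')) \<bullet> ?t"
    by (rule Cmp_Cmp[symmetric]) (simp_all add: add.assoc)
  also have "\<dots> = (mu B \<star> mu B') \<bullet> (h \<star> (h \<star> h') \<star> h') \<bullet> ?t"
    unfolding m by (rule Cmp_Cmp) (simp_all add: add.assoc)
  also have "\<dots> = ((mu B \<star> mu B') \<bullet> ?t') \<bullet> (h \<star> (h' \<star> h) \<star> h')"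
    unfolding t by (rule Cmp_Cmp[symmetric]) (simp_all add: add.assoc)
  finally show ?thesis
    by (simp add: is_monoid_hom_def interchange is_monoid_homD(5)[OF h] is_monoid_homD(5)[OF h'] add.assoc)
qed

lemma tens_mon_assoc:
  assumes mag: "is_magma A" "is_magma B" "is_magma C"
  shows "tens_mon (tens_mon A B) C = tens_mon A (tens_mon B C)"
proof -
  note [simp] = mag
  let ?a = "obj A" and ?b = "obj B" and ?c = "obj C"
  let ?m = "mu A \<star> mu B \<star> mu C"
  \<comment> \<open>Both multiplications first permute A B C A B C to A A B B C C. \<open>?y\<close>
    exchanges the middle pair C A, and \<open>?x\<close> then exchanges the pairs B A and C B;
    either bracketing factors in this way.\<close>
  let ?x = "I ?a \<star> sym T ?b ?a \<star> sym T ?c ?b \<star> I ?c" and ?y = "I (?a + ?b) \<star> sym T ?c ?a \<star> I (?b + ?c)"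
  have "mu (tens_mon (tens_mon A B) C) = ?m \<bullet> ?x \<bullet> ?y"
  proof -
    have 1: "(((mu A \<star> mu B) \<bullet> (I ?a \<star> sym T ?b ?a \<star> I ?b)) \<star> mu C) =
        ?m \<bullet> (I ?a \<star> sym T ?b ?a \<star> I (?b + (?c + ?c)))"
      using interchange[of "I ?a \<star> sym T ?b ?a \<star> I ?b" "mu A \<star> mu B" "I (?c + ?c)" "mu C"] by (simp add: add.assoc)
    have 2: "I (?a + ?b) \<star> sym T ?c (?a + ?b) \<star> I ?c =
        (I (?a + ?b + ?a) \<star> sym T ?c ?b \<star> I ?c) \<bullet> ?y"
      using interchange3[of "I (?a + ?b)" "I (?a + ?b)" "sym T ?c ?a \<star> I ?b" "I ?a \<star> sym T ?c ?b" "I ?c" "I ?c"]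
      by (simp add: sym_add_right add.assoc)
    have 3: "(I ?a \<star> sym T ?b ?a \<star> I (?b + (?c + ?c))) \<bullet> (I (?a + ?b + ?a) \<star> sym T ?c ?b \<star> I ?c) = ?x"
      using interchange3[of "I ?a" "I ?a" "I (?b + ?a)" "sym T ?b ?a" "sym T ?c ?b \<star> I ?c" "I (?b + ?c + ?c)"]
      by (simp add: add.assoc)
    have "mu (tens_mon (tens_mon A B) C) =
      (?m \<bullet> (I ?a \<star> sym T ?b ?a \<star> I (?b + (?c + ?c)))) \<bullet> (I (?a + ?b + ?a) \<star> sym T ?c ?b \<star> I ?c) \<bullet> ?y"
      using 1 2 by simp
    also have "\<dots> = ?m \<bullet> ((I ?a \<star> sym T ?b ?a \<star> I (?b + (?c + ?c))) \<bullet> (I (?a + ?b + ?a) \<star> sym T ?c ?b \<star> I ?c)) \<bullet> ?y"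
      by (simp add: add.assoc)
    finally show ?thesis unfolding 3 .
  qed
  moreover have "mu (tens_mon A (tens_mon B C)) = ?m \<bullet> ?x \<bullet> ?y"
  proof -
    have 1: "(mu A \<star> ((mu B \<star> mu C) \<bullet> (I ?b \<star> sym T ?c ?b \<star> I ?c))) =
        ?m \<bullet> (I (?a + (?a + ?b)) \<star> sym T ?c ?b \<star> I ?c)"
      using interchange[of "I (?a + ?a)" "mu A" "I ?b \<star> sym T ?c ?b \<star> I ?c" "mu B \<star> mu C"] by (simp add: add.assoc)
    have 2: "I ?a \<star> sym T (?b + ?c) ?a \<star> I (?b + ?c) =
        (I ?a \<star> sym T ?b ?a \<star> I (?c + (?b + ?c))) \<bullet> ?y"
      using interchange3[of "I ?a" "I ?a" "I ?b \<star> sym T ?c ?a" "sym T ?b ?a \<star> I ?c" "I (?b + ?c)" "I (?b + ?c)"]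
      by (simp add: sym_add_left add.assoc)
    have 3: "(I (?a + (?a + ?b)) \<star> sym T ?c ?b \<star> I ?c) \<bullet> (I ?a \<star> sym T ?b ?a \<star> I (?c + (?b + ?c))) = ?x"
      using interchange3[of "I ?a" "I ?a" "sym T ?b ?a" "I (?a + ?b)" "I (?c + ?b + ?c)" "sym T ?c ?b \<star> I ?c"]
      by (simp add: add.assoc)
    have "mu (tens_mon A (tens_mon B C)) =
      (?m \<bullet> (I (?a + (?a + ?b)) \<star> sym T ?c ?b \<star> I ?c)) \<bullet> (I ?a \<star> sym T ?b ?a \<star> I (?c + (?b + ?c))) \<bullet> ?y"
      using 1 2 by simp
    also have "\<dots> = ?m \<bullet> ((I (?a + (?a + ?b)) \<star> sym T ?c ?b \<star> I ?c) \<bullet> (I ?a \<star> sym T ?b ?a \<star> I (?c + (?b + ?c)))) \<bullet> ?y"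
      by (simp add: add.assoc)
    finally show ?thesis unfolding 3 .
  qed
  ultimately show ?thesis by (intro mon.equality) (simp_all add: add.assoc del: tens_mon_sel(2))
qed

text \<open>The exchange of A A with B B factors as the middle exchange \<open>?v\<close>, the
  exchange inside each half, and the middle exchange \<open>?w\<close>. The exchange
  \<open>?u\<close> in the multiplication of \<open>tens_mon A B\<close> cancels \<open>?v\<close>,
  and \<open>?w\<close> belongs to the multiplication of \<open>tens_mon B A\<close>.\<close>

lemma is_monoid_hom_sym:
  assumes mag: "is_magma A" "is_magma B"
  shows "is_monoid_hom T (tens_mon A B) (sym T (obj A) (obj B)) (tens_mon B A)"
proof -
  note [simp] = mag
  let ?a = "obj A" and ?b = "obj B"
  let ?u = "I ?a \<star> sym T ?b ?a \<star> I ?b" and ?v = "I ?a \<star> sym T ?a ?b \<star> I ?b"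
  let ?w = "I ?b \<star> sym T ?a ?b \<star> I ?a"
  have 1: "sym T (?a + ?a) (?b + ?b) = ?w \<bullet> (sym T ?a ?b \<star> sym T ?a ?b) \<bullet> ?v"
  proof -
    have "sym T ?a (?b + ?b) \<star> I ?a = ?w \<bullet> (sym T ?a ?b \<star> I (?b + ?a))"
      "I ?a \<star> sym T ?a (?b + ?b) = (I (?a + ?b) \<star> sym T ?a ?b) \<bullet> ?v"
      by (simp_all add: sym_add_right whisker_Cmp add.assoc)
    then have "sym T (?a + ?a) (?b + ?b) =
        ?w \<bullet> ((sym T ?a ?b \<star> I (?b + ?a)) \<bullet> (I (?a + ?b) \<star> sym T ?a ?b)) \<bullet> ?v"
      by (simp add: sym_add_left add.assoc)
    then show ?thesis by (simp add: slide)
  qed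
  have "?v \<bullet> ?u = (I ?a \<bullet> I ?a) \<star> (sym T ?a ?b \<bullet> sym T ?b ?a) \<star> (I ?b \<bullet> I ?b)"
    by (rule interchange3) simp_all
  then have 2: "?v \<bullet> ?u = I (?a + ?b + ?a + ?b)" by (simp add: sym_sym add.assoc)
  have "sym T ?a ?b \<bullet> (mu A \<star> mu B) \<bullet> ?u = (sym T ?a ?b \<bullet> (mu A \<star> mu B)) \<bullet> ?u"
    by (simp add: add.assoc)
  also have "sym T ?a ?b \<bullet> (mu A \<star> mu B) = (mu B \<star> mu A) \<bullet> sym T (?a + ?a) (?b + ?b)"
    using sym_natural[of "mu A" "mu B" ?a ?b] by simp
  also have "((mu B \<star> mu A) \<bullet> sym T (?a + ?a) (?b + ?b)) \<bullet> ?u =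
      ((mu B \<star> mu A) \<bullet> ?w) \<bullet> (sym T ?a ?b \<star> sym T ?a ?b) \<bullet> (?v \<bullet> ?u)"
    unfolding 1 by (simp add: add.assoc)
  also have "\<dots> = ((mu B \<star> mu A) \<bullet> ?w) \<bullet> (sym T ?a ?b \<star> sym T ?a ?b)"
    unfolding 2 by (simp add: add.assoc)
  finally have "sym T ?a ?b \<bullet> (mu A \<star> mu B) \<bullet> ?u = ((mu B \<star> mu A) \<bullet> ?w) \<bullet> (sym T ?a ?b \<star> sym T ?a ?b)" .
  moreover have "sym T ?a ?b \<bullet> (eta A \<star> eta B) = eta B \<star> eta A"
    using sym_natural[of "eta A" "eta B" ?a ?b] by simp
  ultimately show ?thesis by (simp add: is_monoid_hom_def add.assoc)
qed

lemma tens_unit [simp]: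
  assumes "is_magma A" shows "tens_mon A unit_mon = A" "tens_mon unit_mon A = A"
  using assms by (auto intro!: mon.equality)

lemma medial_unit [simp]: "medial unit_mon"
  by (simp add: medial_def is_monoid_hom_def)

text \<open>The multiplication of the tensor product is a symmetry between middle factors followed
  by \<open>mu A \<star> mu B\<close>. The former is always a homomorphism, the latter is one by
  mediality of both factors.\<close>

lemma medial_tens:
  assumes mag: "is_magma A" "is_magma B" and med: "medial A" "medial B"
  shows "medial (tens_mon A B)"
proof -
  note [simp] = mag
  let ?s = "I (obj A) \<star> sym T (obj B) (obj A) \<star> I (obj B)"
  have "is_monoid_hom T (tens_mon A (tens_mon (tens_mon B A) B)) ?s (tens_mon A (tens_mon (tens_mon A B) B))"
    by (intro is_monoid_hom_tens is_monoid_hom_sym is_monoid_hom_I is_magma_tens mag)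
  then have 1: "is_monoid_hom T (tens_mon (tens_mon A B) (tens_mon A B)) ?s (tens_mon (tens_mon A A) (tens_mon B B))"
    by (simp add: tens_mon_assoc)
  have 2: "is_monoid_hom T (tens_mon (tens_mon A A) (tens_mon B B)) (mu A \<star> mu B) (tens_mon A B)"
    using med unfolding medial_def by (intro is_monoid_hom_tens is_magma_tens mag)
  show ?thesis unfolding medial_def tens_mon_sel(2)
    by (intro is_monoid_hom_comp[OF _ _ _ 1 2] is_magma_tens mag)
qed

lemma is_comm_monoid_PROP_iff:
  "is_comm_monoid T A \<longleftrightarrow> is_magma A \<and>
    mu A \<bullet> (mu A \<star> I (obj A)) = mu A \<bullet> (I (obj A) \<star> mu A) \<and> mu A \<bullet> sym T (obj A) (obj A) = mu A"
proof (cases "mu A \<in> Hom T (obj A + obj A) (obj A)")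
  case True
  then have "mu A \<bullet> (I (obj A) \<star> mu A) \<bullet> asc T (obj A) (obj A) (obj A) = mu A \<bullet> (I (obj A) \<star> mu A)"
    by (simp add: add.assoc)
  then show ?thesis
    unfolding is_comm_monoid_def is_magma_def lun_Id run_Id prop_cat_Ob prop_cat_tensO prop_cat_unitO
    by (simp only: UNIV_I simp_thms conj_ac)
next
  case False
  then show ?thesis
    unfolding is_comm_monoid_def is_magma_def prop_cat_tensO by blast
qed

lemma comm_monoid_magma: "is_comm_monoid T A \<Longrightarrow> is_magma A"
  by (simp only: is_comm_monoid_PROP_iff)

text \<open>The empty case of the coproduct: the unit monoid has a homomorphism to every unital
  magma. The product of two units is a unit by the left unit law.\<close>

lemma is_monoid_hom_eta:
  assumes "is_magma A" shows "is_monoid_hom T unit_mon (eta A) A"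
proof -
  have "mu A \<bullet> (eta A \<star> eta A) = mu A \<bullet> (eta A \<star> I (obj A)) \<bullet> (I 0 \<star> eta A)"
    using assms by (subst slide) simp_all
  also have "\<dots> = (mu A \<bullet> (eta A \<star> I (obj A))) \<bullet> eta A"
    using assms by (simp del: is_magmaD(7))
  finally show ?thesis using assms by (simp add: is_monoid_hom_def del: Cmp_Cmp)
qed

lemma comm_monoid_medial:
  assumes A: "is_comm_monoid T A" shows "medial A"
proof -
  let ?a = "obj A" and ?m = "mu A"
  note [simp] = comm_monoid_magma[OF A]
  have as: "?m \<bullet> (?m \<star> I ?a) = ?m \<bullet> (I ?a \<star> ?m)" and cm: "?m \<bullet> sym T ?a ?a = ?m"
    using A by (simp_all only: is_comm_monoid_PROP_iff)
  \<comment> \<open>In elements: \<open>(a b) (c d) = a ((b c) d)\<close>.\<close>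
  have 1: "?m \<bullet> (?m \<star> ?m) = ?m \<bullet> (I ?a \<star> (?m \<bullet> (?m \<star> I ?a)))"
  proof -
    have "?m \<bullet> (?m \<star> ?m) = (?m \<bullet> (?m \<star> I ?a)) \<bullet> (I (?a + ?a) \<star> ?m)"
      by (simp add: slide)
    also have "\<dots> = ?m \<bullet> (I ?a \<star> ?m) \<bullet> (I ?a \<star> (I ?a \<star> ?m))"
      unfolding as by (simp add: add.assoc)
    also have "\<dots> = ?m \<bullet> (I ?a \<star> (?m \<bullet> (I ?a \<star> ?m)))"
      by (subst interchange) simp_all
    finally show ?thesis by (simp only: as)
  qed
  \<comment> \<open>In elements: exchanging b and c does not change \<open>(b c) d\<close>. This is
    applied inside the expression just obtained.\<close>
  have 2: "(?m \<bullet> (?m \<star> I ?a)) \<bullet> (sym T ?a ?a \<star> I ?a) = ?m \<bullet> (?m \<star> I ?a)"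
    by (simp add: interchange cm)
  have "(?m \<bullet> (?m \<star> ?m)) \<bullet> (I ?a \<star> sym T ?a ?a \<star> I ?a) =
      ?m \<bullet> (I ?a \<star> (?m \<bullet> (?m \<star> I ?a))) \<bullet> (I ?a \<star> (sym T ?a ?a \<star> I ?a))"
    unfolding 1 by (simp add: add.assoc)
  also have "\<dots> = ?m \<bullet> (I ?a \<star> ((?m \<bullet> (?m \<star> I ?a)) \<bullet> (sym T ?a ?a \<star> I ?a)))"
    by (subst interchange) (simp_all add: add.assoc)
  also have "\<dots> = ?m \<bullet> (?m \<star> ?m)" unfolding 1 2 ..
  finally have "(?m \<bullet> (?m \<star> ?m)) \<bullet> (I ?a \<star> sym T ?a ?a \<star> I ?a) = ?m \<bullet> (?m \<star> ?m)" .
  moreover have "?m \<bullet> (eta A \<star> eta A) = eta A"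
    using is_monoid_homD(4)[OF is_monoid_hom_eta[of A]] by simp
  ultimately show ?thesis by (simp add: medial_def is_monoid_hom_def add.assoc)
qed

lemma medialD:
  assumes "is_magma A" "medial A"
  shows "is_monoid_hom T (tens_mon A A) (mu A) A" "mu A \<bullet> (eta A \<star> eta A) = eta A"
  using assms by (auto simp: medial_def is_monoid_hom_def)

text \<open>The tensor product is a coproduct of commutative monoids.\<close>

lemma is_monoid_hom_inl:
  "\<lbrakk>is_magma A; is_magma B\<rbrakk> \<Longrightarrow> is_monoid_hom T A (I (obj A) \<star> eta B) (tens_mon A B)"
  and is_monoid_hom_inr:
  "\<lbrakk>is_magma A; is_magma B\<rbrakk> \<Longrightarrow> is_monoid_hom T B (eta A \<star> I (obj B)) (tens_mon A B)"
  using is_monoid_hom_tens[of A A unit_mon B "I (obj A)" "eta B"]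
    is_monoid_hom_tens[of unit_mon A B B "eta A" "I (obj B)"] by (simp_all add: is_monoid_hom_eta)

text \<open>In elements \<open>(a, b) = (a, 1) (1, b)\<close>: the product of the two inclusions is
  the identity of the tensor product. Hence a homomorphism is the product in \<open>C\<close> of its
  two restrictions.\<close>

lemma is_monoid_hom_split:
  assumes mag: "is_magma A" "is_magma B" and h: "is_monoid_hom T (tens_mon A B) h C" and C: "is_magma C"
  shows "h = mu C \<bullet> ((h \<bullet> (I (obj A) \<star> eta B)) \<star> (h \<bullet> (eta A \<star> I (obj B))))"
proof -
  let ?a = "obj A" and ?b = "obj B"
  let ?t = "I ?a \<star> sym T ?b ?a \<star> I ?b"
  note [simp] = mag C is_monoid_homD(1-3)[OF h]
  have "?t \<bullet> (I ?a \<star> (eta B \<star> eta A) \<star> I ?b) = (I ?a \<bullet> I ?a) \<star> (sym T ?b ?a \<bullet> (eta B \<star> eta A)) \<star> (I ?b \<bullet> I ?b)"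
    by (rule interchange3) simp_all
  then have 1: "?t \<bullet> (I ?a \<star> (eta B \<star> eta A) \<star> I ?b) = (I ?a \<star> eta A) \<star> (eta B \<star> I ?b)"
    using sym_natural[of "eta B" "eta A" ?b ?a] by simp
  have 2: "(mu A \<star> mu B) \<bullet> ((I ?a \<star> eta A) \<star> (eta B \<star> I ?b)) = I (?a + ?b)"
    by (subst interchange) simp_all
  have "h = h \<bullet> (mu A \<star> mu B) \<bullet> ?t \<bullet> (I ?a \<star> (eta B \<star> eta A) \<star> I ?b)" unfolding 1 2 by simp
  also have "\<dots> = (h \<bullet> mu (tens_mon A B)) \<bullet> ((I ?a \<star> eta B) \<star> (eta A \<star> I ?b))"
    by (simp add: add.assoc)
  also have "\<dots> = (mu C \<bullet> (h \<star> h)) \<bullet> ((I ?a \<star> eta B) \<star> (eta A \<star> I ?b))"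
    using is_monoid_homD(4)[OF h] by simp
  also have "\<dots> = mu C \<bullet> (h \<star> h) \<bullet> ((I ?a \<star> eta B) \<star> (eta A \<star> I ?b))" by (simp add: add.assoc)
  also have "\<dots> = mu C \<bullet> ((h \<bullet> (I ?a \<star> eta B)) \<star> (h \<bullet> (eta A \<star> I ?b)))"
    by (subst interchange) simp_all
  finally show ?thesis .
qed

text \<open>Mediality of \<open>C\<close> says that \<open>mu C\<close> is a homomorphism from the
  tensor square, so its composite with \<open>h \<star> k\<close> is one as well. The restrictions
  are computed by the unit laws.\<close>

lemma is_monoid_hom_cotuple:
  assumes mag: "is_magma A" "is_magma B" "is_magma C" and C: "medial C"
    and h: "is_monoid_hom T A h C" and k: "is_monoid_hom T B k C"
  shows "is_monoid_hom T (tens_mon A B) (mu C \<bullet> (h \<star> k)) C"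
    "(mu C \<bullet> (h \<star> k)) \<bullet> (I (obj A) \<star> eta B) = h"
    "(mu C \<bullet> (h \<star> k)) \<bullet> (eta A \<star> I (obj B)) = k"
proof -
  note [simp] = mag is_monoid_homD(1-3)[OF h] is_monoid_homD(1-3)[OF k] is_monoid_homD(5)[OF h] is_monoid_homD(5)[OF k]
  show "is_monoid_hom T (tens_mon A B) (mu C \<bullet> (h \<star> k)) C"
    by (rule is_monoid_hom_comp[OF _ _ _ is_monoid_hom_tens[of A C B C] medialD(1)]) (simp_all add: h k C)
  have "(mu C \<bullet> (h \<star> k)) \<bullet> (I (obj A) \<star> eta B) = mu C \<bullet> (I (obj C) \<star> eta C) \<bullet> h"
    using interchange[of h "I (obj C)" "I 0" "eta C"] by (simp add: interchange)
  then show "(mu C \<bullet> (h \<star> k)) \<bullet> (I (obj A) \<star> eta B) = h"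
    using Cmp_Cmp[of h "I (obj C) \<star> eta C" "mu C"] by simp
  have "(mu C \<bullet> (h \<star> k)) \<bullet> (eta A \<star> I (obj B)) = mu C \<bullet> (eta C \<star> I (obj C)) \<bullet> k"
    using interchange[of "I 0" "eta C" k "I (obj C)"] by (simp add: interchange)
  then show "(mu C \<bullet> (h \<star> k)) \<bullet> (eta A \<star> I (obj B)) = k"
    using Cmp_Cmp[of k "eta C \<star> I (obj C)" "mu C"] by simp
qed

end

lemma FG_Arr_iff: "(n, m, f, x) \<in> Arr (FG G) \<longleftrightarrow> f \<in> {1..n} \<rightarrow>\<^sub>E {1..m} \<and> x \<in> {1..n} \<rightarrow>\<^sub>E carrier G"
  by (simp add: FG_def)

lemma FG_ArrD:
  assumes "(n, m, f, x) \<in> Arr (FG G)" "1 \<le> i" "i \<le> n"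
  shows "1 \<le> f i" "f i \<le> m" "x i \<in> carrier G"
proof -
  have "i \<in> {1..n}" using assms by simp
  then have "f i \<in> {1..m}" "x i \<in> carrier G" using assms(1) unfolding FG_Arr_iff by (blast dest: PiE_mem)+
  then show "1 \<le> f i" "f i \<le> m" "x i \<in> carrier G" by auto
qed

section \<open>Powers of a commutative monoid as coproducts\<close>

context prop_cat
begin

primrec pow_mon :: "(nat, 'm) mon \<Rightarrow> nat \<Rightarrow> (nat, 'm) mon"
  where "pow_mon A 0 = unit_mon"
  | "pow_mon A (Suc n) = tens_mon (pow_mon A n) A"

text \<open>The identity in position i, units elsewhere. The index is meaningful for
  \<open>1 \<le> i\<close> and \<open>i \<le> n\<close>; the value at n = 0 is a filler.\<close>

primrec incl :: "(nat, 'm) mon \<Rightarrow> nat \<Rightarrow> nat \<Rightarrow> 'm"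
  where "incl A 0 i = I 0"
  | "incl A (Suc n) i = (if i \<le> n then incl A n i \<star> eta A else eta (pow_mon A n) \<star> I (obj A))"

lemma is_magma_pow [simp]: "is_magma A \<Longrightarrow> is_magma (pow_mon A n)"
  by (induction n) auto

lemma medial_pow: "\<lbrakk>is_magma A; medial A\<rbrakk> \<Longrightarrow> medial (pow_mon A n)"
  by (induction n) (auto intro: medial_tens)

lemma pow_mon_add: "is_magma A \<Longrightarrow> pow_mon A (n + k) = tens_mon (pow_mon A n) (pow_mon A k)"
  by (induction k) (simp_all add: tens_mon_assoc del: tens_mon_sel)

lemma obj_pow_mon: "obj A = 1 \<Longrightarrow> obj (pow_mon A n) = n"
  by (induction n) auto

lemma is_monoid_hom_incl:
  assumes A: "is_magma A" and i: "1 \<le> i" "i \<le> n"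
  shows "is_monoid_hom T A (incl A n i) (pow_mon A n)"
  using i
proof (induction n)
  case (Suc n)
  show ?case
  proof (cases "i \<le> n")
    case True
    then have "is_monoid_hom T (tens_mon A unit_mon) (incl A n i \<star> eta A) (tens_mon (pow_mon A n) A)"
      using Suc A by (intro is_monoid_hom_tens) (auto intro: is_monoid_hom_eta)
    then show ?thesis using True A by simp
  next
    case False
    then show ?thesis using is_monoid_hom_inr[of "pow_mon A n" A] A by simp
  qed
qed simp

lemma incl_Arr [simp]:
  assumes A: "is_magma A" and i: "1 \<le> i" "i \<le> n"
  shows "incl A n i \<in> Arr T" "Dom T (incl A n i) = obj A" "Cod T (incl A n i) = obj (pow_mon A n)"
  using is_monoid_homD(1-3)[OF is_monoid_hom_incl[OF assms]] .

lemma incl_add_left: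
  assumes A: "is_magma A" and i: "1 \<le> i" "i \<le> n"
  shows "incl A (n + k) i = incl A n i \<star> eta (pow_mon A k)"
  using assms by (induction k) (auto simp: le_SucI trans_le_add1)

lemma incl_add_right:
  assumes A: "is_magma A" and i: "1 \<le> i" "i \<le> k"
  shows "incl A (n + k) (n + i) = eta (pow_mon A n) \<star> incl A k i"
  using i
proof (induction k)
  case (Suc k)
  then show ?case using A pow_mon_add[OF A, of n k] by auto
qed simp

text \<open>Uniqueness for the n-fold coproduct: by \<open>is_monoid_hom_split\<close> a
  homomorphism is recovered from its restriction to all factors but the last, covered by induction,
  and its restriction to the last.\<close>

lemma pow_hom_eqI:
  assumes A: "is_magma A" and B: "is_magma B"
    and h: "is_monoid_hom T (pow_mon A n) h B" "is_monoid_hom T (pow_mon A n) h' B"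
    and eq: "\<And>i. \<lbrakk>1 \<le> i; i \<le> n\<rbrakk> \<Longrightarrow> h \<bullet> incl A n i = h' \<bullet> incl A n i"
  shows "h = h'"
  using h eq
proof (induction n arbitrary: h h')
  case 0
  \<comment> \<open>Preservation of the unit leaves \<open>eta B\<close> as the only homomorphism
    from the empty power.\<close>
  have "k = eta B" if "is_monoid_hom T unit_mon k B" for k
    using is_monoid_homD(1,2,5)[OF that] by simp
  from this[of h] this[of h'] show ?case using 0 by simp
next
  case (Suc n)
  let ?l = "I (obj (pow_mon A n)) \<star> eta A" and ?r = "eta (pow_mon A n) \<star> I (obj A)"
  note [simp] = A B
  have l: "is_monoid_hom T (pow_mon A n) ?l (pow_mon A (Suc n))"
    using is_monoid_hom_inl[of "pow_mon A n" A] by simp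
  have hl: "is_monoid_hom T (pow_mon A n) (h \<bullet> ?l) B" "is_monoid_hom T (pow_mon A n) (h' \<bullet> ?l) B"
    using Suc.prems(1,2) l by (auto intro!: is_monoid_hom_comp[of _ "pow_mon A (Suc n)"])
  note [simp] = is_monoid_homD(1-3)[OF Suc.prems(1)] is_monoid_homD(1-3)[OF Suc.prems(2)]
  have *: "?l \<bullet> incl A n i = incl A (Suc n) i" if "1 \<le> i" "i \<le> n" for i
    using that interchange[of "incl A n i" "I (obj (pow_mon A n))" "I 0" "eta A"] by simp
  have "h \<bullet> ?l = h' \<bullet> ?l"
  proof (rule Suc.IH[OF hl])
    fix i assume i: "1 \<le> i" "i \<le> n"
    have "(h \<bullet> ?l) \<bullet> incl A n i = h \<bullet> ?l \<bullet> incl A n i" "(h' \<bullet> ?l) \<bullet> incl A n i = h' \<bullet> ?l \<bullet> incl A n i"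
      using i by simp_all
    then show "(h \<bullet> ?l) \<bullet> incl A n i = (h' \<bullet> ?l) \<bullet> incl A n i"
      unfolding *[OF i] using Suc.prems(3)[of i] i by simp
  qed
  moreover have "h \<bullet> ?r = h' \<bullet> ?r" using Suc.prems(3)[of "Suc n"] by simp
  moreover have "h = mu B \<bullet> ((h \<bullet> ?l) \<star> (h \<bullet> ?r))" "h' = mu B \<bullet> ((h' \<bullet> ?l) \<star> (h' \<bullet> ?r))"
    using Suc.prems(1,2) by (auto intro!: is_monoid_hom_split)
  ultimately show ?case by metis
qed

text \<open>Existence for the n-fold coproduct: the family is assembled by cotupling with one more
  member at a time.\<close>

lemma pow_hom_exists:
  assumes A: "is_magma A" and B: "is_magma B" "medial B"
    and k: "\<And>i. \<lbrakk>1 \<le> i; i \<le> n\<rbrakk> \<Longrightarrow> is_monoid_hom T A (k i) B"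
  shows "\<exists>h. is_monoid_hom T (pow_mon A n) h B \<and> (\<forall>i. 1 \<le> i \<and> i \<le> n \<longrightarrow> h \<bullet> incl A n i = k i)"
  using k
proof (induction n)
  case 0
  then show ?case using is_monoid_hom_eta[OF B(1)] by auto
next
  case (Suc n)
  let ?P = "pow_mon A n"
  note [simp] = A B
  obtain h where h: "is_monoid_hom T ?P h B" "\<And>i. \<lbrakk>1 \<le> i; i \<le> n\<rbrakk> \<Longrightarrow> h \<bullet> incl A n i = k i"
    using Suc by force
  have k: "is_monoid_hom T A (k (Suc n)) B" using Suc.prems by simp
  note c = is_monoid_hom_cotuple[OF is_magma_pow[OF A] A B h(1) k]
  note [simp] = is_monoid_homD(1-3)[OF h(1)] is_monoid_homD(1-3)[OF k]
  have "(mu B \<bullet> (h \<star> k (Suc n))) \<bullet> incl A (Suc n) i = k i" if i: "1 \<le> i" "i \<le> Suc n" for i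
  proof (cases "i \<le> n")
    case True
    have "incl A (Suc n) i = (I (obj ?P) \<star> eta A) \<bullet> incl A n i"
      using True i interchange[of "incl A n i" "I (obj ?P)" "I 0" "eta A"] by simp
    then have "(mu B \<bullet> (h \<star> k (Suc n))) \<bullet> incl A (Suc n) i =
        ((mu B \<bullet> (h \<star> k (Suc n))) \<bullet> (I (obj ?P) \<star> eta A)) \<bullet> incl A n i"
      using True i by (simp del: incl.simps)
    then show ?thesis unfolding c(2) using h(2)[of i] True i by simp
  next
    case False
    then have "i = Suc n" using i by simp
    then show ?thesis using c(3) by simp
  qed
  then show ?case using c(1) unfolding pow_mon.simps by blast
qed

end

section \<open>The functor defined by a commutative G-monoid on the object 1\<close>

locale prop_G_monoid = prop_cat T + G: group G
  for T :: "(nat, 'm, 'x) smc_scheme" and G :: "('g, 'b) monoid_scheme" +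
  fixes A :: "(nat, 'm) mon" and \<rho> :: "'g \<Rightarrow> 'm"
  assumes A: "is_comm_monoid T A" and obj_A: "obj A = 1"
    and \<rho>_hom: "g \<in> carrier G \<Longrightarrow> is_monoid_hom T A (\<rho> g) A"
    and \<rho>_one: "\<rho> \<one>\<^bsub>G\<^esub> = Id T (obj A)"
    and \<rho>_mult: "\<lbrakk>g \<in> carrier G; h \<in> carrier G\<rbrakk> \<Longrightarrow> \<rho> (g \<otimes>\<^bsub>G\<^esub> h) = \<rho> g \<cdot>\<^bsub>T\<^esub> \<rho> h"
begin

lemma magma_A [simp]: "is_magma A"
  using A by (rule comm_monoid_magma)

lemma obj_pow [simp]: "obj (pow_mon A n) = n"
  using obj_A by (rule obj_pow_mon)

lemma \<rho>_Arr [simp]: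
  assumes "g \<in> carrier G" shows "\<rho> g \<in> Arr T" "Dom T (\<rho> g) = obj A" "Cod T (\<rho> g) = obj A"
  using is_monoid_homD(1-3)[OF \<rho>_hom[OF assms]] .

text \<open>At most one arrow represents \<open>p\<close>, so each law for \<open>lift\<close>
  reduces to showing that an explicit arrow represents the composite, tensor product or symmetry in
  question.\<close>

definition represents :: "'g FG_arr \<Rightarrow> 'm \<Rightarrow> bool"
  where "represents p h = (case p of (n, m, f, x) \<Rightarrow>
    is_monoid_hom T (pow_mon A n) h (pow_mon A m) \<and>
    (\<forall>i. 1 \<le> i \<and> i \<le> n \<longrightarrow> h \<bullet> incl A n i = incl A m (f i) \<bullet> \<rho> (x i)))"

definition lift :: "'g FG_arr \<Rightarrow> 'm"
  where "lift p = (THE h. represents p h)"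

lemma representsD:
  assumes "represents p h"
  shows "h \<in> Arr T" "Dom T h = fst p" "Cod T h = fst (snd p)"
  using assms is_monoid_homD(1-3)[of _ h] by (auto simp: represents_def split: prod.splits)

lemma lift_eqI: "represents p h \<Longrightarrow> lift p = h"
proof -
  assume h: "represents p h"
  obtain n m f x where p: "p = (n, m, f, x)" by (cases p)
  have "h' = h" if "represents p h'" for h'
  proof (rule pow_hom_eqI[of A "pow_mon A m" n])
    show "is_monoid_hom T (pow_mon A n) h' (pow_mon A m)" "is_monoid_hom T (pow_mon A n) h (pow_mon A m)"
      using h that unfolding represents_def p split by blast+
    show "h' \<bullet> incl A n i = h \<bullet> incl A n i" if "1 \<le> i" "i \<le> n" for i
      using h \<open>represents p h'\<close> that unfolding represents_def p split by metis
  qed simp_all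
  then show ?thesis unfolding lift_def using h by blast
qed

lemma represents_lift:
  assumes "p \<in> Arr (FG G)" shows "represents p (lift p)"
proof -
  obtain n m f x where p: "p = (n, m, f, x)" by (cases p)
  then have "(n, m, f, x) \<in> Arr (FG G)" using assms by (simp only:)
  note fx = FG_ArrD[OF this]
  have "\<exists>h. is_monoid_hom T (pow_mon A n) h (pow_mon A m) \<and>
      (\<forall>i. 1 \<le> i \<and> i \<le> n \<longrightarrow> h \<bullet> incl A n i = incl A m (f i) \<bullet> \<rho> (x i))"
  proof (rule pow_hom_exists)
    \<comment> \<open>The coproduct property asks for a medial target; this is where commutativity
      of \<open>A\<close> enters.\<close>
    show "medial (pow_mon A m)" by (intro medial_pow magma_A comm_monoid_medial A)
    show "is_monoid_hom T A (incl A m (f i) \<bullet> \<rho> (x i)) (pow_mon A m)" if "1 \<le> i" "i \<le> n" for i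
      by (rule is_monoid_hom_comp[OF _ _ _ \<rho>_hom is_monoid_hom_incl]) (use fx[OF that] in simp_all)
  qed simp_all
  then obtain h where h: "represents p h" unfolding represents_def p split by blast
  from h show ?thesis unfolding lift_eqI[OF h] .
qed

lemma lift_Arr [simp]:
  assumes "p \<in> Arr (FG G)"
  shows "lift p \<in> Arr T" "Dom T (lift p) = fst p" "Cod T (lift p) = fst (snd p)"
  using representsD[OF represents_lift[OF assms]] .

lemma represents_Cmp:
  assumes p: "p \<in> Arr (FG G)" and q: "q \<in> Arr (FG G)" and pq: "Dom (FG G) q = Cod (FG G) p"
    and h: "represents p h" and k: "represents q k"
  shows "represents (q \<cdot>\<^bsub>FG G\<^esub> p) (k \<bullet> h)"
proof -
  obtain n m f x l f' x' where pq[simp]: "p = (n, m, f, x)" "q = (m, l, f', x')"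
    using pq by (cases p; cases q) (auto simp: FG_def)
  have "(n, m, f, x) \<in> Arr (FG G)" using p by (simp only: pq)
  note fx = FG_ArrD[OF this]
  have "(m, l, f', x') \<in> Arr (FG G)" using q by (simp only: pq)
  note fx' = FG_ArrD[OF this]
  note [simp] = representsD[OF h] representsD[OF k]
  have hom: "is_monoid_hom T (pow_mon A n) h (pow_mon A m)" "is_monoid_hom T (pow_mon A m) k (pow_mon A l)"
    and hi: "1 \<le> i \<Longrightarrow> i \<le> n \<Longrightarrow> h \<bullet> incl A n i = incl A m (f i) \<bullet> \<rho> (x i)"
    and ki: "1 \<le> i \<Longrightarrow> i \<le> m \<Longrightarrow> k \<bullet> incl A m i = incl A l (f' i) \<bullet> \<rho> (x' i)"
 for i
    using h k unfolding represents_def pq split by blast+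
  have "k \<bullet> h \<bullet> incl A n i = incl A l (f' (f i)) \<bullet> \<rho> (x' (f i) \<otimes>\<^bsub>G\<^esub> x i)" if i: "1 \<le> i" "i \<le> n" for i
  proof -
    \<comment> \<open>On the i-th summand the label \<open>x i\<close> acts first and the label at
      \<open>f i\<close> second, which is the order of their product in the composition of the
      PROP.\<close>
    have "k \<bullet> h \<bullet> incl A n i = (k \<bullet> incl A m (f i)) \<bullet> \<rho> (x i)" using hi fx i by simp
    also have "\<dots> = incl A l (f' (f i)) \<bullet> \<rho> (x' (f i) \<otimes>\<^bsub>G\<^esub> x i)"
      using ki fx[OF i] fx' by (simp add: \<rho>_mult)
    finally show ?thesis .
  qed
  then show ?thesis using is_monoid_hom_comp[OF _ _ _ hom] by (simp add: represents_def FG_Cmp)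
qed

lemma represents_Id: "represents (FG_id G n) (I n)"
  using is_monoid_hom_I[of "pow_mon A n"] by (simp add: represents_def FG_id_def \<rho>_one)

lemma represents_tensA:
  assumes p: "p \<in> Arr (FG G)" and q: "q \<in> Arr (FG G)"
    and h: "represents p h" and k: "represents q k"
  shows "represents (p \<odot>\<^bsub>FG G\<^esub> q) (h \<star> k)"
proof -
  obtain n m f x n' m' f' x' where pq[simp]: "p = (n, m, f, x)" "q = (n', m', f', x')"
    by (cases p; cases q)
  have "(n, m, f, x) \<in> Arr (FG G)" using p by (simp only: pq)
  note fx = FG_ArrD[OF this]
  have "(n', m', f', x') \<in> Arr (FG G)" using q by (simp only: pq)
  note fx' = FG_ArrD[OF this]
  note [simp] = representsD[OF h] representsD[OF k]
  have hom: "is_monoid_hom T (pow_mon A n) h (pow_mon A m)" "is_monoid_hom T (pow_mon A n') k (pow_mon A m')"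
    and hi: "1 \<le> i \<Longrightarrow> i \<le> n \<Longrightarrow> h \<bullet> incl A n i = incl A m (f i) \<bullet> \<rho> (x i)"
    and ki: "1 \<le> i \<Longrightarrow> i \<le> n' \<Longrightarrow> k \<bullet> incl A n' i = incl A m' (f' i) \<bullet> \<rho> (x' i)"
 for i
    using h k unfolding represents_def pq split by blast+
  have e: "h \<bullet> eta (pow_mon A n) = eta (pow_mon A m)" "k \<bullet> eta (pow_mon A n') = eta (pow_mon A m')"
    using is_monoid_homD(5)[OF hom(1)] is_monoid_homD(5)[OF hom(2)] .
  \<comment> \<open>An index of the first block: the second factor carries only a unit, and
    \<open>k\<close> preserves it. The second block is treated in the same way with the roles
    exchanged.\<close>
  have l: "(h \<star> k) \<bullet> incl A (n + n') i = incl A (m + m') (f i) \<bullet> \<rho> (x i)" if i: "1 \<le> i" "i \<le> n" for i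
  proof -
    have "(h \<star> k) \<bullet> incl A (n + n') i = (h \<bullet> incl A n i) \<star> (k \<bullet> eta (pow_mon A n'))"
      using i by (simp add: incl_add_left interchange)
    also have "\<dots> = (incl A m (f i) \<bullet> \<rho> (x i)) \<star> (eta (pow_mon A m') \<bullet> I 0)"
      using i hi e by simp
    also have "\<dots> = (incl A m (f i) \<star> eta (pow_mon A m')) \<bullet> (\<rho> (x i) \<star> I 0)"
      using fx[OF i] by (subst interchange) simp_all
    finally show ?thesis using fx[OF i] by (simp add: incl_add_left)
  qed
  have r: "(h \<star> k) \<bullet> incl A (n + n') (n + i) = incl A (m + m') (m + f' i) \<bullet> \<rho> (x' i)"
    if i: "1 \<le> i" "i \<le> n'" for i
  proof -
    have "(h \<star> k) \<bullet> incl A (n + n') (n + i) = (h \<bullet> eta (pow_mon A n)) \<star> (k \<bullet> incl A n' i)"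
      using i by (simp add: incl_add_right interchange)
    also have "\<dots> = (eta (pow_mon A m) \<bullet> I 0) \<star> (incl A m' (f' i) \<bullet> \<rho> (x' i))"
      using i ki e by simp
    also have "\<dots> = (eta (pow_mon A m) \<star> incl A m' (f' i)) \<bullet> (I 0 \<star> \<rho> (x' i))"
      using fx'[OF i] by (subst interchange) simp_all
    finally show ?thesis using fx'[OF i] by (simp add: incl_add_right)
  qed
  have "(h \<star> k) \<bullet> incl A (n + n') i = incl A (m + m') (if i \<le> n then f i else m + f' (i - n)) \<bullet>
      \<rho> (if i \<le> n then x i else x' (i - n))" if i: "1 \<le> i" "i \<le> n + n'" for i
    using l[of i] r[of "i - n"] i by (cases "i \<le> n") auto
  moreover have "is_monoid_hom T (pow_mon A (n + n')) (h \<star> k) (pow_mon A (m + m'))"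
    using is_monoid_hom_tens[OF _ _ _ _ hom] by (simp add: pow_mon_add)
  ultimately show ?thesis by (simp add: represents_def FG_tensA)
qed

text \<open>By naturality a symmetry carries an inclusion next to a unit to the same inclusion on
  the other side of a unit. The symmetry left over involves the object 0 and is an identity.\<close>

lemma represents_sym: "represents (sym (FG G) n m) (sym T n m)"
proof -
  have "is_monoid_hom T (pow_mon A (n + m)) (sym T n m) (pow_mon A (m + n))"
    using is_monoid_hom_sym[of "pow_mon A n" "pow_mon A m"] by (simp add: pow_mon_add)
  moreover have "sym T n m \<bullet> incl A (n + m) i = incl A (m + n) (m + i)" if i: "1 \<le> i" "i \<le> n" for i
    using i sym_natural[of "incl A n i" "eta (pow_mon A m)" n m]
    by (simp add: incl_add_left incl_add_right)
  moreover have "sym T n m \<bullet> incl A (n + m) i = incl A (m + n) (i - n)" if i: "\<not> i \<le> n" "i \<le> n + m" for i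
  proof -
    have j: "1 \<le> i - n" "i - n \<le> m" "i = n + (i - n)" using i by auto
    have "sym T n m \<bullet> incl A (n + m) (n + (i - n)) = incl A (m + n) (i - n)"
      using j(1,2) sym_natural[of "eta (pow_mon A n)" "incl A m (i - n)" n m]
      unfolding incl_add_left[OF magma_A j(1,2)] incl_add_right[OF magma_A j(1,2)] by simp
    then show ?thesis using j(3) by simp
  qed
  ultimately show ?thesis by (auto simp: represents_def FG_sym \<rho>_one)
qed

text \<open>Together with the values at the multiplication and the unit, this recovers
  \<open>A\<close> and its action from the lifted functor.\<close>

lemma represents_action:
  assumes "g \<in> carrier G" shows "represents (1, 1, \<lambda>i\<in>{1..1}. 1, \<lambda>i\<in>{1..1}. g) (\<rho> g)"
  using assms \<rho>_hom[OF assms] obj_A by (auto simp: represents_def)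

lemma represents_mu: "represents (2, 1, \<lambda>i\<in>{1..2}. 1, \<lambda>i\<in>{1..2}. \<one>\<^bsub>G\<^esub>) (mu A)"
proof -
  have "i = 1 \<or> i = 2" if "1 \<le> i" "i \<le> 2" for i :: nat using that by auto
  then show ?thesis using medialD(1)[OF magma_A comm_monoid_medial[OF A]] is_magmaD(7,8)[OF magma_A]
    by (auto simp: represents_def numeral_2_eq_2 \<rho>_one)
qed

lemma represents_eta: "represents (0, 1, \<lambda>i\<in>{1..0}. 1, \<lambda>i\<in>{1..0}. \<one>\<^bsub>G\<^esub>) (eta A)"
  using is_monoid_hom_eta[OF magma_A] by (simp add: represents_def)

text \<open>It can be the identity on objects because \<open>A\<close> sits on 1, so that its n-th
  power sits on n.\<close>

definition lift_functor :: "(nat, 'g FG_arr, nat, 'm) cfunctor"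
  where "lift_functor = \<lparr>FO = (\<lambda>n. n), FA = restrict lift (Arr (FG G))\<rparr>"

lemma lift_functor_sel: "FO lift_functor n = n" "FA lift_functor = restrict lift (Arr (FG G))"
  by (auto simp: lift_functor_def)

lemma symmetric_strict_monoidal_functor_lift:
  "symmetric_strict_monoidal_functor (FG G) T lift_functor"
proof -
  interpret FG: prop_cat "FG G" by (rule prop_cat_FG) (rule G.is_group)
  have id: "lift (FG_id G n) = I n" for n by (rule lift_eqI[OF represents_Id])
  have fst: "fst p = Dom (FG G) p" "fst (snd p) = Cod (FG G) p" for p :: "'g FG_arr"
    by (cases p, simp add: FG_def)+
  have FGid: "FG_id G n \<in> Arr (FG G)" for n using FG.Id_Arr(1)[of n] by (simp add: FG_sel)
  show ?thesis
  proof (unfold_locales, unfold lift_functor_sel, goal_cases)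
    case 1 show ?case by (simp add: FG_sel)
  next case 2 show ?case by simp
  next case (3 a) show ?case by simp
  next case (4 f a b) then show ?case by (simp add: fst)
  next case (5 a) then show ?case using FGid by (simp add: FG_sel id)
  next case (6 f a b g c)
    then have "lift (g \<cdot>\<^bsub>FG G\<^esub> f) = lift g \<bullet> lift f"
      by (intro lift_eqI represents_Cmp represents_lift) auto
    then show ?case using 6 by simp
  next case (7 a b) show ?case by simp
  next case 8 show ?case by simp
  next case (9 f g)
    then have "lift (f \<odot>\<^bsub>FG G\<^esub> g) = lift f \<star> lift g"
      by (intro lift_eqI represents_tensA represents_lift) auto
    then show ?case using 9 by simp
  next case (10 a b c) show ?case using FGid[of "a + b + c"] id[of "a + b + c"]
      by (simp add: FG_sel add.assoc)
  next case (11 a) show ?case using FGid by (simp add: FG_sel id)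
  next case (12 a) show ?case using FGid by (simp add: FG_sel id)
  next case (13 a b)
    have "sym (FG G) a b \<in> Arr (FG G)" by (rule FG.sym_Arr) auto
    then show ?case using lift_eqI[OF represents_sym] by simp
  qed
qed

end

section \<open>The endomorphism PROP of an object\<close>

context symmetric_monoidal_category
begin

text \<open>Tensoring with the unit object is faithful: by naturality the left unitor relates it to
  the identity functor, and unitors can be cancelled.\<close>

lemma unit_tensA_cancel:
  assumes "Id S (unitO S) \<odot> f = Id S (unitO S) \<odot> g" "f \<in> Arr S" "g \<in> Arr S" "Dom S f = Dom S g" "Cod S f = Cod S g"
  shows "f = g"
proof -
  have "f \<cdot> lun S (Dom S f) = g \<cdot> lun S (Dom S f)"
    using lun_natural[of f "Cod S f"] lun_natural[of g "Cod S g"] assms by simp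
  then show ?thesis by (rule iso_cancel_right) (use assms in auto)
qed

lemma tensA_unit_cancel:
  assumes "f \<odot> Id S (unitO S) = g \<odot> Id S (unitO S)" "f \<in> Arr S" "g \<in> Arr S" "Dom S f = Dom S g" "Cod S f = Cod S g"
  shows "f = g"
proof -
  have "f \<cdot> run S (Dom S f) = g \<cdot> run S (Dom S f)"
    using run_natural[of f "Cod S f"] run_natural[of g "Cod S g"] assms by simp
  then show ?thesis by (rule iso_cancel_right) (use assms in auto)
qed

text \<open>Uses an equation between two composites in front of a tail \<open>h\<close>.\<close>

lemma Cmp_eq_Cmp:
  assumes "g \<cdot> f = g' \<cdot> f'" "f \<in> Arr S" "g \<in> Arr S" "f' \<in> Arr S" "g' \<in> Arr S" "Dom S g = Cod S f" "Dom S g' = Cod S f'"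
    "h \<in> Arr S" "Cod S h = Dom S f" "Dom S f = Dom S f'"
  shows "g \<cdot> f \<cdot> h = g' \<cdot> f' \<cdot> h"
proof -
  have "(g \<cdot> f) \<cdot> h = (g' \<cdot> f') \<cdot> h" by (simp only: assms(1))
  then show ?thesis using assms(2-) by simp
qed

text \<open>Kelly's argument: after tensoring with the unit object on the left, which is faithful,
  the claim follows from the pentagon, the triangle and naturality of the associator.\<close>

lemma lun_tensO:
  assumes [simp]: "a \<in> Ob S" "b \<in> Ob S"
  shows "lun S (a \<boxtimes> b) \<cdot> asc S (unitO S) a b = lun S a \<odot> Id S b"
proof (rule unit_tensA_cancel)
  let ?e = "unitO S" and ?i = "Id S (unitO S)"
  \<comment> \<open>The two associators that complete the left side to one side of the pentagon.
    They are invertible and are cancelled at the end.\<close>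
  let ?z = "asc S ?e (?e \<boxtimes> a) b \<cdot> (asc S ?e ?e a \<odot> Id S b)"
  have "(?i \<odot> (lun S (a \<boxtimes> b) \<cdot> asc S ?e a b)) \<cdot> ?z =
      (?i \<odot> lun S (a \<boxtimes> b)) \<cdot> (?i \<odot> asc S ?e a b) \<cdot> ?z"
    by (subst interchange_Cmp) simp_all
  also have "\<dots> = ((?i \<odot> lun S (a \<boxtimes> b)) \<cdot> asc S ?e ?e (a \<boxtimes> b)) \<cdot> asc S (?e \<boxtimes> ?e) a b"
    using pentagon[of ?e ?e a b] by simp
  also have "\<dots> = (run S ?e \<odot> Id S (a \<boxtimes> b)) \<cdot> asc S (?e \<boxtimes> ?e) a b"
    by (subst triangle) simp_all
  also have "\<dots> = asc S ?e a b \<cdot> ((run S ?e \<odot> Id S a) \<odot> Id S b)"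
    using asc_natural[of "run S ?e" "Id S a" "Id S b" ?e a b] by simp
  also have "\<dots> = asc S ?e a b \<cdot> ((?i \<odot> lun S a) \<odot> Id S b) \<cdot> (asc S ?e ?e a \<odot> Id S b)"
    by (simp add: interchange triangle)
  also have "\<dots> = (asc S ?e a b \<cdot> ((?i \<odot> lun S a) \<odot> Id S b)) \<cdot> (asc S ?e ?e a \<odot> Id S b)"
    by simp
  also have "\<dots> = (?i \<odot> (lun S a \<odot> Id S b)) \<cdot> ?z"
    by (subst asc_natural) simp_all
  finally show "?i \<odot> (lun S (a \<boxtimes> b) \<cdot> asc S ?e a b) = ?i \<odot> (lun S a \<odot> Id S b)"
    by (rule iso_cancel_right) simp_all
qed simp_all

text \<open>The mirror image: the unit is tensored on the right, and the pentagon has its two units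
  in the last places.\<close>

lemma run_tensO:
  assumes [simp]: "a \<in> Ob S" "b \<in> Ob S"
  shows "run S (a \<boxtimes> b) = (Id S a \<odot> run S b) \<cdot> asc S a b (unitO S)"
proof (rule tensA_unit_cancel)
  let ?e = "unitO S" and ?i = "Id S (unitO S)"
  have "asc S a b ?e \<cdot> (run S (a \<boxtimes> b) \<odot> ?i) =
      asc S a b ?e \<cdot> ((Id S a \<odot> Id S b) \<odot> lun S ?e) \<cdot> asc S (a \<boxtimes> b) ?e ?e"
    by (simp add: triangle)
  also have "\<dots> = (asc S a b ?e \<cdot> ((Id S a \<odot> Id S b) \<odot> lun S ?e)) \<cdot> asc S (a \<boxtimes> b) ?e ?e" by simp
  also have "\<dots> = (Id S a \<odot> (Id S b \<odot> lun S ?e)) \<cdot> asc S a b (?e \<boxtimes> ?e) \<cdot> asc S (a \<boxtimes> b) ?e ?e"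
    by (subst asc_natural) simp_all
  also have "\<dots> = (Id S a \<odot> (Id S b \<odot> lun S ?e)) \<cdot> (Id S a \<odot> asc S b ?e ?e) \<cdot> asc S a (b \<boxtimes> ?e) ?e \<cdot> (asc S a b ?e \<odot> ?i)"
    by (subst pentagon) simp_all
  also have "\<dots> = (Id S a \<odot> (run S b \<odot> ?i)) \<cdot> asc S a (b \<boxtimes> ?e) ?e \<cdot> (asc S a b ?e \<odot> ?i)"
    by (simp add: interchange_Cmp triangle)
  also have "\<dots> = ((Id S a \<odot> (run S b \<odot> ?i)) \<cdot> asc S a (b \<boxtimes> ?e) ?e) \<cdot> (asc S a b ?e \<odot> ?i)" by simp
  also have "(Id S a \<odot> (run S b \<odot> ?i)) \<cdot> asc S a (b \<boxtimes> ?e) ?e = asc S a b ?e \<cdot> ((Id S a \<odot> run S b) \<odot> ?i)"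
    using asc_natural[of "Id S a" "run S b" ?i a b ?e] by simp
  also have "(asc S a b ?e \<cdot> ((Id S a \<odot> run S b) \<odot> ?i)) \<cdot> (asc S a b ?e \<odot> ?i) =
      asc S a b ?e \<cdot> (((Id S a \<odot> run S b) \<cdot> asc S a b ?e) \<odot> ?i)"
    by (simp add: interchange)
  finally show "run S (a \<boxtimes> b) \<odot> ?i = ((Id S a \<odot> run S b) \<cdot> asc S a b ?e) \<odot> ?i"
    by (rule iso_cancel_left) simp_all
qed simp_all

text \<open>Naturality of the left unitor at itself identifies the left unitor of
  \<open>I \<boxtimes> I\<close> with the unitor of I tensored by I on the left. Then
  \<open>lun_tensO\<close> and the triangle compare the two unitors after tensoring with I.\<close>

lemma lun_unitO: "lun S (unitO S) = run S (unitO S)"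
proof (rule tensA_unit_cancel)
  let ?e = "unitO S" and ?i = "Id S (unitO S)"
  have "lun S ?e \<cdot> (?i \<odot> lun S ?e) = lun S ?e \<cdot> lun S (?e \<boxtimes> ?e)"
    using lun_natural[of "lun S ?e" ?e] by simp
  then have "?i \<odot> lun S ?e = lun S (?e \<boxtimes> ?e)" by (rule iso_cancel_left) simp_all
  then show "lun S ?e \<odot> ?i = run S ?e \<odot> ?i"
    using lun_tensO[of ?e ?e] triangle[of ?e ?e] by simp
qed simp_all

end

section \<open>Tensor powers of an object and their rebracketing\<close>

locale tensor_powers = symmetric_monoidal_category S
  for S :: "('o, 'm, 'x) smc_scheme" (structure) +
  fixes X :: 'o
  assumes X [simp]: "X \<in> Ob S"
begin

primrec pw :: "nat \<Rightarrow> 'o"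
  where "pw 0 = unitO S" | "pw (Suc n) = X \<boxtimes> pw n"

text \<open>The canonical rebracketing from \<open>pw n \<boxtimes> pw m\<close> to
  \<open>pw (n + m)\<close>. It recurs on the first exponent because powers are nested to the
  right.\<close>

primrec J :: "nat \<Rightarrow> nat \<Rightarrow> 'm"
  where "J 0 m = lun S (pw m)" | "J (Suc n) m = (Id S X \<odot> J n m) \<cdot> asc S X (pw n) (pw m)"

lemma pw_Ob [simp]: "pw n \<in> Ob S"
  by (induction n) auto

lemma J_Arr [simp]:
  "J n m \<in> Arr S" "Dom S (J n m) = pw n \<boxtimes> pw m" "Cod S (J n m) = pw (n + m)" "iso_arr S (J n m)"
  by (induction n) auto

text \<open>The recursion runs over the other argument and starts with a left unitor, so the right
  unitor appears only through \<open>lun_unitO\<close> and \<open>run_tensO\<close>.\<close>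

lemma J_0: "J n 0 = run S (pw n)"
  by (induction n) (simp_all add: lun_unitO run_tensO)

text \<open>The coherence statement on which strict associativity of the endomorphism PROP rests:
  \<open>lun_tensO\<close> starts the induction and the pentagon continues it.\<close>

lemma J_assoc:
  "J n (m + k) \<cdot> (Id S (pw n) \<odot> J m k) \<cdot> asc S (pw n) (pw m) (pw k) = J (n + m) k \<cdot> (J n m \<odot> Id S (pw k))"
proof (induction n)
  case 0
  have "lun S (pw (m + k)) \<cdot> (Id S (unitO S) \<odot> J m k) \<cdot> asc S (unitO S) (pw m) (pw k) =
      (lun S (pw (m + k)) \<cdot> (Id S (unitO S) \<odot> J m k)) \<cdot> asc S (unitO S) (pw m) (pw k)" by simp
  also have "\<dots> = J m k \<cdot> lun S (pw m \<boxtimes> pw k) \<cdot> asc S (unitO S) (pw m) (pw k)"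
    by (subst lun_natural) simp_all
  finally show ?case by (simp add: lun_tensO)
next
  case (Suc n)
  let ?x = "Id S X" and ?n = "pw n" and ?m = "pw m" and ?k = "pw k"
  have "J (Suc n) (m + k) \<cdot> (Id S (pw (Suc n)) \<odot> J m k) \<cdot> asc S (pw (Suc n)) ?m ?k =
      (?x \<odot> J n (m + k)) \<cdot> (asc S X ?n (pw (m + k)) \<cdot> ((?x \<odot> Id S ?n) \<odot> J m k)) \<cdot> asc S (X \<boxtimes> ?n) ?m ?k"
    by simp
  also have "\<dots> = (?x \<odot> J n (m + k)) \<cdot> (?x \<odot> (Id S ?n \<odot> J m k)) \<cdot> asc S X ?n (?m \<boxtimes> ?k) \<cdot> asc S (X \<boxtimes> ?n) ?m ?k"
    by (subst asc_natural) simp_all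
  also have "\<dots> = (?x \<odot> J n (m + k)) \<cdot> (?x \<odot> (Id S ?n \<odot> J m k)) \<cdot> (?x \<odot> asc S ?n ?m ?k) \<cdot>
      asc S X (?n \<boxtimes> ?m) ?k \<cdot> (asc S X ?n ?m \<odot> Id S ?k)"
    by (subst pentagon) simp_all
  also have "\<dots> = (?x \<odot> (J n (m + k) \<cdot> (Id S ?n \<odot> J m k) \<cdot> asc S ?n ?m ?k)) \<cdot>
      asc S X (?n \<boxtimes> ?m) ?k \<cdot> (asc S X ?n ?m \<odot> Id S ?k)"
    by (simp add: interchange_Cmp)
  also have "\<dots> = (?x \<odot> J (n + m) k) \<cdot> ((?x \<odot> (J n m \<odot> Id S ?k)) \<cdot> asc S X (?n \<boxtimes> ?m) ?k) \<cdot> (asc S X ?n ?m \<odot> Id S ?k)"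
    unfolding Suc by (simp add: interchange_Cmp)
  also have "(?x \<odot> (J n m \<odot> Id S ?k)) \<cdot> asc S X (?n \<boxtimes> ?m) ?k =
      asc S X (pw (n + m)) ?k \<cdot> ((?x \<odot> J n m) \<odot> Id S ?k)"
    using asc_natural[of ?x "J n m" "Id S ?k" X "pw (n + m)" ?k] by simp
  finally show ?case by (simp add: interchange)
qed

text \<open>The exponents are arguments because an arrow of \<open>S\<close> does not determine
  them: different powers of \<open>X\<close> may be the same object.\<close>

definition tn :: "nat \<Rightarrow> nat \<Rightarrow> nat \<Rightarrow> nat \<Rightarrow> 'm \<Rightarrow> 'm \<Rightarrow> 'm"
  where "tn n m n' m' f g = J m m' \<cdot> (f \<odot> g) \<cdot> inv_arr S (J n n')"

definition sm :: "nat \<Rightarrow> nat \<Rightarrow> 'm"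
  where "sm n m = J m n \<cdot> sym S (pw n) (pw m) \<cdot> inv_arr S (J n m)"

lemma sm_Arr [simp]: "sm n m \<in> Arr S" "Dom S (sm n m) = pw (n + m)" "Cod S (sm n m) = pw (m + n)"
  by (auto simp: sm_def)

lemma sm_J: "sm n m \<cdot> J n m = J m n \<cdot> sym S (pw n) (pw m)"
  by (simp add: sm_def)

abbreviation between :: "'m \<Rightarrow> nat \<Rightarrow> nat \<Rightarrow> bool"
  where "between f n m \<equiv> f \<in> Arr S \<and> Dom S f = pw n \<and> Cod S f = pw m"

lemma tn_Arr [simp]:
  assumes "between f n m" "between g n' m'"
  shows "tn n m n' m' f g \<in> Arr S" "Dom S (tn n m n' m' f g) = pw (n + n')" "Cod S (tn n m n' m' f g) = pw (m + m')"
  using assms by (auto simp: tn_def)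

lemma tn_J:
  assumes "between f n m" "between g n' m'"
  shows "tn n m n' m' f g \<cdot> J n n' = J m m' \<cdot> (f \<odot> g)"
  using assms by (simp add: tn_def)

lemma J_cancel:
  assumes "f \<cdot> J n m = g \<cdot> J n m" "between f (n + m) k" "between g (n + m) k"
  shows "f = g"
  using assms by (auto intro: iso_cancel_right)

text \<open>Arrows out of a power are compared after precomposition with rebracketings, which
  removes the inverses of \<open>J\<close> contained in \<open>tn\<close> and
  \<open>sm\<close>.\<close>

lemma JJ_cancel:
  assumes "f \<cdot> J (n + m) k \<cdot> (J n m \<odot> Id S (pw k)) = g \<cdot> J (n + m) k \<cdot> (J n m \<odot> Id S (pw k))"
    "between f (n + m + k) l" "between g (n + m + k) l"
  shows "f = g"
  using assms by (auto intro: iso_cancel_right)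

lemma tn_Id: "tn n n m m (Id S (pw n)) (Id S (pw m)) = Id S (pw (n + m))"
  by (simp add: tn_def)

lemma tn_Cmp:
  assumes "between f n m" "between g n' m'" "between h m k" "between i m' k'"
  shows "tn n k n' k' (h \<cdot> f) (i \<cdot> g) = tn m k m' k' h i \<cdot> tn n m n' m' f g"
  using assms by (simp add: tn_def interchange_Cmp)

lemma tn_JJ:
  assumes "between f n m" "between g n' m'" "between h n'' m''"
  shows "tn (n + n') (m + m') n'' m'' (tn n m n' m' f g) h \<cdot> J (n + n') n'' \<cdot> (J n n' \<odot> Id S (pw n'')) =
    J (m + m') m'' \<cdot> (J m m' \<odot> Id S (pw m'')) \<cdot> ((f \<odot> g) \<odot> h)"
    and "tn n m (n' + n'') (m' + m'') f (tn n' m' n'' m'' g h) \<cdot> J (n + n') n'' \<cdot> (J n n' \<odot> Id S (pw n'')) =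
    J m (m' + m'') \<cdot> (Id S (pw m) \<odot> J m' m'') \<cdot> (f \<odot> (g \<odot> h)) \<cdot> asc S (pw n) (pw n') (pw n'')"
proof -
  note [simp] = tn_Arr[OF assms(1,2)] tn_Arr[OF assms(2,3)]
  have "tn (n + n') (m + m') n'' m'' (tn n m n' m' f g) h \<cdot> J (n + n') n'' \<cdot> (J n n' \<odot> Id S (pw n'')) =
      (tn (n + n') (m + m') n'' m'' (tn n m n' m' f g) h \<cdot> J (n + n') n'') \<cdot> (J n n' \<odot> Id S (pw n''))"
    using assms by simp
  also have "\<dots> = J (m + m') m'' \<cdot> ((J m m' \<cdot> (f \<odot> g)) \<odot> h)"
    using assms by (subst tn_J) (simp_all add: interchange tn_J)
  also have "\<dots> = J (m + m') m'' \<cdot> (J m m' \<odot> Id S (pw m'')) \<cdot> ((f \<odot> g) \<odot> h)"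
    using assms by (simp add: interchange)
  finally show "tn (n + n') (m + m') n'' m'' (tn n m n' m' f g) h \<cdot> J (n + n') n'' \<cdot> (J n n' \<odot> Id S (pw n'')) =
    J (m + m') m'' \<cdot> (J m m' \<odot> Id S (pw m'')) \<cdot> ((f \<odot> g) \<odot> h)" .
  have "tn n m (n' + n'') (m' + m'') f (tn n' m' n'' m'' g h) \<cdot> J (n + n') n'' \<cdot> (J n n' \<odot> Id S (pw n'')) =
     (tn n m (n' + n'') (m' + m'') f (tn n' m' n'' m'' g h) \<cdot> J n (n' + n'')) \<cdot>
       (Id S (pw n) \<odot> J n' n'') \<cdot> asc S (pw n) (pw n') (pw n'')"
    using assms J_assoc[of n n' n''] by simp
  also have "\<dots> = J m (m' + m'') \<cdot> (f \<odot> (J m' m'' \<cdot> (g \<odot> h))) \<cdot> asc S (pw n) (pw n') (pw n'')"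
    using assms by (subst tn_J) (simp_all add: interchange_Cmp tn_J)
  also have "\<dots> = J m (m' + m'') \<cdot> (Id S (pw m) \<odot> J m' m'') \<cdot> (f \<odot> (g \<odot> h)) \<cdot> asc S (pw n) (pw n') (pw n'')"
    using assms by (simp add: interchange_Cmp)
  finally show "tn n m (n' + n'') (m' + m'') f (tn n' m' n'' m'' g h) \<cdot> J (n + n') n'' \<cdot> (J n n' \<odot> Id S (pw n'')) =
    J m (m' + m'') \<cdot> (Id S (pw m) \<odot> J m' m'') \<cdot> (f \<odot> (g \<odot> h)) \<cdot> asc S (pw n) (pw n') (pw n'')" .
qed

text \<open>After precomposition with the rebracketings, the two sides differ by
  \<open>J_assoc\<close> and by naturality of the associator of \<open>S\<close>.\<close>

lemma tn_assoc:
  assumes "between f n m" "between g n' m'" "between h n'' m''"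
  shows "tn (n + n') (m + m') n'' m'' (tn n m n' m' f g) h = tn n m (n' + n'') (m' + m'') f (tn n' m' n'' m'' g h)"
proof (rule JJ_cancel)
  have "J (m + m') m'' \<cdot> (J m m' \<odot> Id S (pw m'')) \<cdot> ((f \<odot> g) \<odot> h) =
      J m (m' + m'') \<cdot> (Id S (pw m) \<odot> J m' m'') \<cdot> asc S (pw m) (pw m') (pw m'') \<cdot> ((f \<odot> g) \<odot> h)"
    using Cmp_eq_Cmp[OF J_assoc[of m m' m''], of "(f \<odot> g) \<odot> h"] assms by simp
  also have "\<dots> = J m (m' + m'') \<cdot> (Id S (pw m) \<odot> J m' m'') \<cdot> (f \<odot> (g \<odot> h)) \<cdot> asc S (pw n) (pw n') (pw n'')"
    using assms by (simp add: asc_natural)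
  finally show "tn (n + n') (m + m') n'' m'' (tn n m n' m' f g) h \<cdot> J (n + n') n'' \<cdot> (J n n' \<odot> Id S (pw n'')) =
    tn n m (n' + n'') (m' + m'') f (tn n' m' n'' m'' g h) \<cdot> J (n + n') n'' \<cdot> (J n n' \<odot> Id S (pw n''))"
    unfolding tn_JJ[OF assms] .
qed (use assms in \<open>simp_all add: add.assoc\<close>)

lemma tn_unit:
  assumes "between f n m"
  shows "tn 0 0 n m (Id S (unitO S)) f = f" "tn n m 0 0 f (Id S (unitO S)) = f"
proof -
  have i: "between (Id S (unitO S)) 0 0" by simp
  show "tn 0 0 n m (Id S (unitO S)) f = f"
  proof (rule J_cancel[of _ 0 n _ m])
    show "tn 0 0 n m (Id S (unitO S)) f \<cdot> J 0 n = f \<cdot> J 0 n"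
      unfolding tn_J[OF i assms] using lun_natural[of f "pw m"] assms by simp
  qed (use assms tn_Arr[OF i assms] in simp_all)
  show "tn n m 0 0 f (Id S (unitO S)) = f"
  proof (rule J_cancel[of _ n 0 _ m])
    show "tn n m 0 0 f (Id S (unitO S)) \<cdot> J n 0 = f \<cdot> J n 0"
      unfolding tn_J[OF assms i] using run_natural[of f "pw m"] assms by (simp add: J_0)
  qed (use assms tn_Arr[OF assms i] in simp_all)
qed

lemma sm_natural:
  assumes "between f n m" "between g n' m'"
  shows "sm m m' \<cdot> tn n m n' m' f g = tn n' m' n m g f \<cdot> sm n n'"
proof (rule J_cancel)
  have "(sm m m' \<cdot> tn n m n' m' f g) \<cdot> J n n' = (sm m m' \<cdot> J m m') \<cdot> (f \<odot> g)"
    using assms by (simp add: tn_J)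
  also have "\<dots> = J m' m \<cdot> sym S (pw m) (pw m') \<cdot> (f \<odot> g)" using assms by (simp add: sm_J)
  also have "\<dots> = (tn n' m' n m g f \<cdot> J n' n) \<cdot> sym S (pw n) (pw n')"
    using assms by (subst tn_J) (simp_all add: sym_natural)
  also have "\<dots> = (tn n' m' n m g f \<cdot> sm n n') \<cdot> J n n'"
    using assms by (simp add: sm_J)
  finally show "(sm m m' \<cdot> tn n m n' m' f g) \<cdot> J n n' = (tn n' m' n m g f \<cdot> sm n n') \<cdot> J n n'" .
qed (use assms in simp_all)

lemma sm_sm: "sm m n \<cdot> sm n m = Id S (pw (n + m))"
proof (rule J_cancel)
  have "(sm m n \<cdot> sm n m) \<cdot> J n m = sm m n \<cdot> (sm n m \<cdot> J n m)" by simp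
  also have "\<dots> = (sm m n \<cdot> J m n) \<cdot> sym S (pw n) (pw m)"
    unfolding sm_J[of n m] by simp
  also have "\<dots> = J n m \<cdot> sym S (pw m) (pw n) \<cdot> sym S (pw n) (pw m)"
    unfolding sm_J by simp
  finally show "(sm m n \<cdot> sm n m) \<cdot> J n m = Id S (pw (n + m)) \<cdot> J n m"
    by (simp add: sym_sym)
qed simp_all

text \<open>The hexagon of the endomorphism PROP. Precomposition with rebracketings turns each
  \<open>sm\<close> into a symmetry of \<open>S\<close>; the hexagon of \<open>S\<close> then
  applies, with \<open>J_assoc\<close> used to change the bracketing before and after it.\<close>

lemma sm_add:
  "sm a (b + c) = tn b b (a + c) (c + a) (Id S (pw b)) (sm a c) \<cdot> tn (a + b) (b + a) c c (sm a b) (Id S (pw c))"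
proof (rule JJ_cancel)
  let ?a = "pw a" and ?b = "pw b" and ?c = "pw c"
  let ?T = "tn b b (a + c) (c + a) (Id S ?b) (sm a c)" and ?U = "tn (a + b) (b + a) c c (sm a b) (Id S ?c)"
  note [simp] = tn_Arr[of "Id S ?b" b b "sm a c" "a + c" "c + a", simplified]
    tn_Arr[of "sm a b" "a + b" "b + a" "Id S ?c" c c, simplified]
  \<comment> \<open>The sums occur as exponents and have to be brought to one form before domains
    and codomains are recognised as equal.\<close>
  have [simp]: "b + (a + c) = a + (b + c)" "b + (c + a) = a + (b + c)" "c + a = a + c" "b + a = a + b" "b + a + c = a + (b + c)"
      "a + b + c = a + (b + c)" "b + c + a = a + (b + c)"
    by simp_all
  have U: "?U \<cdot> J (a + b) c \<cdot> (J a b \<odot> Id S ?c) =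
      J (b + a) c \<cdot> (J b a \<odot> Id S ?c) \<cdot> (sym S ?a ?b \<odot> Id S ?c)"
  proof -
    have "?U \<cdot> J (a + b) c \<cdot> (J a b \<odot> Id S ?c) = (?U \<cdot> J (a + b) c) \<cdot> (J a b \<odot> Id S ?c)" by simp
    also have "\<dots> = J (b + a) c \<cdot> ((sm a b \<cdot> J a b) \<odot> Id S ?c)"
      by (subst tn_J) (simp_all add: interchange)
    finally show ?thesis unfolding sm_J by (simp add: interchange)
  qed
  have T: "?T \<cdot> J b (a + c) \<cdot> (Id S ?b \<odot> J a c) = J b (c + a) \<cdot> (Id S ?b \<odot> J c a) \<cdot> (Id S ?b \<odot> sym S ?a ?c)"
  proof -
    have "?T \<cdot> J b (a + c) \<cdot> (Id S ?b \<odot> J a c) = (?T \<cdot> J b (a + c)) \<cdot> (Id S ?b \<odot> J a c)" by simp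
    also have "\<dots> = J b (c + a) \<cdot> (Id S ?b \<odot> (sm a c \<cdot> J a c))"
      by (subst tn_J) (simp_all add: interchange)
    finally show ?thesis unfolding sm_J by (simp add: interchange)
  qed
  have "(?T \<cdot> ?U) \<cdot> J (a + b) c \<cdot> (J a b \<odot> Id S ?c) =
      ?T \<cdot> (J (b + a) c \<cdot> (J b a \<odot> Id S ?c)) \<cdot> (sym S ?a ?b \<odot> Id S ?c)"
    using U by simp
  also have "\<dots> = (?T \<cdot> J b (a + c) \<cdot> (Id S ?b \<odot> J a c)) \<cdot> asc S ?b ?a ?c \<cdot> (sym S ?a ?b \<odot> Id S ?c)"
    unfolding J_assoc[of b a c, symmetric] by simp
  also have "\<dots> = J b (c + a) \<cdot> (Id S ?b \<odot> J c a) \<cdot> (Id S ?b \<odot> sym S ?a ?c) \<cdot> asc S ?b ?a ?c \<cdot> (sym S ?a ?b \<odot> Id S ?c)"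
    unfolding T by simp
  also have "\<dots> = J b (c + a) \<cdot> (Id S ?b \<odot> J c a) \<cdot> asc S ?b ?c ?a \<cdot> sym S ?a (?b \<boxtimes> ?c) \<cdot> asc S ?a ?b ?c"
    by (subst hexagon) simp_all
  also have "\<dots> = (J b (c + a) \<cdot> (Id S ?b \<odot> J c a) \<cdot> asc S ?b ?c ?a) \<cdot> sym S ?a (?b \<boxtimes> ?c) \<cdot> asc S ?a ?b ?c"
    by simp
  also have "\<dots> = J (b + c) a \<cdot> ((J b c \<odot> Id S ?a) \<cdot> sym S ?a (?b \<boxtimes> ?c)) \<cdot> asc S ?a ?b ?c"
    unfolding J_assoc by simp
  also have "(J b c \<odot> Id S ?a) \<cdot> sym S ?a (?b \<boxtimes> ?c) = sym S ?a (pw (b + c)) \<cdot> (Id S ?a \<odot> J b c)"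
    using sym_natural[of "Id S ?a" "J b c" ?a "pw (b + c)"] by simp
  also have "J (b + c) a \<cdot> (sym S ?a (pw (b + c)) \<cdot> (Id S ?a \<odot> J b c)) \<cdot> asc S ?a ?b ?c =
      (J (b + c) a \<cdot> sym S ?a (pw (b + c))) \<cdot> (Id S ?a \<odot> J b c) \<cdot> asc S ?a ?b ?c" by simp
  also have "\<dots> = sm a (b + c) \<cdot> J a (b + c) \<cdot> (Id S ?a \<odot> J b c) \<cdot> asc S ?a ?b ?c"
    unfolding sm_J[symmetric] by simp
  also have "\<dots> = sm a (b + c) \<cdot> J (a + b) c \<cdot> (J a b \<odot> Id S ?c)"
    unfolding J_assoc ..
  finally show "sm a (b + c) \<cdot> J (a + b) c \<cdot> (J a b \<odot> Id S ?c) =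
      (?T \<cdot> ?U) \<cdot> J (a + b) c \<cdot> (J a b \<odot> Id S ?c)" ..
qed (simp_all add: add_ac)

end

section \<open>The PROP of arrows between tensor powers and its realization in S\<close>

context tensor_powers
begin

text \<open>The tags make source and target well defined on arrows. Since \<open>tn\<close> and
  \<open>sm\<close> have absorbed the constraints of \<open>S\<close>, the constraints here can be
  identities.\<close>

definition end_prop :: "(nat, nat \<times> 'm \<times> nat) smc"
  where "end_prop =
    \<lparr>Ob = UNIV, Arr = {(n, f, m). between f n m}, Dom = (\<lambda>(n, f, m). n), Cod = (\<lambda>(n, f, m). m),
     Id = (\<lambda>n. (n, Id S (pw n), n)), Cmp = (\<lambda>(k, g, l) (n, f, m). (n, g \<cdot> f, l)),
     tensO = (+), tensA = (\<lambda>(n, f, m) (n', g, m'). (n + n', tn n m n' m' f g, m + m')), unitO = 0,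
     asc = (\<lambda>a b c. (a + b + c, Id S (pw (a + b + c)), a + b + c)),
     lun = (\<lambda>n. (n, Id S (pw n), n)), run = (\<lambda>n. (n, Id S (pw n), n)),
     sym = (\<lambda>n m. (n + m, sm n m, m + n))\<rparr>"

lemma end_prop_sel [simp]:
  "Ob end_prop = UNIV" "(n, f, m) \<in> Arr end_prop \<longleftrightarrow> between f n m"
  "Dom end_prop (n, f, m) = n" "Cod end_prop (n, f, m) = m" "Id end_prop n = (n, Id S (pw n), n)"
  "Cmp end_prop (k, g, l) (n, f, m) = (n, g \<cdot> f, l)" "tensO end_prop n m = n + m"
  "tensA end_prop (n, f, m) (n', g, m') = (n + n', tn n m n' m' f g, m + m')" "unitO end_prop = 0"
  "asc end_prop a b c = (a + b + c, Id S (pw (a + b + c)), a + b + c)"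
  "lun end_prop n = (n, Id S (pw n), n)" "run end_prop n = (n, Id S (pw n), n)"
  "sym end_prop n m = (n + m, sm n m, m + n)"
  by (simp_all add: end_prop_def)

lemma end_prop_Hom: "p \<in> Hom end_prop n m \<longleftrightarrow> (\<exists>f. p = (n, f, m) \<and> between f n m)"
  by (cases p) auto

lemma prop_cat_end_prop: "prop_cat end_prop"
proof -
  have iso: "iso_arr end_prop (n, Id S (pw n), n)" for n
    unfolding iso_arr_def inverse_arrows_def by (intro exI[of _ "(n, Id S (pw n), n)"]) simp
  show ?thesis
  proof (unfold_locales, unfold end_prop_Hom, goal_cases)
    case (12 f a b f' c g a' b' g' c')
    then show ?case using tn_Cmp by auto
  next case (15 f a a' g b b' h c c')
    then obtain x y z where e: "f = (a, x, a')" "g = (b, y, b')" "h = (c, z, c')"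
      "between x a a'" "between y b b'" "between z c c'" by auto
    note [simp] = tn_Arr[OF e(4,5)] tn_Arr[OF e(5,6)]
    show ?case using tn_assoc[OF e(4-6)] tn_Arr[of "tn a a' b b' x y" "a + b" "a' + b'" z c c'] e(4-6)
      unfolding e(1-3) by (simp add: add.assoc)
  next case (18 f a b)
    then show ?case using tn_unit by auto
  next case (21 f a b)
    then show ?case using tn_unit by auto
  next case (23 f a a' g b b')
    then show ?case using sm_natural by auto
  next case (24 a b) then show ?case by (simp add: sm_sm)
  next case (25 a b c d)
    then show ?case by (simp add: tn_Id add.assoc)
  next case (27 a b c)
    have "between (sm a b) (a + b) (b + a)" by simp
    note [simp] = tn_Arr[OF this, of "Id S (pw c)" c c, simplified]
    show ?case using sm_add[of a b c] by (simp add: add.assoc)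
  qed (auto simp: iso tn_Id add.assoc)
qed

text \<open>The multiplication of \<open>M\<close> starts at \<open>pw k \<boxtimes> pw k\<close>,
  but in the PROP it must start at \<open>pw (k + k)\<close>; the inverse of \<open>J k k\<close>
  mediates.\<close>

definition end_mon :: "nat \<Rightarrow> ('o, 'm) mon \<Rightarrow> (nat, nat \<times> 'm \<times> nat) mon"
  where "end_mon k M = \<lparr>obj = k, mu = (k + k, mu M \<cdot> inv_arr S (J k k), k), eta = (0, eta M, k)\<rparr>"

lemma end_mon_sel [simp]: "obj (end_mon k M) = k" "mu (end_mon k M) = (k + k, mu M \<cdot> inv_arr S (J k k), k)"
  "eta (end_mon k M) = (0, eta M, k)"
  by (auto simp: end_mon_def)

lemma is_comm_monoid_end_mon:
  assumes M: "is_comm_monoid S M" and k: "obj M = pw k"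
  shows "is_comm_monoid end_prop (end_mon k M)"
proof -
  note [simp] = is_comm_monoidD[OF M, unfolded k]
  let ?m = "mu M \<cdot> inv_arr S (J k k)" and ?i = "Id S (pw k)"
  have as: "mu M \<cdot> (mu M \<odot> ?i) = mu M \<cdot> (?i \<odot> mu M) \<cdot> asc S (pw k) (pw k) (pw k)"
    and ul: "mu M \<cdot> (eta M \<odot> ?i) = lun S (pw k)" and ur: "mu M \<cdot> (?i \<odot> eta M) = run S (pw k)"
    and cm: "mu M \<cdot> sym S (pw k) (pw k) = mu M"
    using M unfolding is_comm_monoid_def k by blast+
  have m: "between ?m (k + k) k" and i: "between ?i k k" and e: "between (eta M) 0 k" by simp_all
  have mJ: "?m \<cdot> J k k = mu M" by simp
  \<comment> \<open>Precomposition with \<open>J\<close> strips the rebracketings from the new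
    multiplication, so each axiom reduces to the corresponding axiom of \<open>M\<close>.\<close>
  have mT: "?m \<cdot> tn n k n' k f g \<cdot> J n n' = mu M \<cdot> (f \<odot> g)" if fg: "between f n k" "between g n' k" for f g n n'
  proof -
    have "?m \<cdot> tn n k n' k f g \<cdot> J n n' = (?m \<cdot> J k k) \<cdot> (f \<odot> g)"
      unfolding tn_J[OF fg] using fg by simp
    then show ?thesis unfolding mJ .
  qed
  have 1: "?m \<cdot> tn (k + k) k k k ?m ?i = ?m \<cdot> tn k k (k + k) k ?i ?m"
  proof (rule JJ_cancel[of _ k k k _ k])
    note [simp] = tn_Arr[OF m i] tn_Arr[OF i m]
    have "(?m \<cdot> tn (k + k) k k k ?m ?i) \<cdot> J (k + k) k \<cdot> (J k k \<odot> ?i) =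
        (?m \<cdot> tn (k + k) k k k ?m ?i \<cdot> J (k + k) k) \<cdot> (J k k \<odot> ?i)" by simp
    also have "\<dots> = mu M \<cdot> (mu M \<odot> ?i)" unfolding mT[OF m i] by (simp add: interchange)
    also have "\<dots> = (?m \<cdot> tn k k (k + k) k ?i ?m \<cdot> J k (k + k)) \<cdot> (?i \<odot> J k k) \<cdot> asc S (pw k) (pw k) (pw k)"
      unfolding mT[OF i m] as by (simp add: interchange_Cmp)
    also have "\<dots> = ?m \<cdot> tn k k (k + k) k ?i ?m \<cdot> J k (k + k) \<cdot> (?i \<odot> J k k) \<cdot> asc S (pw k) (pw k) (pw k)"
      by simp
    finally show "(?m \<cdot> tn (k + k) k k k ?m ?i) \<cdot> J (k + k) k \<cdot> (J k k \<odot> ?i) =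
        (?m \<cdot> tn k k (k + k) k ?i ?m) \<cdot> J (k + k) k \<cdot> (J k k \<odot> ?i)"
      unfolding J_assoc by (simp add: add.assoc)
  qed (use tn_Arr[OF m i] tn_Arr[OF i m] in \<open>simp_all add: add.assoc\<close>)
  have 2: "?m \<cdot> tn 0 k k k (eta M) ?i = ?i"
    by (rule J_cancel[of _ 0 k _ k]) (use mT[OF e i] tn_Arr[OF e i] ul in simp_all)
  have 3: "?m \<cdot> tn k k 0 k ?i (eta M) = ?i"
    by (rule J_cancel[of _ k 0 _ k]) (use mT[OF i e] tn_Arr[OF i e] ur in \<open>simp_all add: J_0\<close>)
  have 4: "?m \<cdot> sm k k = ?m"
  proof (rule J_cancel[of _ k k _ k])
    have "(?m \<cdot> sm k k) \<cdot> J k k = ?m \<cdot> J k k \<cdot> sym S (pw k) (pw k)"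
      using sm_J[of k k] by simp
    then show "(?m \<cdot> sm k k) \<cdot> J k k = ?m \<cdot> J k k" using cm by simp
  qed simp_all
  interpret E: prop_cat end_prop by (rule prop_cat_end_prop)
  show ?thesis
    unfolding E.is_comm_monoid_PROP_iff E.is_magma_def end_mon_sel end_prop_sel Hom_iff
    using m e by (simp only: 1 2 3 4 add.assoc add_0 add_0_right simp_thms)
qed

lemma is_monoid_hom_end_mon:
  assumes M: "is_comm_monoid S M" "obj M = pw k" and N: "is_comm_monoid S N" "obj N = pw k"
    and f: "is_monoid_hom S M f N"
  shows "is_monoid_hom end_prop (end_mon k M) (k, f, k) (end_mon k N)"
proof -
  note [simp] = is_comm_monoidD[OF M(1), unfolded M(2)] is_comm_monoidD[OF N(1), unfolded N(2)]
  have fa: "between f k k" using is_monoid_homD[OF f] M N by simp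
  have "f \<cdot> mu M \<cdot> inv_arr S (J k k) = (f \<cdot> mu M) \<cdot> inv_arr S (J k k)" using fa by simp
  also have "\<dots> = (mu N \<cdot> inv_arr S (J k k)) \<cdot> tn k k k k f f"
    unfolding is_monoid_homD(4)[OF f] tn_def using fa by simp
  finally show ?thesis using fa is_monoid_homD(5)[OF f] by (simp add: is_monoid_hom_def)
qed

text \<open>Forgetting the exponents gives a strict functor when \<open>S\<close> is strict. For a
  general \<open>S\<close> the comparison arrows \<open>J\<close> are needed in addition, as in
  \<open>mrealize\<close>.\<close>

definition realize :: "('o1, 'm1) smc \<Rightarrow> ('o1, 'm1, nat, nat \<times> 'm \<times> nat) cfunctor \<Rightarrow> ('o1, 'm1, 'o, 'm) cfunctor"
  where "realize T K = \<lparr>FO = restrict (\<lambda>a. pw (FO K a)) (Ob T), FA = restrict (\<lambda>f. fst (snd (FA K f))) (Arr T)\<rparr>"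

definition mrealize :: "('o1, 'm1) smc \<Rightarrow> ('o1, 'm1, nat, nat \<times> 'm \<times> nat) cfunctor \<Rightarrow> ('o1, 'm1, 'o, 'm) mfunctor"
  where "mrealize T K = \<lparr>FO = FO (realize T K), FA = FA (realize T K),
    phi = restrict (\<lambda>(a, b). J (FO K a) (FO K b)) (Ob T \<times> Ob T), phi0 = Id S (unitO S)\<rparr>"

lemma realize_sel [simp]:
  "FO (realize T K) = restrict (\<lambda>a. pw (FO K a)) (Ob T)"
  "FA (realize T K) = restrict (\<lambda>f. fst (snd (FA K f))) (Arr T)"
  by (auto simp: realize_def)

lemma mrealize_sel [simp]:
  "FO (mrealize T K) = restrict (\<lambda>a. pw (FO K a)) (Ob T)"
  "FA (mrealize T K) = restrict (\<lambda>f. fst (snd (FA K f))) (Arr T)"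
  "phi (mrealize T K) = restrict (\<lambda>(a, b). J (FO K a) (FO K b)) (Ob T \<times> Ob T)"
  "phi0 (mrealize T K) = Id S (unitO S)"
  by (auto simp: mrealize_def)

context
  fixes T :: "('o1, 'm1) smc" and K :: "('o1, 'm1, nat, nat \<times> 'm \<times> nat) cfunctor"
  assumes K: "symmetric_strict_monoidal_functor T end_prop K"
begin

interpretation K: symmetric_strict_monoidal_functor T end_prop K by (rule K)

lemma realize_arrow:
  assumes "f \<in> Arr T"
  obtains g where "FA K f = (FO K (Dom T f), g, FO K (Cod T f))" "between g (FO K (Dom T f)) (FO K (Cod T f))"
  using K.FA_Hom[of f "Dom T f" "Cod T f"] assms unfolding end_prop_Hom by auto

lemma realize_Cmp:
  assumes "f \<in> Arr T" "g \<in> Arr T" "Dom T g = Cod T f"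
  shows "fst (snd (FA K (g \<cdot>\<^bsub>T\<^esub> f))) = fst (snd (FA K g)) \<cdot> fst (snd (FA K f))"
  using assms by (auto elim!: realize_arrow[of f] realize_arrow[of g])

lemma cat_functor_realize: "cat_functor T S (realize T K)"
proof (unfold_locales, goal_cases)
  case (4 f a b)
  then have "f \<in> Arr T" by simp
  then show ?case by (rule realize_arrow) (use 4 in auto)
next
  case (6 f a b g c)
  then show ?case using realize_Cmp by auto
qed (auto simp: K.FA_Id)

text \<open>The tensor product of \<open>end_prop\<close> is that of \<open>S\<close> conjugated by
  \<open>J\<close>, so \<open>J\<close> is the comparison isomorphism. Its coherence laws are
  \<open>J_assoc\<close>, \<open>J_0\<close> and \<open>sm_J\<close>.\<close>

lemma symmetric_monoidal_functor_mrealize: "symmetric_monoidal_functor T S (mrealize T K)"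
proof -
  interpret R: cat_functor T S "realize T K" by (rule cat_functor_realize)
  note [simp] = K.strict_tensO[simplified] K.strict_unitO[simplified]
  show ?thesis
  proof (unfold_locales, goal_cases)
    case (4 f a b) then show ?case using R.FA_Hom[of f a b] by simp
  next case (5 a) then show ?case using R.FA_Id[of a] by simp
  next case (6 f a b g c) then show ?case using R.FA_Cmp[of f a b g c] by auto
  next case (9 a b) then show ?case by simp
  next case (12 f a a' g b b')
    then obtain x y where e: "FA K f = (FO K a, x, FO K a')" "between x (FO K a) (FO K a')"
       "FA K g = (FO K b, y, FO K b')" "between y (FO K b) (FO K b')"
      by (metis realize_arrow Hom_iff)
    show ?case using 12 tn_J[OF e(2,4)] K.strict_tensA[of f g] e(1,3) by auto
  next case (13 a b c)
    then show ?case using K.strict_FA_asc[of a b c] J_assoc[of "FO K a" "FO K b" "FO K c"]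
      by (simp add: add.assoc)
  next case (14 a) then show ?case using K.strict_FA_lun[of a] by simp
  next case (15 a) then show ?case using K.strict_FA_run[of a] by (simp add: J_0)
  next case (16 a b) then show ?case using K.strict_FA_sym[of a b] by (simp add: sm_J)
  qed auto
qed

end

end

section \<open>Realization in a strict category\<close>

locale strict_tensor_powers = tensor_powers S X + symmetric_strict_monoidal_category S
  for S :: "('o, 'm, 'x) smc_scheme" (structure) and X :: 'o
begin

lemma pw_add: "pw (n + m) = pw n \<boxtimes> pw m"
proof (induction n)
  case 0
  then show ?case using strict_lun[of "pw m"] by simp
next
  case (Suc n)
  then show ?case using strict_asc[of X "pw n" "pw m"] by simp
qed

lemma J_Id: "J n m = Id S (pw (n + m))"
proof (induction n)
  case 0
  then show ?case using strict_lun[of "pw m"] by simp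
next
  case (Suc n)
  then show ?case using strict_asc[of X "pw n" "pw m"] by (simp add: pw_add)
qed

lemma symmetric_strict_monoidal_functor_realize:
  fixes T :: "('o1, 'm1) smc" and K :: "('o1, 'm1, nat, nat \<times> 'm \<times> nat) cfunctor"
  assumes K: "symmetric_strict_monoidal_functor T end_prop K"
  shows "symmetric_strict_monoidal_functor T S (realize T K)"
proof -
  interpret K: symmetric_strict_monoidal_functor T end_prop K by (rule K)
  interpret R: cat_functor T S "realize T K" by (rule cat_functor_realize[OF K])
  note [simp] = K.strict_tensO[simplified] K.strict_unitO[simplified]
  show ?thesis
  proof (unfold_locales, goal_cases)
    case (3 f g)
    then obtain x y where e: "FA K f = (FO K (Dom T f), x, FO K (Cod T f))" "between x (FO K (Dom T f)) (FO K (Cod T f))"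
       "FA K g = (FO K (Dom T g), y, FO K (Cod T g))" "between y (FO K (Dom T g)) (FO K (Cod T g))"
      by (metis realize_arrow[OF K])
    have "tn (FO K (Dom T f)) (FO K (Cod T f)) (FO K (Dom T g)) (FO K (Cod T g)) x y = x \<odot> y"
      using e(2,4) by (simp add: tn_def J_Id pw_add)
    then show ?case using 3 K.strict_tensA[of f g] e(1,3) by simp
  next case (4 a b c)
    then show ?case using K.strict_FA_asc[of a b c] strict_asc[of "pw (FO K a)" "pw (FO K b)" "pw (FO K c)"]
      by (simp add: pw_add add.assoc)
  next case (5 a) then show ?case using K.strict_FA_lun[of a] strict_lun[of "pw (FO K a)"] by simp
  next case (6 a) then show ?case using K.strict_FA_run[of a] strict_run[of "pw (FO K a)"] by simp
  next case (7 a b) then show ?case using K.strict_FA_sym[of a b] by (simp add: sm_def J_Id pw_add)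
  qed (auto simp: pw_add)
qed

end

section \<open>Algebras over the PROP and their underlying monoids\<close>

text \<open>With \<open>act\<close> this is the tautological G-monoid in the PROP; the underlying
  monoid of an algebra is its image.\<close>

definition gen_mon :: "('g, 'b) monoid_scheme \<Rightarrow> (nat, 'g FG_arr) mon"
  where "gen_mon G = \<lparr>obj = 1,
    mu = (2, 1, \<lambda>i\<in>{1..2}. 1, \<lambda>i\<in>{1..2}. \<one>\<^bsub>G\<^esub>),
    eta = (0, 1, \<lambda>i\<in>{1..0}. 1, \<lambda>i\<in>{1..0}. \<one>\<^bsub>G\<^esub>)\<rparr>"

definition act :: "'g \<Rightarrow> 'g FG_arr"
  where "act g = (1, 1, \<lambda>i\<in>{1..1}. 1, \<lambda>i\<in>{1..1}. g)"

lemma gen_mon_sel: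
  "obj (gen_mon G) = 1"
  "mu (gen_mon G) = (2, 1, \<lambda>i\<in>{1..2}. 1, \<lambda>i\<in>{1..2}. \<one>\<^bsub>G\<^esub>)"
  "eta (gen_mon G) = (0, 1, \<lambda>i\<in>{1..0}. 1, \<lambda>i\<in>{1..0}. \<one>\<^bsub>G\<^esub>)"
  by (auto simp: gen_mon_def)

lemma FG_Dom_Cod: "Dom (FG G) (n, m, f, x) = n" "Cod (FG G) (n, m, f, x) = m"
  by (auto simp: FG_def)

lemma is_comm_monoid_gen_mon:
  assumes "group G" shows "is_comm_monoid (FG G) (gen_mon G)"
proof -
  interpret G: group G by fact
  interpret FG: prop_cat "FG G" by (rule prop_cat_FG) fact
  have 1: "FG.is_magma (gen_mon G)"
    unfolding FG.is_magma_def gen_mon_sel FG_Hom FG_sel FG_id_def FG_tensA FG_Cmp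
    by (auto intro!: restrict_ext)
  have 2: "mu (gen_mon G) \<cdot>\<^bsub>FG G\<^esub> (mu (gen_mon G) \<odot>\<^bsub>FG G\<^esub> Id (FG G) 1) =
     mu (gen_mon G) \<cdot>\<^bsub>FG G\<^esub> (Id (FG G) 1 \<odot>\<^bsub>FG G\<^esub> mu (gen_mon G))"
    unfolding gen_mon_sel FG_sel FG_id_def FG_tensA FG_Cmp
    by (rule FG_eqI) auto
  have 3: "mu (gen_mon G) \<cdot>\<^bsub>FG G\<^esub> sym (FG G) 1 1 = mu (gen_mon G)"
    unfolding gen_mon_sel FG_sym FG_Cmp by (rule FG_eqI) auto
  show ?thesis using 1 2 3 by (simp only: FG.is_comm_monoid_PROP_iff gen_mon_sel(1) simp_thms)
qed

lemma act_Arr: "g \<in> carrier G \<Longrightarrow> act g \<in> Hom (FG G) 1 1"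
  unfolding act_def FG_Hom by auto

lemma is_monoid_hom_act:
  assumes "group G" "g \<in> carrier G" shows "is_monoid_hom (FG G) (gen_mon G) (act g) (gen_mon G)"
proof -
  interpret G: group G by fact
  have 1: "act g \<cdot>\<^bsub>FG G\<^esub> mu (gen_mon G) = mu (gen_mon G) \<cdot>\<^bsub>FG G\<^esub> (act g \<odot>\<^bsub>FG G\<^esub> act g)"
    unfolding act_def gen_mon_sel FG_tensA FG_Cmp by (rule FG_eqI) (use assms in auto)
  have 2: "act g \<cdot>\<^bsub>FG G\<^esub> eta (gen_mon G) = eta (gen_mon G)"
    unfolding act_def gen_mon_sel FG_tensA FG_Cmp by (rule FG_eqI) auto
  show ?thesis unfolding is_monoid_hom_def gen_mon_sel(1) using act_Arr[OF assms(2)] 1 2 by blast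
qed

lemma act_mult: "act (g \<otimes>\<^bsub>G\<^esub> h) = act g \<cdot>\<^bsub>FG G\<^esub> act h"
  unfolding act_def FG_Cmp by (rule FG_eqI) auto

lemma act_one: "act \<one>\<^bsub>G\<^esub> = Id (FG G) 1"
  unfolding act_def FG_sel FG_id_def by (rule FG_eqI) auto

text \<open>Naturality is preserved by composition and, for monoidal transformations, by tensor
  products. This rule therefore reduces it to finitely many kinds of generators.\<close>

lemma FG_induct [consumes 2, case_names Id Cmp tensA sym mu eta act]:
  assumes G: "group G" and p: "p \<in> Arr (FG G)"
    and Id: "\<And>n. P (Id (FG G) n)"
    and Cmp: "\<And>p q. \<lbrakk>p \<in> Arr (FG G); q \<in> Arr (FG G); Dom (FG G) q = Cod (FG G) p; P p; P q\<rbrakk> \<Longrightarrow> P (q \<cdot>\<^bsub>FG G\<^esub> p)"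
    and tensA: "\<And>p q. \<lbrakk>p \<in> Arr (FG G); q \<in> Arr (FG G); P p; P q\<rbrakk> \<Longrightarrow> P (p \<odot>\<^bsub>FG G\<^esub> q)"
    and sym: "\<And>n m. P (sym (FG G) n m)"
    and mu: "P (mu (gen_mon G))" and eta: "P (eta (gen_mon G))"
    and act: "\<And>g. g \<in> carrier G \<Longrightarrow> P (act g)"
  shows "P p"
proof -
  interpret G: group G by fact
  interpret FG: prop_cat "FG G" by (rule prop_cat_FG) fact
  note gen = FG.is_comm_monoidD[OF is_comm_monoid_gen_mon[OF G], unfolded gen_mon_sel(1)]
  \<comment> \<open>The map from the empty set to m points is a tensor product of m copies of the
    unit.\<close>
  have init: "(0, m, f, x) \<in> Arr (FG G) \<Longrightarrow> P (0, m, f, x)" for m f x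
  proof (induction m arbitrary: f x)
    case 0
    have "(0, 0, f, x) = Id (FG G) 0"
      using 0 unfolding FG_sel FG_id_def FG_Arr_iff by (intro FG_eqI) (auto simp: PiE_def)
    then show ?case using Id[of 0] by (simp only:)
  next
    case (Suc m)
    \<comment> \<open>The only extensional function on the empty index set.\<close>
    let ?u = "\<lambda>_. undefined"
    have a: "(0, m, ?u, ?u) \<in> Arr (FG G)" unfolding FG_Arr_iff by simp
    have "(0, Suc m, f, x) = (0, m, ?u, ?u) \<odot>\<^bsub>FG G\<^esub> eta (gen_mon G)"
      using Suc.prems unfolding gen_mon_sel FG_tensA FG_Arr_iff by (intro FG_eqI) (auto simp: PiE_def)
    then show ?case using tensA[OF a gen(5) Suc.IH[OF a] eta] by (simp only:)
  qed
  \<comment> \<open>An arrow from \<open>n + 1\<close> is an arrow from \<open>n\<close> next to a labelled point, followed by the map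
    that merges this last point into \<open>j = f (n + 1)\<close>.\<close>
  define merge where "merge m j = (m + 1, m, \<lambda>i\<in>{1..m + 1}. if i \<le> m then i else j, \<lambda>i\<in>{1..m + 1}. \<one>\<^bsub>G\<^esub>)" for m j :: nat
  have merge_Arr: "merge m j \<in> Arr (FG G)" if "1 \<le> j" "j \<le> m" for m j
    unfolding merge_def FG_Arr_iff using that by (auto simp: le_Suc_eq)
  have merge: "P (merge m j)" if j: "1 \<le> j" "j \<le> m" for m j
  proof -
    \<comment> \<open>The numbers of points before and after j. The symmetry moves the last point
      across the b points behind j, and the multiplication then merges it with j.\<close>
    define a b where "a = j - 1" and "b = m - j"
    have ab: "m = a + 1 + b" "j = a + 1" using j by (auto simp: a_def b_def)
    let ?x = "(Id (FG G) a \<odot>\<^bsub>FG G\<^esub> mu (gen_mon G)) \<odot>\<^bsub>FG G\<^esub> Id (FG G) b"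
    let ?y = "Id (FG G) (a + 1) \<odot>\<^bsub>FG G\<^esub> sym (FG G) b 1"
    have "merge m j = ?x \<cdot>\<^bsub>FG G\<^esub> ?y"
      unfolding merge_def ab gen_mon_sel FG_sel FG_id_def FG_sym FG_tensA FG_Cmp
    proof (rule FG_eqI, goal_cases)
      case (7 i)
      consider "i \<le> a" | "i = a + 1" | k where "i = a + 1 + k" "1 \<le> k" "k \<le> b" | "i = a + 1 + b + 1"
      proof -
        assume *: "i \<le> a \<Longrightarrow> thesis" "i = a + 1 \<Longrightarrow> thesis"
          "\<And>k. i = a + 1 + k \<Longrightarrow> 1 \<le> k \<Longrightarrow> k \<le> b \<Longrightarrow> thesis" "i = a + 1 + b + 1 \<Longrightarrow> thesis"
        then show thesis using *(3)[of "i - (a + 1)"] 7 by linarith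
      qed
      then show ?case using 7 by cases auto
    next
      case (8 i)
      consider "i \<le> a" | "i = a + 1" | k where "i = a + 1 + k" "1 \<le> k" "k \<le> b" | "i = a + 1 + b + 1"
      proof -
        assume *: "i \<le> a \<Longrightarrow> thesis" "i = a + 1 \<Longrightarrow> thesis"
          "\<And>k. i = a + 1 + k \<Longrightarrow> 1 \<le> k \<Longrightarrow> k \<le> b \<Longrightarrow> thesis" "i = a + 1 + b + 1 \<Longrightarrow> thesis"
        then show thesis using *(3)[of "i - (a + 1)"] 8 by linarith
      qed
      then show ?case using 8 by cases auto
    qed auto
    moreover have "P (?x \<cdot>\<^bsub>FG G\<^esub> ?y)"
      using gen by (intro Cmp tensA Id mu sym) simp_all
    ultimately show ?thesis by (simp only:)
  qed
  have "(n, m, f, x) \<in> Arr (FG G) \<Longrightarrow> P (n, m, f, x)" for n m f x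
  proof (induction n arbitrary: f x)
    case 0
    then show ?case by (rule init)
  next
    case (Suc n)
    let ?j = "f (Suc n)" and ?g = "x (Suc n)"
    let ?p = "(n, m, restrict f {1..n}, restrict x {1..n})"
    have fx: "1 \<le> f i" "f i \<le> m" "x i \<in> carrier G" if "1 \<le> i" "i \<le> Suc n" for i
      using FG_ArrD[OF Suc.prems] that by blast+
    have j: "1 \<le> ?j" "?j \<le> m" and g: "?g \<in> carrier G" using fx[of "Suc n"] by simp_all
    have p: "?p \<in> Arr (FG G)" unfolding FG_Arr_iff using fx by auto
    have "(Suc n, m, f, x) = merge m ?j \<cdot>\<^bsub>FG G\<^esub> (?p \<odot>\<^bsub>FG G\<^esub> act ?g)"
      unfolding merge_def act_def FG_tensA FG_Cmp
    proof (rule FG_eqI, goal_cases)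
      case (7 i)
      then show ?case using fx[of i] by (cases "i \<le> n") (auto simp: le_Suc_eq)
    next
      case (8 i)
      then show ?case using fx[of i] by (cases "i \<le> n") (auto simp: le_Suc_eq)
    qed (use Suc.prems in \<open>auto simp: FG_Arr_iff PiE_def\<close>)
    moreover have "P (merge m ?j \<cdot>\<^bsub>FG G\<^esub> (?p \<odot>\<^bsub>FG G\<^esub> act ?g))"
    proof (rule Cmp[OF _ merge_Arr[OF j] _ _ merge[OF j]])
      show "?p \<odot>\<^bsub>FG G\<^esub> act ?g \<in> Arr (FG G)" using p act_Arr[OF g] by simp
      show "Dom (FG G) (merge m ?j) = Cod (FG G) (?p \<odot>\<^bsub>FG G\<^esub> act ?g)"
        by (simp add: merge_def act_def FG_tensA FG_Dom_Cod)
      show "P (?p \<odot>\<^bsub>FG G\<^esub> act ?g)"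
        using act_Arr[OF g] by (intro tensA p Suc.IH act g) simp
    qed
    ultimately show ?case by (simp only:)
  qed
  then show ?thesis using p by (cases p) simp
qed

section \<open>Images of monoids under monoidal functors and transformations\<close>

definition image_mon :: "('o2, 'm2, 'y) smc_scheme \<Rightarrow> ('o1, 'm1, 'o2, 'm2) mfunctor \<Rightarrow> ('o1, 'm1) mon \<Rightarrow> ('o2, 'm2) mon"
  where "image_mon S F A = \<lparr>obj = FO F (obj A), mu = FA F (mu A) \<cdot>\<^bsub>S\<^esub> phi F (obj A, obj A),
    eta = FA F (eta A) \<cdot>\<^bsub>S\<^esub> phi0 F\<rparr>"

lemma image_mon_sel [simp]:
  "obj (image_mon S F A) = FO F (obj A)"
  "mu (image_mon S F A) = FA F (mu A) \<cdot>\<^bsub>S\<^esub> phi F (obj A, obj A)"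
  "eta (image_mon S F A) = FA F (eta A) \<cdot>\<^bsub>S\<^esub> phi0 F"
  by (auto simp: image_mon_def)

context symmetric_monoidal_functor
begin

abbreviation cmpS (infixr \<open>\<bullet>\<close> 65) where "g \<bullet> f \<equiv> g \<cdot>\<^bsub>S\<^esub> f"
abbreviation tensS (infixr \<open>\<star>\<close> 70) where "f \<star> g \<equiv> f \<odot>\<^bsub>S\<^esub> g"

lemma is_comm_monoid_image_mon:
  assumes A: "is_comm_monoid T A" shows "is_comm_monoid S (image_mon S F A)"
proof -
  note [simp] = source.is_comm_monoidD[OF A]
  let ?a = "obj A" and ?m = "mu A"
  let ?x = "FO F ?a" and ?i = "Id T ?a" and ?p = "phi F (?a, ?a)" and ?j = "Id S (FO F ?a)"
  have as: "?m \<cdot>\<^bsub>T\<^esub> (?m \<odot>\<^bsub>T\<^esub> ?i) = ?m \<cdot>\<^bsub>T\<^esub> (?i \<odot>\<^bsub>T\<^esub> ?m) \<cdot>\<^bsub>T\<^esub> asc T ?a ?a ?a"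
    and ul: "?m \<cdot>\<^bsub>T\<^esub> (eta A \<odot>\<^bsub>T\<^esub> ?i) = lun T ?a" and ur: "?m \<cdot>\<^bsub>T\<^esub> (?i \<odot>\<^bsub>T\<^esub> eta A) = run T ?a"
    and cm: "?m \<cdot>\<^bsub>T\<^esub> sym T ?a ?a = ?m"
    using A unfolding is_comm_monoid_def by blast+
  have nat: "?p \<bullet> (FA F f \<star> FA F g) \<bullet> h = FA F (f \<odot>\<^bsub>T\<^esub> g) \<bullet> phi F (Dom T f, Dom T g) \<bullet> h"
    if "f \<in> Arr T" "g \<in> Arr T" "Cod T f = ?a" "Cod T g = ?a" "h \<in> Arr S"
      "Cod S h = FO F (Dom T f) \<boxtimes>\<^bsub>S\<^esub> FO F (Dom T g)" for f g h
    using target.Cmp_Cmp[of h "FA F f \<star> FA F g" ?p] phi_natural[of f g ?a ?a] that by simp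
  \<comment> \<open>\<open>l\<close> and \<open>r\<close> pull a product in the image, with one
    factor coming from an arrow \<open>f\<close> of \<open>T\<close>, back inside the functor by
    naturality of \<open>phi\<close>. The axioms of \<open>A\<close> are then applied in
    \<open>T\<close>.\<close>
  have l: "(FA F ?m \<bullet> ?p) \<bullet> ((FA F f \<bullet> h) \<star> ?j) =
      FA F (?m \<cdot>\<^bsub>T\<^esub> (f \<odot>\<^bsub>T\<^esub> ?i)) \<bullet> phi F (Dom T f, ?a) \<bullet> (h \<star> ?j)"
    if "f \<in> Arr T" "Cod T f = ?a" "h \<in> Arr S" "Cod S h = FO F (Dom T f)" for f h
    using that nat[of f ?i "h \<star> ?j"] target.interchange[of h "FA F f" ?j ?j] by simp
  have r: "(FA F ?m \<bullet> ?p) \<bullet> (?j \<star> (FA F f \<bullet> h)) =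
      FA F (?m \<cdot>\<^bsub>T\<^esub> (?i \<odot>\<^bsub>T\<^esub> f)) \<bullet> phi F (?a, Dom T f) \<bullet> (?j \<star> h)"
    if "f \<in> Arr T" "Cod T f = ?a" "h \<in> Arr S" "Cod S h = FO F (Dom T f)" for f h
    using that nat[of ?i f "?j \<star> h"] target.interchange[of ?j ?j h "FA F f"] by simp
  have 1: "(FA F ?m \<bullet> ?p) \<bullet> ((FA F ?m \<bullet> ?p) \<star> ?j) =
      (FA F ?m \<bullet> ?p) \<bullet> (?j \<star> (FA F ?m \<bullet> ?p)) \<bullet> asc S ?x ?x ?x"
  proof -
    have "(FA F ?m \<bullet> ?p) \<bullet> ((FA F ?m \<bullet> ?p) \<star> ?j) =
        FA F (?m \<cdot>\<^bsub>T\<^esub> (?i \<odot>\<^bsub>T\<^esub> ?m) \<cdot>\<^bsub>T\<^esub> asc T ?a ?a ?a) \<bullet> phi F (?a \<boxtimes>\<^bsub>T\<^esub> ?a, ?a) \<bullet> (?p \<star> ?j)"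
      by (subst l) (simp_all add: as del: FA_Cmp')
    also have "\<dots> = FA F (?m \<cdot>\<^bsub>T\<^esub> (?i \<odot>\<^bsub>T\<^esub> ?m)) \<bullet> (FA F (asc T ?a ?a ?a) \<bullet> phi F (?a \<boxtimes>\<^bsub>T\<^esub> ?a, ?a) \<bullet> (?p \<star> ?j))"
      by simp
    also have "\<dots> = (FA F (?m \<cdot>\<^bsub>T\<^esub> (?i \<odot>\<^bsub>T\<^esub> ?m)) \<bullet> phi F (?a, ?a \<boxtimes>\<^bsub>T\<^esub> ?a) \<bullet> (?j \<star> ?p)) \<bullet> asc S ?x ?x ?x"
      by (subst phi_asc) simp_all
    also have "\<dots> = ((FA F ?m \<bullet> ?p) \<bullet> (?j \<star> (FA F ?m \<bullet> ?p))) \<bullet> asc S ?x ?x ?x"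
      by (subst r) simp_all
    finally show ?thesis by simp
  qed
  have 2: "(FA F ?m \<bullet> ?p) \<bullet> ((FA F (eta A) \<bullet> phi0 F) \<star> ?j) = lun S ?x"
    by (subst l) (simp_all add: ul phi_lun del: FA_Cmp')
  have 3: "(FA F ?m \<bullet> ?p) \<bullet> (?j \<star> (FA F (eta A) \<bullet> phi0 F)) = run S ?x"
    by (subst r) (simp_all add: ur phi_run del: FA_Cmp')
  have "(FA F ?m \<bullet> ?p) \<bullet> sym S ?x ?x = FA F (?m \<cdot>\<^bsub>T\<^esub> sym T ?a ?a) \<bullet> ?p"
    using phi_sym[of ?a ?a] by simp
  then have 4: "(FA F ?m \<bullet> ?p) \<bullet> sym S ?x ?x = FA F ?m \<bullet> ?p" unfolding cm .
  have 5: "?x \<in> Ob S" "FA F ?m \<bullet> ?p \<in> Hom S (?x \<boxtimes>\<^bsub>S\<^esub> ?x) ?x" "FA F (eta A) \<bullet> phi0 F \<in> Hom S (unitO S) ?x"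
    by simp_all
  show ?thesis unfolding is_comm_monoid_def image_mon_sel using 1 2 3 4 5 by blast
qed

lemma is_monoid_hom_image_mon:
  assumes A: "is_comm_monoid T A" and B: "is_comm_monoid T B" and f: "is_monoid_hom T A f B"
  shows "is_monoid_hom S (image_mon S F A) (FA F f) (image_mon S F B)"
proof -
  note [simp] = source.is_comm_monoidD[OF A] source.is_comm_monoidD[OF B] source.is_monoid_homD(1-3)[OF f]
  have "FA F f \<bullet> FA F (mu A) \<bullet> phi F (obj A, obj A) = FA F (f \<cdot>\<^bsub>T\<^esub> mu A) \<bullet> phi F (obj A, obj A)"
    by simp
  also have "\<dots> = (FA F (mu B) \<bullet> phi F (obj B, obj B)) \<bullet> (FA F f \<star> FA F f)"
    unfolding source.is_monoid_homD(4)[OF f] using phi_natural[of f f "obj B" "obj B"] by simp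
  finally have 1: "FA F f \<bullet> FA F (mu A) \<bullet> phi F (obj A, obj A) =
      (FA F (mu B) \<bullet> phi F (obj B, obj B)) \<bullet> (FA F f \<star> FA F f)" .
  have "FA F f \<bullet> FA F (eta A) \<bullet> phi0 F = FA F (f \<cdot>\<^bsub>T\<^esub> eta A) \<bullet> phi0 F" by simp
  then have 2: "FA F f \<bullet> FA F (eta A) \<bullet> phi0 F = FA F (eta B) \<bullet> phi0 F"
    unfolding source.is_monoid_homD(5)[OF f] .
  show ?thesis unfolding is_monoid_hom_def image_mon_sel using 1 2 by simp
qed

end

definition monoidal_transf :: "('o1, 'm1) smc \<Rightarrow> ('o2, 'm2) smc \<Rightarrow> ('o1, 'm1, 'o2, 'm2) mfunctor \<Rightarrow>
    ('o1 \<Rightarrow> 'm2) \<Rightarrow> ('o1, 'm1, 'o2, 'm2) mfunctor \<Rightarrow> bool"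
  where "monoidal_transf T S F \<theta> F' \<longleftrightarrow> nat_transf T S F \<theta> F' \<and>
    (\<forall>a \<in> Ob T. \<forall>b \<in> Ob T. \<theta> (a \<boxtimes>\<^bsub>T\<^esub> b) \<cdot>\<^bsub>S\<^esub> phi F (a, b) = phi F' (a, b) \<cdot>\<^bsub>S\<^esub> (\<theta> a \<odot>\<^bsub>S\<^esub> \<theta> b)) \<and>
    \<theta> (unitO T) \<cdot>\<^bsub>S\<^esub> phi0 F = phi0 F'"

lemma Alg_sel [simp]:
  "Ob (Alg T S) = {F. symmetric_monoidal_functor T S F}"
  "(F, \<theta>, F') \<in> Arr (Alg T S) \<longleftrightarrow> symmetric_monoidal_functor T S F \<and> symmetric_monoidal_functor T S F' \<and>
    monoidal_transf T S F \<theta> F'"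
  "Dom (Alg T S) (F, \<theta>, F') = F" "Cod (Alg T S) (F, \<theta>, F') = F'"
  "Id (Alg T S) F = (F, restrict (\<lambda>a. Id S (FO F a)) (Ob T), F)"
  "Cmp (Alg T S) (E', \<psi>, E'') (F, \<theta>, F') = (F, restrict (\<lambda>a. \<psi> a \<cdot>\<^bsub>S\<^esub> \<theta> a) (Ob T), E'')"
  unfolding Alg_def monoidal_transf_def by auto

lemma monoidal_transfD:
  assumes "monoidal_transf T S F \<theta> F'"
  shows "a \<in> Ob T \<Longrightarrow> \<theta> a \<in> Arr S" "a \<in> Ob T \<Longrightarrow> Dom S (\<theta> a) = FO F a" "a \<in> Ob T \<Longrightarrow> Cod S (\<theta> a) = FO F' a"
    "f \<in> Arr T \<Longrightarrow> \<theta> (Cod T f) \<cdot>\<^bsub>S\<^esub> FA F f = FA F' f \<cdot>\<^bsub>S\<^esub> \<theta> (Dom T f)"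
    "\<lbrakk>a \<in> Ob T; b \<in> Ob T\<rbrakk> \<Longrightarrow> \<theta> (a \<boxtimes>\<^bsub>T\<^esub> b) \<cdot>\<^bsub>S\<^esub> phi F (a, b) = phi F' (a, b) \<cdot>\<^bsub>S\<^esub> (\<theta> a \<odot>\<^bsub>S\<^esub> \<theta> b)"
    "\<theta> (unitO T) \<cdot>\<^bsub>S\<^esub> phi0 F = phi0 F'"
  using assms by (auto simp: monoidal_transf_def nat_transf_def)

lemma is_monoid_hom_transf:
  fixes S :: "('o, 'm) smc" (structure)
  assumes F: "symmetric_monoidal_functor T S F" and F': "symmetric_monoidal_functor T S F'"
    and \<theta>: "monoidal_transf T S F \<theta> F'" and A: "is_comm_monoid T A"
  shows "is_monoid_hom S (image_mon S F A) (\<theta> (obj A)) (image_mon S F' A)"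
proof -
  interpret F: symmetric_monoidal_functor T S F by fact
  interpret F': symmetric_monoidal_functor T S F' by fact
  note [simp] = F.source.is_comm_monoidD[OF A] monoidal_transfD(1-3)[OF \<theta>]
  let ?a = "obj A"
  have "\<theta> ?a \<cdot> FA F (mu A) \<cdot> phi F (?a, ?a) = (\<theta> ?a \<cdot> FA F (mu A)) \<cdot> phi F (?a, ?a)" by simp
  also have "\<dots> = FA F' (mu A) \<cdot> \<theta> (?a \<boxtimes>\<^bsub>T\<^esub> ?a) \<cdot> phi F (?a, ?a)"
    using monoidal_transfD(4)[OF \<theta>, of "mu A"] by simp
  also have "\<dots> = (FA F' (mu A) \<cdot> phi F' (?a, ?a)) \<cdot> (\<theta> ?a \<odot> \<theta> ?a)"
    by (subst monoidal_transfD(5)[OF \<theta>]) simp_all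
  finally have 1: "\<theta> ?a \<cdot> FA F (mu A) \<cdot> phi F (?a, ?a) =
      (FA F' (mu A) \<cdot> phi F' (?a, ?a)) \<cdot> (\<theta> ?a \<odot> \<theta> ?a)" .
  have "\<theta> ?a \<cdot> FA F (eta A) \<cdot> phi0 F = (\<theta> ?a \<cdot> FA F (eta A)) \<cdot> phi0 F" by simp
  also have "\<dots> = FA F' (eta A) \<cdot> \<theta> (unitO T) \<cdot> phi0 F"
    using monoidal_transfD(4)[OF \<theta>, of "eta A"] by simp
  finally have 2: "\<theta> ?a \<cdot> FA F (eta A) \<cdot> phi0 F = FA F' (eta A) \<cdot> phi0 F'"
    unfolding monoidal_transfD(6)[OF \<theta>] .
  show ?thesis unfolding is_monoid_hom_def image_mon_sel using 1 2 by simp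
qed

section \<open>Extension of an equivariant homomorphism to a transformation of algebras\<close>

locale alg_hom_extension = F: symmetric_monoidal_functor "FG G" S F +
  F': symmetric_monoidal_functor "FG G" S F' + G: group G
  for G :: "('g, 'b) monoid_scheme" and S :: "('o, 'm) smc" (structure)
    and F :: "(nat, 'g FG_arr, 'o, 'm) mfunctor" and F' +
  fixes f :: 'm
  assumes hom: "is_monoid_hom S (image_mon S F (gen_mon G)) f (image_mon S F' (gen_mon G))"
    and equivariant: "g \<in> carrier G \<Longrightarrow> f \<cdot> FA F (act g) = FA F' (act g) \<cdot> f"
begin

text \<open>Compatibility with \<open>phi0\<close> and with \<open>phi\<close> at
  \<open>(n, Suc 0)\<close> leaves no other choice.\<close>

primrec ext :: "nat \<Rightarrow> 'm"
  where "ext 0 = phi0 F' \<cdot> inv_arr S (phi0 F)"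
  | "ext (Suc n) = phi F' (n, Suc 0) \<cdot> (ext n \<odot> f) \<cdot> inv_arr S (phi F (n, Suc 0))"

lemma f_Arr [simp]: "f \<in> Arr S" "Dom S f = FO F (Suc 0)" "Cod S f = FO F' (Suc 0)"
  using F.target.is_monoid_homD(1-3)[OF hom] by (simp_all add: gen_mon_sel)

lemma FG_Ob [simp]: "a \<in> Ob (FG G)" "tensO (FG G) a b = a + b" "unitO (FG G) = 0"
  by (simp_all add: FG_sel)

lemma ext_Arr [simp]: "ext n \<in> Arr S" "Dom S (ext n) = FO F n" "Cod S (ext n) = FO F' n"
  by (induction n) auto

lemma phi_unit:
  "phi F (n, 0) \<cdot> (Id S (FO F n) \<odot> phi0 F) = run S (FO F n)"
  "phi F' (n, 0) \<cdot> (Id S (FO F' n) \<odot> phi0 F') = run S (FO F' n)"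
  "phi F (0, n) \<cdot> (phi0 F \<odot> Id S (FO F n)) = lun S (FO F n)"
  "phi F' (0, n) \<cdot> (phi0 F' \<odot> Id S (FO F' n)) = lun S (FO F' n)"
  using F.phi_run[of n] F'.phi_run[of n] F.phi_lun[of n] F'.phi_lun[of n] F.FA_Id[of n] F'.FA_Id[of n]
  by (simp_all add: FG_sel)

lemma phi_assoc:
  "phi F (a + b, c) \<cdot> (phi F (a, b) \<odot> Id S (FO F c)) =
   phi F (a, b + c) \<cdot> (Id S (FO F a) \<odot> phi F (b, c)) \<cdot> asc S (FO F a) (FO F b) (FO F c)"
  "phi F' (a + b, c) \<cdot> (phi F' (a, b) \<odot> Id S (FO F' c)) =
   phi F' (a, b + c) \<cdot> (Id S (FO F' a) \<odot> phi F' (b, c)) \<cdot> asc S (FO F' a) (FO F' b) (FO F' c)"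
  using F.phi_asc[of a b c] F'.phi_asc[of a b c] F.FA_Id[of "a + b + c"] F'.FA_Id[of "a + b + c"]
  by (simp_all add: FG_sel add.assoc)

text \<open>Induction on the second argument, since \<open>ext\<close> adds factors on the right.
  Both cases are checked after precomposing with an invertible \<open>?z\<close>, chosen so that the
  unit law or the associativity law of \<open>phi\<close> applies.\<close>

lemma ext_tensO: "ext (n + m) \<cdot> phi F (n, m) = phi F' (n, m) \<cdot> (ext n \<odot> ext m)"
proof (induction m)
  case 0
  let ?z = "Id S (FO F n) \<odot> phi0 F"
  have "(ext n \<cdot> phi F (n, 0)) \<cdot> ?z = ext n \<cdot> run S (FO F n)"
    using phi_unit(1) by simp
  also have "\<dots> = run S (FO F' n) \<cdot> (ext n \<odot> Id S (unitO S))"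
    by (subst F.target.run_natural) simp_all
  also have "\<dots> = phi F' (n, 0) \<cdot> (ext n \<odot> phi0 F')"
    unfolding phi_unit(2)[symmetric] by (simp add: F.target.interchange)
  also have "\<dots> = (phi F' (n, 0) \<cdot> (ext n \<odot> ext 0)) \<cdot> ?z"
    by (simp add: F.target.interchange)
  finally have "ext n \<cdot> phi F (n, 0) = phi F' (n, 0) \<cdot> (ext n \<odot> ext 0)"
    by (rule F.target.iso_cancel_right) simp_all
  then show ?case by simp
next
  case (Suc m)
  let ?i = "Id S (FO F n)" and ?k = "Id S (FO F (Suc 0))"
  let ?asc = "asc S (FO F n) (FO F m) (FO F (Suc 0))" and ?asc' = "asc S (FO F' n) (FO F' m) (FO F' (Suc 0))"
  let ?z = "(?i \<odot> phi F (m, Suc 0)) \<cdot> ?asc"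
  have e: "ext (Suc k) \<cdot> phi F (k, Suc 0) = phi F' (k, Suc 0) \<cdot> (ext k \<odot> f)" for k
    by simp
  have "(ext (n + Suc m) \<cdot> phi F (n, Suc m)) \<cdot> ?z =
      (ext (Suc (n + m)) \<cdot> phi F (n + m, Suc 0)) \<cdot> (phi F (n, m) \<odot> ?k)"
    using phi_assoc(1)[of n m "Suc 0"] by (simp del: ext.simps)
  also have "\<dots> = phi F' (n + m, Suc 0) \<cdot> ((ext (n + m) \<cdot> phi F (n, m)) \<odot> f)"
    unfolding e by (simp add: F.target.interchange)
  also have "\<dots> = (phi F' (n + m, Suc 0) \<cdot> (phi F' (n, m) \<odot> Id S (FO F' (Suc 0)))) \<cdot> ((ext n \<odot> ext m) \<odot> f)"
    unfolding Suc by (simp add: F.target.interchange)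
  also have "\<dots> = (phi F' (n, Suc m) \<cdot> (Id S (FO F' n) \<odot> phi F' (m, Suc 0))) \<cdot> ?asc' \<cdot> ((ext n \<odot> ext m) \<odot> f)"
    unfolding phi_assoc(2) by simp
  also have "\<dots> = phi F' (n, Suc m) \<cdot> (ext n \<odot> (phi F' (m, Suc 0) \<cdot> (ext m \<odot> f))) \<cdot> ?asc"
    by (subst F.target.asc_natural) (simp_all add: F.target.interchange_Cmp)
  also have "\<dots> = (phi F' (n, Suc m) \<cdot> (ext n \<odot> ext (Suc m))) \<cdot> ?z"
    unfolding e[symmetric] by (simp add: F.target.interchange_Cmp del: ext.simps)
  finally show ?case by (rule F.target.iso_cancel_right) (simp_all del: ext.simps)
qed

text \<open>The recursion starts at 0, so \<open>ext (Suc 0)\<close> is \<open>f\<close> wrapped in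
  \<open>phi0\<close> and in \<open>phi\<close> at \<open>(0, Suc 0)\<close>. The left unit laws of
  both functors and naturality of the left unitor remove the wrapping.\<close>

lemma ext_1: "ext (Suc 0) = f"
proof (rule F.target.iso_cancel_right)
  let ?z = "phi0 F \<odot> Id S (FO F (Suc 0))"
  have "ext (Suc 0) \<cdot> lun S (FO F (Suc 0)) = (ext (Suc 0) \<cdot> phi F (0, Suc 0)) \<cdot> ?z"
    unfolding phi_unit(3)[symmetric] by (simp del: ext.simps)
  also have "\<dots> = phi F' (0, Suc 0) \<cdot> (phi0 F' \<odot> f)"
    by (simp add: F.target.interchange)
  also have "\<dots> = (phi F' (0, Suc 0) \<cdot> (phi0 F' \<odot> Id S (FO F' (Suc 0)))) \<cdot> (Id S (unitO S) \<odot> f)"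
    by (simp add: F.target.interchange)
  also have "\<dots> = f \<cdot> lun S (FO F (Suc 0))"
    unfolding phi_unit by (subst F.target.lun_natural) simp_all
  finally show "ext (Suc 0) \<cdot> lun S (FO F (Suc 0)) = f \<cdot> lun S (FO F (Suc 0))" .
qed (simp_all del: ext.simps)

text \<open>At \<open>mu\<close>, \<open>eta\<close> and \<open>act\<close> naturality is the
  hypothesis on \<open>f\<close>; at tensor products and symmetries it follows from
  \<open>ext_tensO\<close>.\<close>

lemma ext_natural:
  assumes "p \<in> Arr (FG G)"
  shows "ext (Cod (FG G) p) \<cdot> FA F p = FA F' p \<cdot> ext (Dom (FG G) p)"
  using G.is_group assms
proof (induction p rule: FG_induct)
  case (Id n)
  then show ?case by simp
next
  case (Cmp p q)
  have "ext (Cod (FG G) q) \<cdot> FA F q \<cdot> FA F p = (ext (Cod (FG G) q) \<cdot> FA F q) \<cdot> FA F p"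
    using Cmp(1-3) by simp
  also have "\<dots> = FA F' q \<cdot> (ext (Cod (FG G) p) \<cdot> FA F p)"
    unfolding Cmp(5) using Cmp(1-3) by simp
  also have "\<dots> = FA F' q \<cdot> FA F' p \<cdot> ext (Dom (FG G) p)" unfolding Cmp(4) ..
  finally show ?case using Cmp(1-3) by simp
next
  case (tensA p q)
  let ?a = "Dom (FG G) p" and ?b = "Dom (FG G) q" and ?c = "Cod (FG G) p" and ?d = "Cod (FG G) q"
  let ?pq = "p \<odot>\<^bsub>FG G\<^esub> q"
  have "(ext (?c + ?d) \<cdot> FA F ?pq) \<cdot> phi F (?a, ?b) =
      (ext (?c + ?d) \<cdot> phi F (?c, ?d)) \<cdot> (FA F p \<odot> FA F q)"
    using F.phi_natural[of p q ?c ?d] tensA(1,2) by simp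
  also have "\<dots> = phi F' (?c, ?d) \<cdot> ((ext ?c \<cdot> FA F p) \<odot> (ext ?d \<cdot> FA F q))"
    unfolding ext_tensO using tensA(1,2) by (simp add: F.target.interchange)
  also have "\<dots> = (phi F' (?c, ?d) \<cdot> (FA F' p \<odot> FA F' q)) \<cdot> (ext ?a \<odot> ext ?b)"
    unfolding tensA(3,4) using tensA(1,2) by (simp add: F.target.interchange)
  also have "\<dots> = FA F' ?pq \<cdot> (phi F' (?a, ?b) \<cdot> (ext ?a \<odot> ext ?b))"
    using F'.phi_natural[of p q ?c ?d] tensA(1,2) by simp
  also have "\<dots> = (FA F' ?pq \<cdot> ext (?a + ?b)) \<cdot> phi F (?a, ?b)"
    unfolding ext_tensO[symmetric] using tensA(1,2) by simp
  finally have "ext (?c + ?d) \<cdot> FA F ?pq = FA F' ?pq \<cdot> ext (?a + ?b)"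
    by (rule F.target.iso_cancel_right) (use tensA(1,2) in simp_all)
  then show ?case using tensA(1,2) by simp
next
  case (sym n m)
  let ?s = "sym (FG G) n m"
  have "(ext (m + n) \<cdot> FA F ?s) \<cdot> phi F (n, m) =
      (ext (m + n) \<cdot> phi F (m, n)) \<cdot> sym S (FO F n) (FO F m)"
    using F.phi_sym[of n m] by simp
  also have "\<dots> = phi F' (m, n) \<cdot> (sym S (FO F' n) (FO F' m) \<cdot> (ext n \<odot> ext m))"
    unfolding ext_tensO by (simp add: F.target.sym_natural)
  also have "\<dots> = (FA F' ?s \<cdot> phi F' (n, m)) \<cdot> (ext n \<odot> ext m)"
    using F'.phi_sym[of n m] by simp
  also have "\<dots> = FA F' ?s \<cdot> ext (n + m) \<cdot> phi F (n, m)"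
    unfolding ext_tensO by simp
  also have "\<dots> = (FA F' ?s \<cdot> ext (n + m)) \<cdot> phi F (n, m)" by simp
  finally have "ext (m + n) \<cdot> FA F ?s = FA F' ?s \<cdot> ext (n + m)"
    by (rule F.target.iso_cancel_right) simp_all
  then show ?case by simp
next
  case mu
  note gen = F.source.is_comm_monoidD[OF is_comm_monoid_gen_mon[OF G.is_group], unfolded gen_mon_sel(1), simplified]
  let ?m = "mu (gen_mon G)" and ?k = "Suc 0"
  have "(f \<cdot> FA F ?m) \<cdot> phi F (?k, ?k) = f \<cdot> (FA F ?m \<cdot> phi F (?k, ?k))"
    using gen by simp
  also have "\<dots> = (FA F' ?m \<cdot> phi F' (?k, ?k)) \<cdot> (f \<odot> f)"
    using F.target.is_monoid_homD(4)[OF hom] by (simp add: gen_mon_sel(1))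
  also have "\<dots> = FA F' ?m \<cdot> (phi F' (?k, ?k) \<cdot> (ext ?k \<odot> ext ?k))"
    unfolding ext_1 using gen by simp
  also have "\<dots> = (FA F' ?m \<cdot> ext (?k + ?k)) \<cdot> phi F (?k, ?k)"
    unfolding ext_tensO[symmetric] using gen by simp
  finally have "f \<cdot> FA F ?m = FA F' ?m \<cdot> ext (?k + ?k)"
    by (rule F.target.iso_cancel_right) (use gen in simp_all)
  then show ?case using gen ext_1 by simp
next
  case eta
  note gen = F.source.is_comm_monoidD[OF is_comm_monoid_gen_mon[OF G.is_group], unfolded gen_mon_sel(1), simplified]
  let ?e = "eta (gen_mon G)"
  have "(f \<cdot> FA F ?e) \<cdot> phi0 F = f \<cdot> (FA F ?e \<cdot> phi0 F)"
    using gen by simp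
  also have "\<dots> = FA F' ?e \<cdot> phi0 F'"
    using F.target.is_monoid_homD(5)[OF hom] by simp
  also have "\<dots> = (FA F' ?e \<cdot> ext 0) \<cdot> phi0 F" using gen by simp
  finally have "f \<cdot> FA F ?e = FA F' ?e \<cdot> ext 0"
    by (rule F.target.iso_cancel_right) (use gen in simp_all)
  then show ?case using gen ext_1 by simp
next
  case (act g)
  then show ?case using equivariant[of g] act_Arr[of g G] ext_1 by simp
qed

lemma monoidal_transf_ext: "monoidal_transf (FG G) S F ext F'"
  unfolding monoidal_transf_def nat_transf_def
  using ext_tensO ext_natural by (auto simp: FG_sel(1))

end

text \<open>As \<open>phi\<close> and \<open>phi0\<close> are invertible, the compatibility
  conditions fix the component at 0 and determine the one at \<open>Suc n\<close> from those at n
  and 1. This gives faithfulness.\<close>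

lemma monoidal_transf_unique:
  fixes S :: "('o, 'm) smc" (structure)
  assumes F: "symmetric_monoidal_functor (FG G) S F" and F': "symmetric_monoidal_functor (FG G) S F'"
    and \<theta>: "monoidal_transf (FG G) S F \<theta> F'" and \<psi>: "monoidal_transf (FG G) S F \<psi> F'" and 1: "\<theta> 1 = \<psi> 1"
  shows "\<theta> = \<psi>"
proof
  interpret F: symmetric_monoidal_functor "FG G" S F by fact
  interpret F': symmetric_monoidal_functor "FG G" S F' by fact
  have Ob [simp]: "n \<in> Ob (FG G)" for n by (simp add: FG_sel)
  note [simp] = monoidal_transfD(1-3)[OF \<theta>] monoidal_transfD(1-3)[OF \<psi>]
  show "\<theta> n = \<psi> n" for n
  proof (induction n)
    case 0
    have "\<theta> 0 \<cdot> phi0 F = \<psi> 0 \<cdot> phi0 F"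
      using monoidal_transfD(6)[OF \<theta>] monoidal_transfD(6)[OF \<psi>] by (simp add: FG_sel)
    then show ?case by (rule F.target.iso_cancel_right) (simp_all add: FG_sel)
  next
    case (Suc n)
    have "\<theta> (Suc n) \<cdot> phi F (n, 1) = \<psi> (Suc n) \<cdot> phi F (n, 1)"
      using monoidal_transfD(5)[OF \<theta> Ob Ob, of n 1] monoidal_transfD(5)[OF \<psi> Ob Ob, of n 1] Suc 1
      by (simp add: FG_sel)
    then show ?case by (rule F.target.iso_cancel_right) (simp_all add: FG_sel)
  qed
qed

section \<open>The underlying G-monoid of an algebra\<close>

definition underlying :: "('g, 'b) monoid_scheme \<Rightarrow> ('o, 'm) smc \<Rightarrow> (nat, 'g FG_arr, 'o, 'm) mfunctor \<Rightarrow>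
    (unit, 'g, ('o, 'm) mon, ('o, 'm) mon \<times> 'm \<times> ('o, 'm) mon) cfunctor"
  where "underlying G S F = \<lparr>FO = (\<lambda>u. image_mon S F (gen_mon G)),
    FA = restrict (\<lambda>g. (image_mon S F (gen_mon G), FA F (act g), image_mon S F (gen_mon G))) (carrier G)\<rparr>"

lemma underlying_sel [simp]:
  "FO (underlying G S F) u = image_mon S F (gen_mon G)"
  "FA (underlying G S F) =
    restrict (\<lambda>g. (image_mon S F (gen_mon G), FA F (act g), image_mon S F (gen_mon G))) (carrier G)"
  by (auto simp: underlying_def)

lemma category_G_comm_monoids:
  assumes "group G" "symmetric_monoidal_category S" shows "category (G_comm_monoids G S)"
  by (intro category_functor_category category_one_object_cat assms
      symmetric_monoidal_category.category_CommMon)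

lemma cat_functor_underlying:
  assumes G: "group G" and F: "symmetric_monoidal_functor (FG G) S F"
  shows "cat_functor (one_object_cat G) (CommMon S) (underlying G S F)"
proof -
  interpret G: group G by fact
  interpret F: symmetric_monoidal_functor "FG G" S F by fact
  interpret O: category "one_object_cat G" by (rule category_one_object_cat[OF G])
  interpret M: category "CommMon S" by (rule F.target.category_CommMon)
  note c = is_comm_monoid_gen_mon[OF G]
  note i = F.is_comm_monoid_image_mon[OF c] F.is_monoid_hom_image_mon[OF c c is_monoid_hom_act[OF G]]
  show ?thesis
  proof (unfold_locales, goal_cases)
    case (5 u)
    then show ?case using F.FA_Id[of 1] by (simp add: act_one gen_mon_sel(1) FG_sel(1))
  next
    case (6 g a b h c)
    then show ?case using act_Arr[of g G] act_Arr[of h G] by (simp add: act_mult)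
  qed (auto simp: i)
qed

definition underlying_functor :: "('g, 'b) monoid_scheme \<Rightarrow> ('o, 'm) smc \<Rightarrow> _"
  where "underlying_functor G S = \<lparr>FO = restrict (underlying G S) (Ob (Alg (FG G) S)),
    FA = restrict (\<lambda>(F, \<theta>, F'). (underlying G S F,
      (\<lambda>u::unit. (image_mon S F (gen_mon G), \<theta> 1, image_mon S F' (gen_mon G))), underlying G S F')) (Arr (Alg (FG G) S))\<rparr>"

lemma underlying_functor_sel [simp]:
  "FO (underlying_functor G S) = restrict (underlying G S) (Ob (Alg (FG G) S))"
  "FA (underlying_functor G S) = restrict (\<lambda>(F, \<theta>, F'). (underlying G S F,
      (\<lambda>u::unit. (image_mon S F (gen_mon G), \<theta> 1, image_mon S F' (gen_mon G))), underlying G S F')) (Arr (Alg (FG G) S))"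
  by (simp_all add: underlying_functor_def)

lemma functor_category_sel [simp]:
  "Ob (functor_category C D) = {F. cat_functor C D F}"
  "(F, \<theta>, F') \<in> Arr (functor_category C D) \<longleftrightarrow> cat_functor C D F \<and> cat_functor C D F' \<and> nat_transf C D F \<theta> F'"
  "Dom (functor_category C D) (F, \<theta>, F') = F" "Cod (functor_category C D) (F, \<theta>, F') = F'"
  "Id (functor_category C D) F = (F, restrict (\<lambda>a. Id D (FO F a)) (Ob C), F)"
  "Cmp (functor_category C D) (E', \<psi>, E'') (F, \<theta>, F') = (F, restrict (\<lambda>a. \<psi> a \<cdot>\<^bsub>D\<^esub> \<theta> a) (Ob C), E'')"
  by (simp_all add: functor_category_def)

lemma nat_transf_underlying:
  assumes G: "group G" and F: "symmetric_monoidal_functor (FG G) S F" and F': "symmetric_monoidal_functor (FG G) S F'"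
    and \<theta>: "monoidal_transf (FG G) S F \<theta> F'"
  shows "nat_transf (one_object_cat G) (CommMon S) (underlying G S F)
    (\<lambda>u. (image_mon S F (gen_mon G), \<theta> 1, image_mon S F' (gen_mon G))) (underlying G S F')"
proof -
  interpret G: group G by fact
  interpret F: symmetric_monoidal_functor "FG G" S F by fact
  interpret F': symmetric_monoidal_functor "FG G" S F' by fact
  note c = is_comm_monoid_gen_mon[OF G]
  have n: "\<theta> 1 \<cdot>\<^bsub>S\<^esub> FA F (act g) = FA F' (act g) \<cdot>\<^bsub>S\<^esub> \<theta> 1" if "g \<in> carrier G" for g
    using monoidal_transfD(4)[OF \<theta>, of "act g"] act_Arr[OF that] by simp
  show ?thesis
    using F.is_comm_monoid_image_mon[OF c] F'.is_comm_monoid_image_mon[OF c]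
      is_monoid_hom_transf[OF F F' \<theta> c] n
    by (auto simp: nat_transf_def gen_mon_sel(1))
qed

lemma fully_faithful_underlying_functor:
  fixes S :: "('o, 'm) smc" and G :: "('g, 'b) monoid_scheme"
  assumes G: "group G" and S: "symmetric_monoidal_category S"
  shows "fully_faithful (Alg (FG G) S) (G_comm_monoids G S) (underlying_functor G S)"
proof -
  interpret G: group G by fact
  interpret FG: prop_cat "FG G" by (rule prop_cat_FG[OF G])
  interpret A: category "Alg (FG G) S"
    by (intro category_Alg S FG.symmetric_monoidal_category_axioms)
  interpret M: category "G_comm_monoids G S" by (intro category_G_comm_monoids G S)
  let ?i = "\<lambda>F. image_mon S F (gen_mon G)"
  note c = is_comm_monoid_gen_mon[OF G]
  have Arr: "(F, \<theta>, F') \<in> Arr (Alg (FG G) S) \<Longrightarrow> (underlying G S F, (\<lambda>u. (?i F, \<theta> 1, ?i F')), underlying G S F')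
      \<in> Arr (G_comm_monoids G S)" for F \<theta> F'
    using nat_transf_underlying[OF G, of S F F' \<theta>] by (simp add: cat_functor_underlying[OF G])
  have "cat_functor (Alg (FG G) S) (G_comm_monoids G S) (underlying_functor G S)"
  proof (unfold_locales, goal_cases)
    case (3 F) then show ?case by (simp add: cat_functor_underlying[OF G])
  next case (4 f F F')
    then show ?case using Arr by (cases f) auto
  next case (5 F)
    then show ?case using A.Id_Arr(1)[of F] by (auto simp: fun_eq_iff gen_mon_sel(1) FG_sel(1))
  next case (6 f F F' g F'')
    then have "g \<cdot>\<^bsub>Alg (FG G) S\<^esub> f \<in> Arr (Alg (FG G) S)" by simp
    then show ?case using 6 by (cases f; cases g) (auto simp: FG_sel(1) fun_eq_iff)
  qed simp_all
  moreover have "\<exists>!f. f \<in> Hom (Alg (FG G) S) F F' \<and> FA (underlying_functor G S) f = g"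
    if F: "symmetric_monoidal_functor (FG G) S F" and F': "symmetric_monoidal_functor (FG G) S F'"
      and g: "g \<in> Hom (G_comm_monoids G S) (underlying G S F) (underlying G S F')" for F F' g
  proof -
    obtain \<kappa> where \<kappa>: "g = (underlying G S F, \<kappa>, underlying G S F')" using g by (cases g) auto
    obtain h where h: "\<kappa> = (\<lambda>u. (?i F, h, ?i F'))" "is_monoid_hom S (?i F) h (?i F')"
    proof -
      have n: "\<kappa> () \<in> Hom (CommMon S) (?i F) (?i F')" using g \<kappa> by (auto simp: nat_transf_def)
      obtain h where "\<kappa> () = (?i F, h, ?i F')" using n by (cases "\<kappa> ()") auto
      then show thesis using n by (intro that[of h]) (auto simp: fun_eq_iff)
    qed
    have eq: "h \<cdot>\<^bsub>S\<^esub> FA F (act x) = FA F' (act x) \<cdot>\<^bsub>S\<^esub> h" if "x \<in> carrier G" for x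
      using g that unfolding \<kappa> h(1) by (auto simp: nat_transf_def)
    \<comment> \<open>The extension of \<open>h\<close> gives fullness;
      \<open>monoidal_transf_unique\<close> shows that there is no other preimage.\<close>
    interpret E: alg_hom_extension G S F F' h
      by (intro alg_hom_extension.intro alg_hom_extension_axioms.intro F F' G h(2) eq)
    have "f \<in> Hom (Alg (FG G) S) F F' \<and> FA (underlying_functor G S) f = g \<longleftrightarrow> f = (F, E.ext, F')" for f
    proof
      assume f: "f \<in> Hom (Alg (FG G) S) F F' \<and> FA (underlying_functor G S) f = g"
      then obtain \<theta> where \<theta>: "f = (F, \<theta>, F')" "monoidal_transf (FG G) S F \<theta> F'" by (cases f) auto
      have "\<theta> 1 = h" using f unfolding \<theta>(1) \<kappa> h(1) by (auto simp: fun_eq_iff)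
      then have "\<theta> = E.ext"
        using monoidal_transf_unique[OF F F' \<theta>(2) E.monoidal_transf_ext] E.ext_1 by simp
      then show "f = (F, E.ext, F')" using \<theta> by simp
    next
      assume f: "f = (F, E.ext, F')"
      show "f \<in> Hom (Alg (FG G) S) F F' \<and> FA (underlying_functor G S) f = g"
        using F F' E.monoidal_transf_ext E.ext_1 unfolding f \<kappa> h(1) by simp
    qed
    then show ?thesis by simp
  qed
  ultimately show ?thesis unfolding fully_faithful_def by auto
qed

section \<open>Essential surjectivity\<close>

context symmetric_monoidal_category
begin

text \<open>Serves to replace a monoid on \<open>X\<close> by an isomorphic one on the first power
  \<open>X \<boxtimes> I\<close>.\<close>

definition transport_mon :: "('o, 'm) mon \<Rightarrow> 'm \<Rightarrow> ('o, 'm) mon"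
  where "transport_mon M q = \<lparr>obj = Dom S q, mu = inv_arr S q \<cdot> mu M \<cdot> (q \<odot> q), eta = inv_arr S q \<cdot> eta M\<rparr>"

lemma transport_mon_sel [simp]:
  "obj (transport_mon M q) = Dom S q" "mu (transport_mon M q) = inv_arr S q \<cdot> mu M \<cdot> (q \<odot> q)"
  "eta (transport_mon M q) = inv_arr S q \<cdot> eta M"
  by (auto simp: transport_mon_def)

lemma transport_mon:
  assumes M: "is_comm_monoid S M" and q: "iso_arr S q" "Cod S q = obj M"
  shows "is_comm_monoid S (transport_mon M q)"
    "is_monoid_hom S (transport_mon M q) q M" "is_monoid_hom S M (inv_arr S q) (transport_mon M q)"
proof -
  note [simp] = is_comm_monoidD[OF M] q iso_Arr[OF q(1)]
  let ?x = "obj M" and ?y = "Dom S q" and ?m = "mu M" and ?r = "inv_arr S q"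
  let ?n = "?r \<cdot> ?m \<cdot> (q \<odot> q)"
  have as: "?m \<cdot> (?m \<odot> Id S ?x) = ?m \<cdot> (Id S ?x \<odot> ?m) \<cdot> asc S ?x ?x ?x"
    and ul: "?m \<cdot> (eta M \<odot> Id S ?x) = lun S ?x" and ur: "?m \<cdot> (Id S ?x \<odot> eta M) = run S ?x"
    and cm: "?m \<cdot> sym S ?x ?x = ?m"
    using M unfolding is_comm_monoid_def by blast+
  have 1: "?n \<cdot> (?n \<odot> Id S ?y) = ?n \<cdot> (Id S ?y \<odot> ?n) \<cdot> asc S ?y ?y ?y"
  proof -
    have "?n \<cdot> (?n \<odot> Id S ?y) = ?r \<cdot> (?m \<cdot> (?m \<odot> Id S ?x)) \<cdot> ((q \<odot> q) \<odot> q)"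
      by (simp add: interchange)
    also have "\<dots> = ?r \<cdot> ?m \<cdot> (Id S ?x \<odot> ?m) \<cdot> asc S ?x ?x ?x \<cdot> ((q \<odot> q) \<odot> q)"
      unfolding as by simp
    also have "\<dots> = ?n \<cdot> (Id S ?y \<odot> ?n) \<cdot> asc S ?y ?y ?y"
      by (simp add: asc_natural interchange_Cmp)
    finally show ?thesis .
  qed
  have "?n \<cdot> ((?r \<cdot> eta M) \<odot> Id S ?y) = ?r \<cdot> (?m \<cdot> (eta M \<odot> Id S ?x)) \<cdot> (Id S (unitO S) \<odot> q)"
    by (simp add: interchange)
  then have 2: "?n \<cdot> ((?r \<cdot> eta M) \<odot> Id S ?y) = lun S ?y" unfolding ul by (simp add: lun_natural)
  have "?n \<cdot> (Id S ?y \<odot> (?r \<cdot> eta M)) = ?r \<cdot> (?m \<cdot> (Id S ?x \<odot> eta M)) \<cdot> (q \<odot> Id S (unitO S))"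
    by (simp add: interchange)
  then have 3: "?n \<cdot> (Id S ?y \<odot> (?r \<cdot> eta M)) = run S ?y" unfolding ur by (simp add: run_natural)
  have "?n \<cdot> sym S ?y ?y = ?r \<cdot> (?m \<cdot> sym S ?x ?x) \<cdot> (q \<odot> q)"
    by (simp add: sym_natural)
  then have 4: "?n \<cdot> sym S ?y ?y = ?n" unfolding cm .
  have 5: "?y \<in> Ob S" "?n \<in> Hom S (?y \<boxtimes> ?y) ?y" "?r \<cdot> eta M \<in> Hom S (unitO S) ?y" by simp_all
  show "is_comm_monoid S (transport_mon M q)"
    unfolding is_comm_monoid_def transport_mon_sel using 1 2 3 4 5 by blast
  show "is_monoid_hom S (transport_mon M q) q M"
    by (simp add: is_monoid_hom_def)
  show "is_monoid_hom S M (inv_arr S q) (transport_mon M q)"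
    by (simp add: is_monoid_hom_def interchange)
qed

end

text \<open>Stated with a strict functor \<open>K\<close> into the endomorphism PROP instead of an
  algebra in \<open>S\<close>, because \<open>K\<close> can then be realized as a strong algebra or,
  for strict \<open>S\<close>, as a strict one.\<close>

lemma realization:
  fixes S :: "('o, 'm) smc" and G :: "('g, 'b) monoid_scheme"
  assumes G: "group G" and S: "symmetric_monoidal_category S"
    and H: "cat_functor (one_object_cat G) (CommMon S) H"
  obtains X K g where "X \<in> Ob S"
    "symmetric_strict_monoidal_functor (FG G) (tensor_powers.end_prop S X) K"
    "g \<in> Hom (G_comm_monoids G S) (underlying G S (tensor_powers.mrealize S X (FG G) K)) H"
    "iso_arr (G_comm_monoids G S) g"
proof -
  interpret G: group G by fact
  interpret S: symmetric_monoidal_category S by fact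
  interpret FG: prop_cat "FG G" by (rule prop_cat_FG[OF G])
  interpret H: cat_functor "one_object_cat G" "CommMon S" H by fact
  let ?M = "FO H ()"
  have M: "is_comm_monoid S ?M" using H.FO_Ob[of "()"] by simp
  define r where "r g = fst (snd (FA H g))" for g
  have FAH: "FA H g = (?M, r g, ?M)" "is_monoid_hom S ?M (r g) ?M" if "g \<in> carrier G" for g
    using H.FA_Hom[of g "()" "()"] that by (cases "FA H g"; auto simp: r_def)+
  have r1: "r \<one>\<^bsub>G\<^esub> = Id S (obj ?M)" using H.FA_Id[of "()"] by (simp add: r_def)
  have rm: "r (g \<otimes>\<^bsub>G\<^esub> h) = r g \<cdot>\<^bsub>S\<^esub> r h" if "g \<in> carrier G" "h \<in> carrier G" for g h
    using H.FA_Cmp'[of h g] that by (simp add: FAH)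
  have rA: "r g \<in> Arr S" "Dom S (r g) = obj ?M" "Cod S (r g) = obj ?M" if "g \<in> carrier G" for g
    using S.is_monoid_homD(1-3)[OF FAH(2)[OF that]] .
  define X where "X = obj ?M"
  interpret P: tensor_powers S X
    using S.is_comm_monoidD(1)[OF M] by unfold_locales (simp add: X_def)
  \<comment> \<open>\<open>pw 1\<close> is \<open>X \<boxtimes> I\<close>, so the monoid and the
    action have to be carried over from \<open>X\<close> along the right unitor.\<close>
  define q where "q = run S X"
  have q [simp]: "iso_arr S q" "q \<in> Arr S" "Cod S q = X" "Dom S q = P.pw 1"
    by (simp_all add: q_def)
  define N where "N = S.transport_mon ?M q"
  note N = S.transport_mon[OF M q(1) q(3)[unfolded X_def], folded N_def]
  have objN: "obj N = P.pw 1" by (simp add: N_def)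
  define r' where "r' g = inv_arr S q \<cdot>\<^bsub>S\<^esub> r g \<cdot>\<^bsub>S\<^esub> q" for g
  have r'_hom: "is_monoid_hom S N (r' g) N" if "g \<in> carrier G" for g
    unfolding r'_def
    by (intro S.is_monoid_hom_Cmp[OF N(1) M N(1) _ N(3)] S.is_monoid_hom_Cmp[OF N(1) M M N(2)] FAH(2) that)
  define A where "A = P.end_mon 1 N"
  define \<rho> where "\<rho> g = (1::nat, r' g, 1::nat)" for g
  interpret E: prop_cat P.end_prop by (rule P.prop_cat_end_prop)
  interpret L: prop_G_monoid P.end_prop G A \<rho>
  proof
    show "is_comm_monoid P.end_prop A" unfolding A_def by (intro P.is_comm_monoid_end_mon N(1) objN)
    show "obj A = 1" by (simp add: A_def)
    show "is_monoid_hom P.end_prop A (\<rho> g) A" if "g \<in> carrier G" for g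
      unfolding A_def \<rho>_def by (intro P.is_monoid_hom_end_mon N(1) objN r'_hom that)
    show "\<rho> \<one>\<^bsub>G\<^esub> = Id P.end_prop (obj A)"
      by (simp add: \<rho>_def A_def r'_def r1 X_def[symmetric])
    show "\<rho> (g \<otimes>\<^bsub>G\<^esub> h) = \<rho> g \<cdot>\<^bsub>P.end_prop\<^esub> \<rho> h" if "g \<in> carrier G" "h \<in> carrier G" for g h
      using that by (simp add: \<rho>_def r'_def rm rA X_def[symmetric])
  qed
  note K = L.symmetric_strict_monoidal_functor_lift
  note gen = FG.is_comm_monoidD[OF is_comm_monoid_gen_mon[OF G], unfolded gen_mon_sel(1)]
  have Kmu: "FA L.lift_functor (mu (gen_mon G)) = mu A"
    using L.lift_eqI[OF L.represents_mu] gen(2) unfolding L.lift_functor_sel gen_mon_sel by simp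
  have Keta: "FA L.lift_functor (eta (gen_mon G)) = eta A"
    using L.lift_eqI[OF L.represents_eta] gen(5) unfolding L.lift_functor_sel gen_mon_sel by simp
  have Kact: "FA L.lift_functor (act g) = \<rho> g" if "g \<in> carrier G" for g
    using L.lift_eqI[OF L.represents_action[OF that]] act_Arr[OF that] unfolding L.lift_functor_sel act_def by simp
  let ?R = "P.mrealize (FG G) L.lift_functor"
  have NA: "mu N \<in> Arr S" "Dom S (mu N) = P.pw 1 \<boxtimes>\<^bsub>S\<^esub> P.pw 1" "eta N \<in> Arr S" "Dom S (eta N) = unitO S"
    using S.is_comm_monoidD[OF N(1)] objN by simp_all
  have A_sel: "fst (snd (mu A)) = mu N \<cdot>\<^bsub>S\<^esub> inv_arr S (P.J (Suc 0) (Suc 0))" "fst (snd (eta A)) = eta N"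
    by (simp_all add: A_def)
  \<comment> \<open>An equality and not just an isomorphism: the comparison arrow \<open>J\<close>
    of \<open>mrealize\<close> cancels the inverse of \<open>J\<close> in
    \<open>end_mon\<close>.\<close>
  have img: "image_mon S ?R (gen_mon G) = N"
  proof (rule mon.equality)
    show "obj (image_mon S ?R (gen_mon G)) = obj N"
      by (simp add: gen_mon_sel(1) L.lift_functor_sel FG_sel(1) objN)
    show "mu (image_mon S ?R (gen_mon G)) = mu N"
      using gen(2) NA by (simp add: gen_mon_sel(1) Kmu FG_sel(1) A_sel L.lift_functor_sel(1) del: P.J.simps P.pw.simps)
    show "eta (image_mon S ?R (gen_mon G)) = eta N"
      using gen(5) NA by (simp add: gen_mon_sel(1) Keta FG_sel(1) A_sel del: P.pw.simps)
  qed simp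
  have FAR: "act g \<in> Arr (FG G)" "fst (snd (FA L.lift_functor (act g))) = r' g" if "g \<in> carrier G" for g
    unfolding Kact[OF that] using act_Arr[OF that] by (simp_all add: \<rho>_def)
  have U: "cat_functor (one_object_cat G) (CommMon S) (underlying G S ?R)"
    by (intro cat_functor_underlying G P.symmetric_monoidal_functor_mrealize K)
  \<comment> \<open>\<open>q\<close> is a homomorphism by the construction of \<open>N\<close>, and
    it is equivariant because \<open>r'\<close> is \<open>r\<close> conjugated by
    \<open>q\<close>.\<close>
  let ?g = "(underlying G S ?R, \<lambda>u::unit. (N, q, ?M), H)"
  let ?h = "(H, \<lambda>u::unit. (?M, inv_arr S q, N), underlying G S ?R)"
  have g: "?g \<in> Arr (G_comm_monoids G S)"
    using N M FAH U H by (auto simp: nat_transf_def img FAR r'_def rA X_def[symmetric])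
  have h: "?h \<in> Arr (G_comm_monoids G S)"
    using N M FAH U H by (auto simp: nat_transf_def img FAR r'_def rA X_def[symmetric])
  have "inverse_arrows (G_comm_monoids G S) ?g ?h"
    unfolding inverse_arrows_def using g h by (auto simp: img objN X_def[symmetric] fun_eq_iff)
  then have "iso_arr (G_comm_monoids G S) ?g" unfolding iso_arr_def by blast
  then show thesis using that[OF P.X K _ _, of ?g] g by simp
qed

lemma weak_equivalence_underlying_functor:
  fixes S :: "('o, 'm) smc" and G :: "('g, 'b) monoid_scheme"
  assumes G: "group G" and S: "symmetric_monoidal_category S"
  shows "weak_equivalence (Alg (FG G) S) (G_comm_monoids G S) (underlying_functor G S)"
  unfolding weak_equivalence_def
proof (intro conjI ballI fully_faithful_underlying_functor G S)
  fix H assume "H \<in> Ob (G_comm_monoids G S)"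
  then have "cat_functor (one_object_cat G) (CommMon S) H" by simp
  then obtain X K g where *: "X \<in> Ob S"
    "symmetric_strict_monoidal_functor (FG G) (tensor_powers.end_prop S X) K"
    "g \<in> Hom (G_comm_monoids G S) (underlying G S (tensor_powers.mrealize S X (FG G) K)) H"
    "iso_arr (G_comm_monoids G S) g"
    by (rule realization[OF G S])
  interpret P: tensor_powers S X
    using S *(1) by (intro tensor_powers.intro tensor_powers_axioms.intro)
  show "\<exists>F\<in>Ob (Alg (FG G) S). \<exists>g\<in>Hom (G_comm_monoids G S) (FO (underlying_functor G S) F) H. iso_arr (G_comm_monoids G S) g"
    using * P.symmetric_monoidal_functor_mrealize[OF *(2)]
    by (intro bexI[of _ "P.mrealize (FG G) K"] bexI[of _ g]) auto
qed

section \<open>Strict algebras\<close>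

text \<open>Regards strict functors as strong ones, so that full faithfulness for strict algebras
  can be inherited from \<open>Alg\<close>.\<close>

definition strict_mfunctor :: "('o1, 'm1) smc \<Rightarrow> ('o2, 'm2) smc \<Rightarrow> ('o1, 'm1, 'o2, 'm2) cfunctor \<Rightarrow> ('o1, 'm1, 'o2, 'm2) mfunctor"
  where "strict_mfunctor T S F = \<lparr>FO = FO F, FA = FA F,
    phi = restrict (\<lambda>(a, b). Id S (FO F a \<boxtimes>\<^bsub>S\<^esub> FO F b)) (Ob T \<times> Ob T), phi0 = Id S (unitO S)\<rparr>"

lemma strict_mfunctor_sel [simp]:
  "FO (strict_mfunctor T S F) = FO F" "FA (strict_mfunctor T S F) = FA F"
  "phi (strict_mfunctor T S F) = restrict (\<lambda>(a, b). Id S (FO F a \<boxtimes>\<^bsub>S\<^esub> FO F b)) (Ob T \<times> Ob T)"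
  "phi0 (strict_mfunctor T S F) = Id S (unitO S)"
  by (auto simp: strict_mfunctor_def)

lemma symmetric_monoidal_functor_strict_mfunctor:
  assumes "symmetric_strict_monoidal_functor T S F"
  shows "symmetric_monoidal_functor T S (strict_mfunctor T S F)"
proof -
  interpret F: symmetric_strict_monoidal_functor T S F by fact
  show ?thesis
    by unfold_locales
      (auto simp: F.FO_ext F.FA_ext F.strict_tensO F.strict_unitO F.strict_tensA F.strict_FA_asc
        F.strict_FA_lun F.strict_FA_run F.strict_FA_sym)
qed

lemma Alg_strict_sel [simp]:
  "Ob (Alg_strict T S) = {F. symmetric_strict_monoidal_functor T S F}"
  "Dom (Alg_strict T S) (F, \<theta>, F') = F" "Cod (Alg_strict T S) (F, \<theta>, F') = F'"
  "Id (Alg_strict T S) F = (F, restrict (\<lambda>a. Id S (FO F a)) (Ob T), F)"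
  "Cmp (Alg_strict T S) (E', \<psi>, E'') (F, \<theta>, F') = (F, restrict (\<lambda>a. \<psi> a \<cdot>\<^bsub>S\<^esub> \<theta> a) (Ob T), E'')"
  unfolding Alg_strict_def by auto

text \<open>With identity comparison arrows the compatibility condition of \<open>Alg\<close>
  becomes the strict one. This is what makes the embedding of strict algebras full.\<close>

lemma Alg_strict_Arr [simp]:
  "(F, \<theta>, F') \<in> Arr (Alg_strict T S) \<longleftrightarrow> symmetric_strict_monoidal_functor T S F \<and>
    symmetric_strict_monoidal_functor T S F' \<and>
    monoidal_transf T S (strict_mfunctor T S F) \<theta> (strict_mfunctor T S F')"
proof (cases "symmetric_strict_monoidal_functor T S F \<and> symmetric_strict_monoidal_functor T S F' \<and>
    nat_transf T S F \<theta> F'")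
  case True
  interpret F: symmetric_strict_monoidal_functor T S F using True by simp
  interpret F': symmetric_strict_monoidal_functor T S F' using True by simp
  have n: "nat_transf T S (strict_mfunctor T S F) \<theta> (strict_mfunctor T S F')"
    using True by (simp add: nat_transf_def)
  have [simp]: "\<theta> a \<in> Arr S" "Dom S (\<theta> a) = FO F a" "Cod S (\<theta> a) = FO F' a" if "a \<in> Ob T" for a
    using True that by (auto simp: nat_transf_def)
  show ?thesis unfolding Alg_strict_def monoidal_transf_def using True n
    by (simp add: F.strict_tensO F.strict_unitO)
next
  case False
  then show ?thesis by (auto simp: Alg_strict_def monoidal_transf_def nat_transf_def)
qed

definition strict_embedding :: "('o1, 'm1) smc \<Rightarrow> ('o2, 'm2) smc \<Rightarrow> _"
  where "strict_embedding T S = \<lparr>FO = restrict (strict_mfunctor T S) (Ob (Alg_strict T S)),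
    FA = restrict (\<lambda>(F, \<theta>, F'). (strict_mfunctor T S F, \<theta>, strict_mfunctor T S F')) (Arr (Alg_strict T S))\<rparr>"

lemma fully_faithful_strict_embedding:
  assumes T: "symmetric_monoidal_category T" and S: "symmetric_monoidal_category S"
  shows "fully_faithful (Alg_strict T S) (Alg T S) (strict_embedding T S)"
proof -
  let ?s = "strict_mfunctor T S"
  have sel: "FO (strict_embedding T S) = restrict ?s (Ob (Alg_strict T S))"
    "FA (strict_embedding T S) = restrict (\<lambda>(F, \<theta>, F'). (?s F, \<theta>, ?s F')) (Arr (Alg_strict T S))"
    by (simp_all add: strict_embedding_def)
  interpret A: category "Alg_strict T S" by (rule category_Alg_strict[OF T S])
  interpret B: category "Alg T S" by (rule category_Alg[OF T S])
  have "cat_functor (Alg_strict T S) (Alg T S) (strict_embedding T S)"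
  proof (unfold_locales, unfold sel, goal_cases)
    case (3 F) then show ?case by (simp add: symmetric_monoidal_functor_strict_mfunctor)
  next case (4 f F F')
    then show ?case by (cases f) (auto simp: symmetric_monoidal_functor_strict_mfunctor)
  next case (5 F)
    then show ?case using A.Id_Arr(1)[of F] by auto
  next case (6 f F F' g F'')
    then have "g \<cdot>\<^bsub>Alg_strict T S\<^esub> f \<in> Arr (Alg_strict T S)" by simp
    then show ?case using 6 by (cases f; cases g) auto
  qed simp_all
  moreover have "\<exists>!f. f \<in> Hom (Alg_strict T S) F F' \<and> FA (strict_embedding T S) f = g"
    if F: "symmetric_strict_monoidal_functor T S F" and F': "symmetric_strict_monoidal_functor T S F'"
      and g: "g \<in> Hom (Alg T S) (?s F) (?s F')" for F F' g
  proof -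
    obtain \<theta> where \<theta>: "g = (?s F, \<theta>, ?s F')" using g by (cases g) auto
    have "f \<in> Hom (Alg_strict T S) F F' \<and> FA (strict_embedding T S) f = g \<longleftrightarrow> f = (F, \<theta>, F')" for f
      using g F F' unfolding \<theta> sel by (cases f) auto
    then show ?thesis by simp
  qed
  ultimately show ?thesis unfolding fully_faithful_def sel by auto
qed

text \<open>Full faithfulness comes from the general case. Essential surjectivity does not, as the
  algebra has to be strict; it is obtained from the same functor \<open>K\<close>, realized
  strictly.\<close>

lemma weak_equivalence_Alg_strict:
  fixes S :: "('o, 'm) smc" and G :: "('g, 'b) monoid_scheme"
  assumes G: "group G" and S: "symmetric_strict_monoidal_category S"
  shows "weak_equivalence (Alg_strict (FG G) S) (G_comm_monoids G S)
    (comp_functor (Alg_strict (FG G) S) (underlying_functor G S) (strict_embedding (FG G) S))"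
    (is "weak_equivalence _ _ ?E")
proof -
  interpret S: symmetric_strict_monoidal_category S by fact
  interpret FG: prop_cat "FG G" by (rule prop_cat_FG[OF G])
  have S': "symmetric_monoidal_category S" by unfold_locales
  show ?thesis unfolding weak_equivalence_def
  proof (intro conjI ballI fully_faithful_comp[of _ "Alg (FG G) S"] fully_faithful_underlying_functor
      fully_faithful_strict_embedding G S' FG.symmetric_monoidal_category_axioms)
    fix H assume "H \<in> Ob (G_comm_monoids G S)"
    then have "cat_functor (one_object_cat G) (CommMon S) H" by simp
    then obtain X K g where *: "X \<in> Ob S"
      "symmetric_strict_monoidal_functor (FG G) (tensor_powers.end_prop S X) K"
      "g \<in> Hom (G_comm_monoids G S) (underlying G S (tensor_powers.mrealize S X (FG G) K)) H"
      "iso_arr (G_comm_monoids G S) g"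
      by (rule realization[OF G S'])
    interpret P: strict_tensor_powers S X
      using S S' *(1) by (intro strict_tensor_powers.intro tensor_powers.intro tensor_powers_axioms.intro)
    let ?R = "P.realize (FG G) K"
    have R: "symmetric_strict_monoidal_functor (FG G) S ?R"
      by (rule P.symmetric_strict_monoidal_functor_realize[OF *(2)])
    \<comment> \<open>For strict \<open>S\<close> every \<open>J\<close> is an identity, so the
      strict realization, viewed as a strong functor, is the general one.\<close>
    have "strict_mfunctor (FG G) S ?R = P.mrealize (FG G) K"
      by (rule mfunctor.equality) (auto simp: P.J_Id P.pw_add intro!: restrict_ext)
    then have "FO ?E ?R = underlying G S (P.mrealize (FG G) K)"
      using R symmetric_monoidal_functor_strict_mfunctor[OF R]
      by (simp add: comp_functor_def strict_embedding_def)
    then show "\<exists>F\<in>Ob (Alg_strict (FG G) S). \<exists>g\<in>Hom (G_comm_monoids G S) (FO ?E F) H. iso_arr (G_comm_monoids G S) g"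
      using * R by (intro bexI[of _ ?R] bexI[of _ g]) auto
  qed
qed

theorem proposition4p2:
  fixes S :: "('o, 'm) smc" and G :: "('g, 'b) monoid_scheme"
  assumes "symmetric_monoidal_category S" and "group G"
  shows "equivalent_categories (Alg (FG G) S) (G_comm_monoids G S) \<and>
         equivalent_categories (Alg (op_smc (FG G)) S) (G_cocomm_comonoids G S) \<and>
         (symmetric_strict_monoidal_category S \<longrightarrow>
            equivalent_categories (Alg_strict (FG G) S) (G_comm_monoids G S) \<and>
            equivalent_categories (Alg_strict (op_smc (FG G)) S) (G_cocomm_comonoids G S))"
proof (intro conjI impI)
  note S = assms(1) and G = assms(2)
  interpret FG: prop_cat "FG G" by (rule prop_cat_FG[OF G])
  have FG: "symmetric_monoidal_category (FG G)" by unfold_locales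
  have opS: "symmetric_monoidal_category (op_smc S)" by (rule symmetric_monoidal_category_op[OF S])
  obtain C where C: "weak_equivalence (op_cat (G_comm_monoids G (op_smc S))) (G_cocomm_comonoids G S) C"
    using weak_equivalence_dual_comonoids[OF S G] by blast
  show "equivalent_categories (Alg (FG G) S) (G_comm_monoids G S)"
    by (rule weak_equivalence_imp_equivalent[OF weak_equivalence_underlying_functor[OF G S]])
  \<comment> \<open>The chain leads from \<open>Alg (op_smc (FG G)) S\<close> to the opposite of
    \<open>Alg (FG G) (op_smc S)\<close>, then to the opposite of the G-monoids in
    \<open>op_smc S\<close>, and from there to the G-comonoids in \<open>S\<close>.\<close>
  obtain D where D: "weak_equivalence (Alg (op_smc (FG G)) S) (op_cat (Alg (FG G) (op_smc S))) D"
    using weak_equivalence_dual_Alg[OF FG S] by blast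
  show "equivalent_categories (Alg (op_smc (FG G)) S) (G_cocomm_comonoids G S)"
    by (rule weak_equivalence_imp_equivalent[OF weak_equivalence_comp[OF weak_equivalence_comp[OF D
      weak_equivalence_op[OF weak_equivalence_underlying_functor[OF G opS]]] C]])
  assume strict: "symmetric_strict_monoidal_category S"
  show "equivalent_categories (Alg_strict (FG G) S) (G_comm_monoids G S)"
    by (rule weak_equivalence_imp_equivalent[OF weak_equivalence_Alg_strict[OF G strict]])
  obtain D' where D': "weak_equivalence (Alg_strict (op_smc (FG G)) S) (op_cat (Alg_strict (FG G) (op_smc S))) D'"
    using weak_equivalence_dual_Alg_strict[OF FG S] by blast
  show "equivalent_categories (Alg_strict (op_smc (FG G)) S) (G_cocomm_comonoids G S)"
    by (rule weak_equivalence_imp_equivalent[OF weak_equivalence_comp[OF weak_equivalence_comp[OF D'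
      weak_equivalence_op[OF weak_equivalence_Alg_strict[OF G symmetric_strict_monoidal_category_op[OF strict]]]] C]])
qed

end
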